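(* Let $\mathcal I=[0,b)$, $0<b\le+\infty$, let $0=x_0<x_1<x_2<\dots<b$ with $\lim_{n\to\infty}x_n=b$, put $d_n=x_n-x_{n-1}$ and assume $d^*=\sup_{n\in\mathbb N}d_n<+\infty$. Let $\mathrm H_n=-\frac{\mathrm d^2}{\mathrm dx^2}$ in $L^2[x_{n-1},x_n]$ with $\operatorname{dom}(\mathrm H_n)=W_0^{2,2}[x_{n-1},x_n]$, and $\mathrm H_{\min}=\bigoplus_{n=1}^\infty\mathrm H_n$. Define mappings $\Gamma_j^{(n)}:W^{2,2}[x_{n-1},x_n]\to\mathbb C^2$, $n\in\mathbb N$, $j=0,1$, by $$\Gamma_0^{(n)}f:=\begin{pmatrix} d_n^{1/2}f(x_{n-1}+)\\ -d_n^{1/2}f(x_n-)\end{pmatrix},\qquad \Gamma_1^{(n)}f:=\begin{pmatrix}\dfrac{d_nf'(x_{n-1}+)+\bigl(f(x_{n-1}+)-f(x_n-)\bigr)}{d_n^{3/2}}\\[2mm] \dfrac{d_nf'(x_n-)+\bigl(f(x_{n-1}+)-f(x_n-)\bigr)}{d_n^{3/2}}\end{pmatrix}.$$ Then: (i) For any $n\in\mathbb N$ the triplet $\Pi_n=\{\mathbb C^2,\Gamma_0^{(n)},\Gamma_1^{(n)}\}$ is a boundary triplet for $\mathrm H_n^*$. (ii) The direct sum $\Pi=\bigoplus_{n=1}^\infty\Pi_n$ is a boundary triplet for the operator $\mathrm H_{\min}^*$.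
   Context: $W^{2,2}[c,d]$ is the usual Sobolev space on the interval and $W^{2,2}_0[c,d]=\{f\in W^{2,2}[c,d]:f(c)=f'(c)=f(d)=f'(d)=0\}$; $\mathrm H_n^*=-\mathrm d^2/\mathrm dx^2$ on $W^{2,2}[x_{n-1},x_n]$. Boundary triplet: for a densely defined closed symmetric operator $S$ in a Hilbert space with equal deficiency indices, $\{\mathcal G,\Gamma_0,\Gamma_1\}$ is an (ordinary) boundary triplet for $S^*$ if $\mathcal G$ is a Hilbert space and $\Gamma_0,\Gamma_1:\operatorname{dom}(S^* )\to\mathcal G$ are linear mappings defined on all of $\operatorname{dom}(S^* )$, bounded with respect to the graph norm, such that $(S^*f,g)-(f,S^*g)=(\Gamma_1f,\Gamma_0g)_{\mathcal G}-(\Gamma_0f,\Gamma_1g)_{\mathcal G}$ for all $f,g\in\operatorname{dom}(S^* )$ and $\{\Gamma_0,\Gamma_1\}:\operatorname{dom}(S^* )\to\mathcal G\oplus\mathcal G$ is surjective. Direct sum: $\bigoplus_n\Pi_n=\{\mathcal H,\Gamma_0,\Gamma_1\}$ with $\mathcal H=\bigoplus_n\mathbb C^2=l_2(\mathbb N,\mathbb C^2)$, $\Gamma_j=\bigoplus_n\Gamma_j^{(n)}$, $\operatorname{dom}(\Gamma_j)=\{f=\bigoplus f_n\in\operatorname{dom}(\mathrm H_{\min}^* ):\sum_n\|\Gamma_j^{(n)}f_n\|^2<\infty\}$. That it is a boundary triplet for $\mathrm H_{\min}^*$ includes $\operatorname{dom}(\Gamma_0)=\operatorname{dom}(\Gamma_1)=\operatorname{dom}(\mathrm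 H_{\min}^* )$. *)

theory Defs
  imports "HOL-Analysis.Analysis" "HOL-Library.Equipollence"
begin

section \<open>Complex Hilbert spaces\<close>

record 'a inner_space =
  carrier :: "'a set"
  vadd :: "'a \<Rightarrow> 'a \<Rightarrow> 'a"
  vzero :: 'a
  vscale :: "complex \<Rightarrow> 'a \<Rightarrow> 'a"
  ip :: "'a \<Rightarrow> 'a \<Rightarrow> complex"

text \<open>The inner product is linear in its first argument.\<close>

locale complex_inner_space =
  fixes H :: "'a inner_space"
  assumes add_closed: "u \<in> carrier H \<Longrightarrow> v \<in> carrier H \<Longrightarrow> vadd H u v \<in> carrier H"
    and zero_closed: "vzero H \<in> carrier H"
    and scale_closed: "u \<in> carrier H \<Longrightarrow> vscale H a u \<in> carrier H"
    and add_assoc: "u \<in> carrier H \<Longrightarrow> v \<in> carrier H \<Longrightarrow> w \<in> carrier H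
          \<Longrightarrow> vadd H (vadd H u v) w = vadd H u (vadd H v w)"
    and add_commute: "u \<in> carrier H \<Longrightarrow> v \<in> carrier H \<Longrightarrow> vadd H u v = vadd H v u"
    and add_zero: "u \<in> carrier H \<Longrightarrow> vadd H u (vzero H) = u"
    and add_inverse: "u \<in> carrier H \<Longrightarrow> vadd H u (vscale H (-1) u) = vzero H"
    and scale_one: "u \<in> carrier H \<Longrightarrow> vscale H 1 u = u"
    and scale_scale: "u \<in> carrier H \<Longrightarrow> vscale H a (vscale H a' u) = vscale H (a * a') u"
    and scale_add: "u \<in> carrier H \<Longrightarrow> v \<in> carrier H
          \<Longrightarrow> vscale H a (vadd H u v) = vadd H (vscale H a u) (vscale H a v)"
    and add_scale: "u \<in> carrier H
          \<Longrightarrow> vscale H (a + a') u = vadd H (vscale H a u) (vscale H a' u)"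
    and ip_add: "u \<in> carrier H \<Longrightarrow> v \<in> carrier H \<Longrightarrow> w \<in> carrier H
          \<Longrightarrow> ip H (vadd H u v) w = ip H u w + ip H v w"
    and ip_scale: "u \<in> carrier H \<Longrightarrow> v \<in> carrier H \<Longrightarrow> ip H (vscale H a u) v = a * ip H u v"
    and ip_cnj: "u \<in> carrier H \<Longrightarrow> v \<in> carrier H \<Longrightarrow> ip H v u = cnj (ip H u v)"
    and ip_nonneg: "u \<in> carrier H \<Longrightarrow> 0 \<le> Re (ip H u u)"
    and ip_definite: "u \<in> carrier H \<Longrightarrow> ip H u u = 0 \<Longrightarrow> u = vzero H"

definition vnorm :: "'a inner_space \<Rightarrow> 'a \<Rightarrow> real" where
  "vnorm H u = sqrt (Re (ip H u u))"

text \<open>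
  The value outside the carrier is irrelevant, and is set to 0 because \<open>Metric_space\<close> asks for
  symmetry and nonnegativity on the whole type.
\<close>

definition vdist :: "'a inner_space \<Rightarrow> 'a \<Rightarrow> 'a \<Rightarrow> real" where
  "vdist H u v =
     (if u \<in> carrier H \<and> v \<in> carrier H then vnorm H (vadd H u (vscale H (-1) v)) else 0)"

definition vtop :: "'a inner_space \<Rightarrow> 'a topology" where
  "vtop H = Metric_space.mtopology (carrier H) (vdist H)"

definition hilbert_space :: "'a inner_space \<Rightarrow> bool" where
  "hilbert_space H \<longleftrightarrow>
     complex_inner_space H \<and> Metric_space.mcomplete (carrier H) (vdist H)"

definition C2 :: "(complex ^ 2) inner_space" where
  "C2 = \<lparr>carrier = UNIV, vadd = (+), vzero = 0, vscale = (*s),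
         ip = (\<lambda>u v. \<Sum>i\<in>UNIV. u $ i * cnj (v $ i))\<rparr>"

definition dsum_space :: "(nat \<Rightarrow> 'a inner_space) \<Rightarrow> (nat \<Rightarrow> 'a) inner_space" where
  "dsum_space H =
     \<lparr>carrier = {f. (\<forall>n. f n \<in> carrier (H n)) \<and> summable (\<lambda>n. (vnorm (H n) (f n))\<^sup>2)},
      vadd = (\<lambda>f g n. vadd (H n) (f n) (g n)),
      vzero = (\<lambda>n. vzero (H n)),
      vscale = (\<lambda>a f n. vscale (H n) a (f n)),
      ip = (\<lambda>f g. \<Sum>n. ip (H n) (f n) (g n))\<rparr>"


section \<open>Unbounded operators and boundary triplets\<close>

text \<open>
  A partially defined operator is a map \<open>'a \<rightharpoonup> 'b\<close>; its domain is the \<open>dom\<close> of the map.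
\<close>

definition linear_op :: "'a inner_space \<Rightarrow> 'b inner_space \<Rightarrow> ('a \<rightharpoonup> 'b) \<Rightarrow> bool" where
  "linear_op H K T \<longleftrightarrow>
     dom T \<subseteq> carrier H \<and> ran T \<subseteq> carrier K \<and> vzero H \<in> dom T \<and>
     (\<forall>f\<in>dom T. \<forall>g\<in>dom T. T (vadd H f g) = Some (vadd K (the (T f)) (the (T g)))) \<and>
     (\<forall>a. \<forall>f\<in>dom T. T (vscale H a f) = Some (vscale K a (the (T f))))"

definition densely_defined :: "'a inner_space \<Rightarrow> ('a \<rightharpoonup> 'a) \<Rightarrow> bool" where
  "densely_defined H S \<longleftrightarrow> vtop H closure_of dom S = carrier H"

definition closed_op :: "'a inner_space \<Rightarrow> ('a \<rightharpoonup> 'a) \<Rightarrow> bool" where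
  "closed_op H S \<longleftrightarrow>
     (\<forall>F f g. (\<forall>k::nat. F k \<in> dom S) \<longrightarrow> limitin (vtop H) F f sequentially \<longrightarrow>
        limitin (vtop H) (\<lambda>k. the (S (F k))) g sequentially \<longrightarrow> S f = Some g)"

definition symmetric_op :: "'a inner_space \<Rightarrow> ('a \<rightharpoonup> 'a) \<Rightarrow> bool" where
  "symmetric_op H S \<longleftrightarrow> (\<forall>f\<in>dom S. \<forall>g\<in>dom S. ip H (the (S f)) g = ip H f (the (S g)))"

text \<open>The choice of \<open>h\<close> below is unique when \<open>S\<close> is densely defined.\<close>

definition adj :: "'a inner_space \<Rightarrow> ('a \<rightharpoonup> 'a) \<Rightarrow> ('a \<rightharpoonup> 'a)" where
  "adj H S = (\<lambda>g.
     if g \<in> carrier H \<and> (\<exists>h\<in>carrier H. \<forall>f\<in>dom S. ip H (the (S f)) g = ip H f h)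
     then Some (THE h. h \<in> carrier H \<and> (\<forall>f\<in>dom S. ip H (the (S f)) g = ip H f h))
     else None)"

definition deficiency_space :: "'a inner_space \<Rightarrow> ('a \<rightharpoonup> 'a) \<Rightarrow> complex \<Rightarrow> 'a set" where
  "deficiency_space H S z = {f \<in> dom (adj H S). adj H S f = Some (vscale H z f)}"

text \<open>A Hilbert basis of a subspace \<open>N\<close>, as a maximal orthonormal subset of \<open>N\<close>.\<close>

definition orthonormal_basis :: "'a inner_space \<Rightarrow> 'a set \<Rightarrow> 'a set \<Rightarrow> bool" where
  "orthonormal_basis H N B \<longleftrightarrow>
     B \<subseteq> N \<and> (\<forall>e\<in>B. \<forall>e'\<in>B. ip H e e' = (if e = e' then 1 else 0)) \<and>
     (\<forall>f\<in>N. (\<forall>e\<in>B. ip H f e = 0) \<longrightarrow> f = vzero H)"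

text \<open>
  The deficiency indices are the (possibly infinite) Hilbert dimensions of
  \<open>ker (S* - i)\<close> and \<open>ker (S* + i)\<close>; they are compared as cardinals.
\<close>

definition equal_deficiency_indices :: "'a inner_space \<Rightarrow> ('a \<rightharpoonup> 'a) \<Rightarrow> bool" where
  "equal_deficiency_indices H S \<longleftrightarrow>
     (\<exists>B B'. orthonormal_basis H (deficiency_space H S \<i>) B \<and>
             orthonormal_basis H (deficiency_space H S (- \<i>)) B' \<and> B \<approx> B')"

text \<open>
  \<open>boundary_triplet H S G \<Gamma>\<^sub>0 \<Gamma>\<^sub>1\<close>: \<open>{G, \<Gamma>\<^sub>0, \<Gamma>\<^sub>1}\<close> is a boundary triplet for the adjoint of the
  operator \<open>S\<close> in the Hilbert space \<open>H\<close>.  The hypotheses on \<open>S\<close> under which the notion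
  makes sense are part of the predicate.
\<close>

definition boundary_triplet ::
  "'a inner_space \<Rightarrow> ('a \<rightharpoonup> 'a) \<Rightarrow> 'g inner_space \<Rightarrow> ('a \<rightharpoonup> 'g) \<Rightarrow> ('a \<rightharpoonup> 'g) \<Rightarrow> bool" where
  "boundary_triplet H S G \<Gamma>\<^sub>0 \<Gamma>\<^sub>1 \<longleftrightarrow>
     hilbert_space H \<and> linear_op H H S \<and> densely_defined H S \<and> closed_op H S \<and>
     symmetric_op H S \<and> equal_deficiency_indices H S \<and>
     hilbert_space G \<and>
     (\<forall>\<Gamma>\<in>{\<Gamma>\<^sub>0, \<Gamma>\<^sub>1}. dom \<Gamma> = dom (adj H S) \<and> linear_op H G \<Gamma> \<and>
        (\<exists>C. \<forall>f\<in>dom (adj H S).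
           vnorm G (the (\<Gamma> f)) \<le> C * sqrt ((vnorm H f)\<^sup>2 + (vnorm H (the (adj H S f)))\<^sup>2))) \<and>
     (\<forall>f\<in>dom (adj H S). \<forall>g\<in>dom (adj H S).
        ip H (the (adj H S f)) g - ip H f (the (adj H S g)) =
        ip G (the (\<Gamma>\<^sub>1 f)) (the (\<Gamma>\<^sub>0 g)) - ip G (the (\<Gamma>\<^sub>0 f)) (the (\<Gamma>\<^sub>1 g))) \<and>
     (\<forall>u\<in>carrier G. \<forall>v\<in>carrier G. \<exists>f\<in>dom (adj H S). \<Gamma>\<^sub>0 f = Some u \<and> \<Gamma>\<^sub>1 f = Some v)"

definition dsum_op ::
  "(nat \<Rightarrow> 'a inner_space) \<Rightarrow> (nat \<Rightarrow> 'b inner_space) \<Rightarrow> (nat \<Rightarrow> 'a \<rightharpoonup> 'b)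
     \<Rightarrow> (nat \<Rightarrow> 'a) \<rightharpoonup> (nat \<Rightarrow> 'b)" where
  "dsum_op H K T = (\<lambda>f.
     if f \<in> carrier (dsum_space H) \<and> (\<forall>n. f n \<in> dom (T n)) \<and>
        (\<lambda>n. the (T n (f n))) \<in> carrier (dsum_space K)
     then Some (\<lambda>n. the (T n (f n))) else None)"


section \<open>The spaces \<open>L\<^sup>2\<close> and \<open>W\<^sup>2\<^sup>,\<^sup>2\<close> on a compact interval\<close>

definition L2_fun :: "'m measure \<Rightarrow> ('m \<Rightarrow> complex) set" where
  "L2_fun M = {f \<in> borel_measurable M. integrable M (\<lambda>t. (norm (f t))\<^sup>2)}"

definition L2_rel :: "'m measure \<Rightarrow> (('m \<Rightarrow> complex) \<times> ('m \<Rightarrow> complex)) set" where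
  "L2_rel M = {(f, g). f \<in> L2_fun M \<and> g \<in> L2_fun M \<and> (AE t in M. f t = g t)}"

definition L2_class :: "'m measure \<Rightarrow> ('m \<Rightarrow> complex) \<Rightarrow> ('m \<Rightarrow> complex) set" where
  "L2_class M f = L2_rel M `` {f}"

definition L2_rep :: "('m \<Rightarrow> complex) set \<Rightarrow> 'm \<Rightarrow> complex" where
  "L2_rep u = (SOME f. f \<in> u)"

definition L2_space :: "'m measure \<Rightarrow> ('m \<Rightarrow> complex) set inner_space" where
  "L2_space M =
     \<lparr>carrier = L2_fun M // L2_rel M,
      vadd = (\<lambda>u v. L2_class M (\<lambda>t. L2_rep u t + L2_rep v t)),
      vzero = L2_class M (\<lambda>t. 0),
      vscale = (\<lambda>a u. L2_class M (\<lambda>t. a * L2_rep u t)),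
      ip = (\<lambda>u v. LINT t|M. L2_rep u t * cnj (L2_rep v t))\<rparr>"

abbreviation L2_int :: "real \<Rightarrow> real \<Rightarrow> (real \<Rightarrow> complex) set inner_space" where
  "L2_int c d \<equiv> L2_space (lebesgue_on {c..d})"

text \<open>
  \<open>f\<close> is continuously differentiable on \<open>[c,d]\<close> with derivative \<open>f1\<close> (one-sided at the end
  points), and \<open>f1\<close> is absolutely continuous, being a primitive of \<open>f2 \<in> L\<^sup>2[c,d]\<close>.
\<close>

definition W22_fun ::
  "real \<Rightarrow> real \<Rightarrow> (real \<Rightarrow> complex) \<Rightarrow> (real \<Rightarrow> complex) \<Rightarrow> (real \<Rightarrow> complex) \<Rightarrow> bool" where
  "W22_fun c d f f1 f2 \<longleftrightarrow>
     (\<forall>t\<in>{c..d}. (f has_vector_derivative f1 t) (at t within {c..d})) \<and>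
     f2 \<in> L2_fun (lebesgue_on {c..d}) \<and>
     (\<forall>t\<in>{c..d}. f1 t = f1 c + (LINT s|lebesgue_on {c..t}. f2 s))"

definition W22 :: "real \<Rightarrow> real \<Rightarrow> (real \<Rightarrow> complex) set set" where
  "W22 c d = {u \<in> carrier (L2_int c d). \<exists>f\<in>u. \<exists>f1 f2. W22_fun c d f f1 f2}"

text \<open>
  The continuously differentiable representative of a class in \<open>W\<^sup>2\<^sup>,\<^sup>2[c,d]\<close>, and its
  derivatives.  For \<open>c < d\<close> the representative and its first derivative are unique on
  \<open>[c,d]\<close>, and the second derivative is unique almost everywhere.
\<close>

definition W22_rep :: "real \<Rightarrow> real \<Rightarrow> (real \<Rightarrow> complex) set \<Rightarrow> real \<Rightarrow> complex" where
  "W22_rep c d u = (SOME f. f \<in> u \<and> (\<exists>f1 f2. W22_fun c d f f1 f2))"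

definition W22_deriv :: "real \<Rightarrow> real \<Rightarrow> (real \<Rightarrow> complex) set \<Rightarrow> real \<Rightarrow> complex" where
  "W22_deriv c d u t = vector_derivative (W22_rep c d u) (at t within {c..d})"

definition W22_deriv2 :: "real \<Rightarrow> real \<Rightarrow> (real \<Rightarrow> complex) set \<Rightarrow> real \<Rightarrow> complex" where
  "W22_deriv2 c d u = (SOME f2. \<exists>f1. W22_fun c d (W22_rep c d u) f1 f2)"

definition W22_0 :: "real \<Rightarrow> real \<Rightarrow> (real \<Rightarrow> complex) set set" where
  "W22_0 c d = {u \<in> W22 c d. W22_rep c d u c = 0 \<and> W22_deriv c d u c = 0 \<and>
                             W22_rep c d u d = 0 \<and> W22_deriv c d u d = 0}"


section \<open>The operators and boundary mappings\<close>

definition H_op :: "real \<Rightarrow> real \<Rightarrow> (real \<Rightarrow> complex) set \<rightharpoonup> (real \<Rightarrow> complex) set" where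
  "H_op c d = (\<lambda>u. if u \<in> W22_0 c d
     then Some (L2_class (lebesgue_on {c..d}) (\<lambda>t. - W22_deriv2 c d u t)) else None)"

text \<open>
  The end point values of the representative and of its one-sided derivative are the limits
  \<open>f(c+)\<close>, \<open>f(d-)\<close>, \<open>f'(c+)\<close>, \<open>f'(d-)\<close>, both functions being continuous on \<open>[c,d]\<close>.
\<close>

definition Gamma0 :: "real \<Rightarrow> real \<Rightarrow> (real \<Rightarrow> complex) set \<rightharpoonup> complex ^ 2" where
  "Gamma0 c d = (\<lambda>u. if u \<in> W22 c d
     then let f = W22_rep c d u; l = d - c in
       Some (vector [of_real (l powr (1/2)) * f c, - of_real (l powr (1/2)) * f d])
     else None)"

definition Gamma1 :: "real \<Rightarrow> real \<Rightarrow> (real \<Rightarrow> complex) set \<rightharpoonup> complex ^ 2" where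
  "Gamma1 c d = (\<lambda>u. if u \<in> W22 c d
     then let f = W22_rep c d u; f' = W22_deriv c d u; l = d - c in
       Some (vector [(of_real l * f' c + (f c - f d)) / of_real (l powr (3/2)),
                     (of_real l * f' d + (f c - f d)) / of_real (l powr (3/2))])
     else None)"

text \<open>
  Component \<open>k\<close> of the direct sums lives on the interval \<open>[x k, x (k + 1)]\<close>.
\<close>

definition L2_sum :: "(nat \<Rightarrow> real) \<Rightarrow> (nat \<Rightarrow> (real \<Rightarrow> complex) set) inner_space" where
  "L2_sum x = dsum_space (\<lambda>k. L2_int (x k) (x (Suc k)))"

definition H_min :: "(nat \<Rightarrow> real) \<Rightarrow>
    (nat \<Rightarrow> (real \<Rightarrow> complex) set) \<rightharpoonup> (nat \<Rightarrow> (real \<Rightarrow> complex) set)" where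
  "H_min x = dsum_op (\<lambda>k. L2_int (x k) (x (Suc k))) (\<lambda>k. L2_int (x k) (x (Suc k)))
                     (\<lambda>k. H_op (x k) (x (Suc k)))"

definition l2_C2 :: "(nat \<Rightarrow> complex ^ 2) inner_space" where
  "l2_C2 = dsum_space (\<lambda>k. C2)"

definition Gamma0_sum :: "(nat \<Rightarrow> real) \<Rightarrow>
    (nat \<Rightarrow> (real \<Rightarrow> complex) set) \<rightharpoonup> (nat \<Rightarrow> complex ^ 2)" where
  "Gamma0_sum x =
     dsum_op (\<lambda>k. L2_int (x k) (x (Suc k))) (\<lambda>k. C2) (\<lambda>k. Gamma0 (x k) (x (Suc k)))
     |` dom (adj (L2_sum x) (H_min x))"

definition Gamma1_sum :: "(nat \<Rightarrow> real) \<Rightarrow>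
    (nat \<Rightarrow> (real \<Rightarrow> complex) set) \<rightharpoonup> (nat \<Rightarrow> complex ^ 2)" where
  "Gamma1_sum x =
     dsum_op (\<lambda>k. L2_int (x k) (x (Suc k))) (\<lambda>k. C2) (\<lambda>k. Gamma1 (x k) (x (Suc k)))
     |` dom (adj (L2_sum x) (H_min x))"

end

theory Submission
  imports Defs
begin

text \<open>
  On \<open>[c,d]\<close> everything follows from Green's formula.  Applied to functions vanishing with their
  derivatives at the end points it identifies \<open>H_n*\<close> with \<open>- d\<^sup>2/dx\<^sup>2\<close> on \<open>W\<^sup>2\<^sup>,\<^sup>2\<close>.  Applied to cubic
  and affine test functions, with \<open>l = d - c\<close>, it expresses \<open>f c\<close>, \<open>f d\<close>, \<open>l f' c + f c - f d\<close> and
  \<open>l f' d + f c - f d\<close> as integrals, which gives \<open>|\<Gamma>\<^sub>0 f| \<le> C (l\<^sup>2 \<parallel>f''\<parallel> + \<parallel>f\<parallel>)\<close> and \<open>|\<Gamma>\<^sub>1 f| \<le> C \<parallel>f''\<parallel>\<close> with an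
  absolute constant.  Cubics also give a right inverse of \<open>{\<Gamma>\<^sub>0, \<Gamma>\<^sub>1}\<close> whose graph norm is bounded in
  terms of \<open>l\<^sup>2\<close>.  Since \<open>sup d\<^sub>n < \<infinity>\<close>, all these bounds are uniform in \<open>n\<close>, and a direct sum of boundary
  triplets with uniform bounds is a boundary triplet.  Complex conjugation commutes with the
  operators, so the deficiency indices are equal; closedness follows from Green's identity and
  surjectivity, and density from the Hilbert projection argument.
\<close>


section \<open>Complex inner product spaces\<close>

text \<open>The form of the boundary mappings is what makes the bounds uniform. Since
  \<open>Gamma0\<close> carries the weight \<open>l\<close> to the power 1/2, Green's identity
  forces the weight -1/2 on \<open>f'\<close>. With that weight alone an affine function of slope 1
  vanishing at \<open>c\<close> has derivative data of size \<open>l\<close> to the power -1/2 but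
  norm of order \<open>l\<close> to the power 3/2, so no bound would survive short intervals.
  Subtracting the slope of the chord makes \<open>Gamma1\<close> vanish on affine functions, so that
  it sees only \<open>f''\<close>. The price is a term
  \<open>(f c - f d) * cnj (g c - g d) / l\<close>, which occurs in both products of Green's
  identity and cancels. All remaining powers of \<open>l\<close> are nonnegative, so only an upper
  bound \<open>D\<close> on the lengths enters. Totality of the domain of \<open>H_op\<close> is
  obtained together with the adjoint: a vector orthogonal to the domain is an adjoint value at 0,
  and the regularity result for weak solutions forces it to vanish.\<close>

abbreviation vsub :: "'a inner_space \<Rightarrow> 'a \<Rightarrow> 'a \<Rightarrow> 'a" where
  "vsub H u v \<equiv> vadd H u (vscale H (-1) v)"

context complex_inner_space
begin

lemma sub_closed: "u \<in> carrier H \<Longrightarrow> v \<in> carrier H \<Longrightarrow> vsub H u v \<in> carrier H"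
  by (simp add: add_closed scale_closed)

lemma ip_add_right:
  assumes "u \<in> carrier H" "v \<in> carrier H" "w \<in> carrier H"
  shows "ip H w (vadd H u v) = ip H w u + ip H w v"
proof -
  have "ip H w (vadd H u v) = cnj (ip H (vadd H u v) w)"
    using assms by (intro ip_cnj) (auto simp: add_closed)
  also have "\<dots> = cnj (ip H u w) + cnj (ip H v w)"
    using assms by (simp add: ip_add)
  also have "\<dots> = ip H w u + ip H w v"
    using assms ip_cnj by metis
  finally show ?thesis .
qed

lemma ip_scale_right:
  assumes "u \<in> carrier H" "v \<in> carrier H"
  shows "ip H u (vscale H a v) = cnj a * ip H u v"
proof -
  have "ip H u (vscale H a v) = cnj (ip H (vscale H a v) u)"
    using assms by (intro ip_cnj) (auto simp: scale_closed)
  also have "\<dots> = cnj a * cnj (ip H v u)"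
    using assms by (simp add: ip_scale)
  also have "\<dots> = cnj a * ip H u v"
    using assms ip_cnj by metis
  finally show ?thesis .
qed

lemma ip_zero_left: "v \<in> carrier H \<Longrightarrow> ip H (vzero H) v = 0"
  using ip_add[of "vzero H" "vzero H" v] add_zero[of "vzero H"] zero_closed by simp

lemma ip_zero_right: "v \<in> carrier H \<Longrightarrow> ip H v (vzero H) = 0"
  using ip_zero_left[of v] ip_cnj[of "vzero H" v] zero_closed by simp

lemmas ip_expand = ip_add ip_add_right ip_scale ip_scale_right ip_zero_left ip_zero_right
  add_closed scale_closed zero_closed

lemma vnorm_power2: "u \<in> carrier H \<Longrightarrow> (vnorm H u)\<^sup>2 = Re (ip H u u)"
  by (simp add: vnorm_def ip_nonneg)

lemma vnorm_nonneg: "u \<in> carrier H \<Longrightarrow> 0 \<le> vnorm H u"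
  by (simp add: vnorm_def ip_nonneg)

lemma ip_self: "u \<in> carrier H \<Longrightarrow> ip H u u = of_real ((vnorm H u)\<^sup>2)"
  using ip_cnj[of u u] vnorm_power2[of u]
  by (metis Reals_cnj_iff of_real_Re)

lemma vnorm_eq_0_iff: "u \<in> carrier H \<Longrightarrow> vnorm H u = 0 \<longleftrightarrow> u = vzero H"
  using ip_self[of u] ip_definite[of u] ip_zero_left[of u] vnorm_power2[of u] by auto

lemma sub_eq_zeroD:
  assumes "u \<in> carrier H" "v \<in> carrier H" "vsub H u v = vzero H"
  shows "u = v"
proof -
  have "v = vadd H (vsub H u v) v"
    using assms add_zero[of v] add_commute[of v "vzero H"] zero_closed by simp
  also have "\<dots> = vadd H u (vadd H v (vscale H (-1) v))"
    using assms(1,2) add_assoc[of u "vscale H (-1) v" v] add_commute[of "vscale H (-1) v" v]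
    by (simp add: scale_closed)
  also have "\<dots> = u"
    using assms by (simp add: add_inverse add_zero)
  finally show ?thesis by simp
qed

lemma sub_self: "u \<in> carrier H \<Longrightarrow> vsub H u u = vzero H"
  by (rule add_inverse)

text \<open>Identities between vectors of an abstract carrier are reduced by this rule to identities
  between complex numbers, which \<open>ip_expand\<close> and arithmetic settle.\<close>

lemma vector_eqI:
  assumes "u \<in> carrier H" "v \<in> carrier H" "\<And>w. w \<in> carrier H \<Longrightarrow> ip H u w = ip H v w"
  shows "u = v"
proof (rule sub_eq_zeroD)
  have "ip H (vsub H u v) (vsub H u v) = 0"
    using assms assms(3)[OF sub_closed[OF assms(1,2)]]
    by (simp add: ip_add[of u "vscale H (-1) v"] ip_scale sub_closed scale_closed)
  then show "vsub H u v = vzero H"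
    using assms by (intro ip_definite) (auto simp: sub_closed)
qed (use assms in auto)

lemma scale_zero: "u \<in> carrier H \<Longrightarrow> vscale H 0 u = vzero H"
  by (rule vector_eqI) (auto simp: ip_expand)

lemma vnorm_scale: "u \<in> carrier H \<Longrightarrow> vnorm H (vscale H a u) = cmod a * vnorm H u"
  by (simp add: vnorm_def ip_expand complex_norm_square[symmetric] flip: mult.assoc)
     (simp add: cmod_def real_sqrt_mult power2_eq_square)

lemma vnorm_add_power2:
  assumes "u \<in> carrier H" "v \<in> carrier H"
  shows "(vnorm H (vadd H u v))\<^sup>2 = (vnorm H u)\<^sup>2 + (vnorm H v)\<^sup>2 + 2 * Re (ip H u v)"
  using assms ip_cnj[of u v] by (simp add: vnorm_power2 ip_expand)

lemma vnorm_sub_power2: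
  assumes "u \<in> carrier H" "v \<in> carrier H"
  shows "(vnorm H (vsub H u v))\<^sup>2 = (vnorm H u)\<^sup>2 + (vnorm H v)\<^sup>2 - 2 * Re (ip H u v)"
  using assms ip_cnj[of u v] by (simp add: vnorm_power2 ip_expand)

lemma Cauchy_Schwarz:
  assumes u: "u \<in> carrier H" and v: "v \<in> carrier H"
  shows "cmod (ip H u v) \<le> vnorm H u * vnorm H v"
proof (cases "v = vzero H")
  case True
  then show ?thesis
    using assms vnorm_nonneg by (simp add: ip_zero_right)
next
  case False
  let ?n = "(vnorm H v)\<^sup>2" and ?z = "ip H u v"
  have n: "?n > 0"
    using False v by (simp add: vnorm_eq_0_iff)
  have "0 \<le> (vnorm H (vsub H u (vscale H (?z / of_real ?n) v)))\<^sup>2"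
    by simp
  also have "\<dots> = (vnorm H u)\<^sup>2 + (cmod ?z / ?n)\<^sup>2 * ?n - 2 * Re (cnj (?z / of_real ?n) * ?z)"
    using assms by (simp add: vnorm_sub_power2 ip_expand vnorm_scale power_mult_distrib
        norm_divide power_divide norm_power)
  also have "cnj (?z / of_real ?n) * ?z = of_real ((cmod ?z)\<^sup>2 / ?n)"
    by (simp add: complex_norm_square mult.commute flip: of_real_power)
  also have "(cmod ?z / ?n)\<^sup>2 * ?n = (cmod ?z)\<^sup>2 / ?n"
    using n by (simp add: power2_eq_square)
  finally have "(cmod ?z)\<^sup>2 / ?n \<le> (vnorm H u)\<^sup>2"
    by simp
  then have "(cmod ?z)\<^sup>2 \<le> (vnorm H u * vnorm H v)\<^sup>2"
    using n by (simp add: divide_le_eq power_mult_distrib)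
  then show ?thesis
    using assms vnorm_nonneg by (meson mult_nonneg_nonneg power2_le_imp_le)
qed

lemma vnorm_triangle:
  assumes "u \<in> carrier H" "v \<in> carrier H"
  shows "vnorm H (vadd H u v) \<le> vnorm H u + vnorm H v"
proof (rule power2_le_imp_le)
  have "Re (ip H u v) \<le> vnorm H u * vnorm H v"
    using Cauchy_Schwarz[OF assms] complex_Re_le_cmod order_trans by blast
  then show "(vnorm H (vadd H u v))\<^sup>2 \<le> (vnorm H u + vnorm H v)\<^sup>2"
    using assms by (simp add: vnorm_add_power2 power2_sum)
qed (use assms vnorm_nonneg in auto)

lemma vnorm_sub_commute:
  "u \<in> carrier H \<Longrightarrow> v \<in> carrier H \<Longrightarrow> vnorm H (vsub H u v) = vnorm H (vsub H v u)"
  using ip_cnj[of u v] by (simp add: vnorm_def ip_expand)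

lemma vsub_split:
  assumes "u \<in> carrier H" "v \<in> carrier H" "w \<in> carrier H"
  shows "vsub H u w = vadd H (vsub H u v) (vsub H v w)"
  using assms by (intro vector_eqI) (auto simp: ip_expand)

lemma vnorm_sub_triangle:
  assumes "u \<in> carrier H" "v \<in> carrier H" "w \<in> carrier H"
  shows "vnorm H (vsub H u w) \<le> vnorm H (vsub H u v) + vnorm H (vsub H v w)"
  using assms vnorm_triangle[of "vsub H u v" "vsub H v w"] vsub_split[of u v w]
  by (simp add: sub_closed)

section \<open>Metric, convergence and orthogonal projection\<close>

sublocale met: Metric_space "carrier H" "vdist H"
proof
  show "vdist H x y = 0 \<longleftrightarrow> x = y" if "x \<in> carrier H" "y \<in> carrier H" for x y
    using that by (auto simp: vdist_def vnorm_eq_0_iff sub_closed sub_self dest: sub_eq_zeroD)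
qed (auto simp: vdist_def vnorm_nonneg sub_closed vnorm_sub_commute vnorm_sub_triangle)

lemma limitin_vtop_iff:
  "limitin (vtop H) F f sequentially \<longleftrightarrow>
     f \<in> carrier H \<and> (\<forall>e>0. \<exists>N. \<forall>k\<ge>N. F k \<in> carrier H \<and> vnorm (H) (vsub H (F k) f) < e)"
  unfolding vtop_def met.limit_metric_sequentially by (auto simp: vdist_def) metis+

lemma ip_tendsto:
  assumes lim: "limitin (vtop H) F f sequentially" and F: "\<And>k. F k \<in> carrier H"
    and h: "h \<in> carrier H"
  shows "(\<lambda>k. ip H (F k) h) \<longlonglongrightarrow> ip H f h"
proof (rule LIMSEQ_I)
  fix r :: real assume r: "r > 0"
  have f: "f \<in> carrier H"
    using lim by (simp add: limitin_vtop_iff)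
  have "r / (vnorm H h + 1) > 0"
    using r vnorm_nonneg[OF h] by (simp add: add_nonneg_pos)
  then obtain N where N: "\<And>k. k \<ge> N \<Longrightarrow> vnorm H (vsub H (F k) f) < r / (vnorm H h + 1)"
    using lim unfolding limitin_vtop_iff by meson
  have "norm (ip H (F k) h - ip H f h) < r" if "k \<ge> N" for k
  proof -
    have "ip H (F k) h - ip H f h = ip H (vsub H (F k) f) h"
      using F f h by (simp add: ip_expand)
    then have "norm (ip H (F k) h - ip H f h) \<le> vnorm H (vsub H (F k) f) * vnorm H h"
      using Cauchy_Schwarz F f h by (simp add: sub_closed)
    also have "\<dots> \<le> vnorm H (vsub H (F k) f) * (vnorm H h + 1)"
      using F f by (intro mult_left_mono) (auto simp: vnorm_nonneg sub_closed)
    also have "\<dots> < r"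
      using N[OF that] vnorm_nonneg[OF h] by (simp add: pos_less_divide_eq add_nonneg_pos)
    finally show ?thesis .
  qed
  then show "\<exists>N. \<forall>k\<ge>N. norm (ip H (F k) h - ip H f h) < r"
    by blast
qed

lemma hilbert_spaceI:
  assumes "\<And>F :: nat \<Rightarrow> 'a. (\<And>n. F n \<in> carrier H) \<Longrightarrow>
      (\<And>e. e > 0 \<Longrightarrow> \<exists>N. \<forall>m\<ge>N. \<forall>n\<ge>N. vnorm H (vsub H (F m) (F n)) < e) \<Longrightarrow>
      \<exists>f\<in>carrier H. \<forall>e>0. \<exists>N. \<forall>n\<ge>N. vnorm H (vsub H (F n) f) < e"
  shows "hilbert_space H"
  unfolding hilbert_space_def met.mcomplete_def
proof (intro conjI allI impI)
  show "complex_inner_space H" by unfold_locales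
  fix F assume F: "met.MCauchy F"
  then have car: "F n \<in> carrier H" for n
    by (auto simp: met.MCauchy_def)
  have "\<exists>f\<in>carrier H. \<forall>e>0. \<exists>N. \<forall>n\<ge>N. vnorm H (vsub H (F n) f) < e"
  proof (rule assms)
    show "F n \<in> carrier H" for n by (rule car)
    fix e :: real assume "e > 0"
    then show "\<exists>N. \<forall>m\<ge>N. \<forall>n\<ge>N. vnorm H (vsub H (F m) (F n)) < e"
      using F car unfolding met.MCauchy_def by (simp add: vdist_def)
  qed
  then show "\<exists>f. limitin met.mtopology F f sequentially"
    unfolding vtop_def[symmetric] limitin_vtop_iff using car by (simp add: Bex_def)
qed

lemma hilbert_spaceD:
  assumes "hilbert_space H" "\<And>n. F n \<in> carrier H"
    and "\<And>e. e > 0 \<Longrightarrow> \<exists>N. \<forall>m\<ge>N. \<forall>n\<ge>N. vnorm H (vsub H (F m) (F n)) < e"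
  shows "\<exists>f. limitin (vtop H) F f sequentially"
proof -
  have "met.MCauchy F"
    unfolding met.MCauchy_def using assms(2,3) by (simp add: vdist_def image_subset_iff)
  then show ?thesis
    using assms(1) by (auto simp: hilbert_space_def met.mcomplete_def vtop_def)
qed

lemma parallelogram:
  assumes "u \<in> carrier H" "v \<in> carrier H"
  shows "(vnorm H (vsub H u v))\<^sup>2 + (vnorm H (vadd H u v))\<^sup>2 = 2 * (vnorm H u)\<^sup>2 + 2 * (vnorm H v)\<^sup>2"
  using assms by (simp add: vnorm_sub_power2 vnorm_add_power2)

text \<open>
  By the parallelogram law a minimizing sequence for the distance from \<open>u\<close> to \<open>M\<close> converges, and
  \<open>u\<close> minus the limit is orthogonal to \<open>M\<close>.
\<close>

lemma dense_if_total:
  assumes hil: "hilbert_space H" and sub: "M \<subseteq> carrier H" and zero: "vzero H \<in> M"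
    and add: "\<And>u v. u \<in> M \<Longrightarrow> v \<in> M \<Longrightarrow> vadd H u v \<in> M"
    and scale: "\<And>a u. u \<in> M \<Longrightarrow> vscale H a u \<in> M"
    and total: "\<And>h. h \<in> carrier H \<Longrightarrow> (\<And>f. f \<in> M \<Longrightarrow> ip H f h = 0) \<Longrightarrow> h = vzero H"
  shows "vtop H closure_of M = carrier H"
proof -
  have "\<exists>m\<in>M. vnorm H (vsub H u m) < r" if u: "u \<in> carrier H" and r: "r > 0" for u r
  proof -
    define D where "D = (\<lambda>m. (vnorm H (vsub H u m))\<^sup>2) ` M"
    define \<delta> where "\<delta> = Inf D"
    have bdd: "bdd_below D" by (auto simp: D_def intro!: bdd_belowI[of _ 0])
    have ne: "D \<noteq> {}" using zero by (auto simp: D_def)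
    have lower: "\<delta> \<le> (vnorm H (vsub H u m))\<^sup>2" if "m \<in> M" for m
      unfolding \<delta>_def using that by (intro cInf_lower bdd) (auto simp: D_def)
    have "\<exists>m\<in>M. (vnorm H (vsub H u m))\<^sup>2 < \<delta> + 1 / real (Suc k)" for k
    proof -
      have "Inf D < \<delta> + 1 / real (Suc k)" by (simp add: \<delta>_def)
      then show ?thesis
        using cInf_less_iff[OF ne bdd] by (auto simp: D_def)
    qed
    then obtain m where m: "\<And>k. m k \<in> M"
      and mless: "\<And>k. (vnorm H (vsub H u (m k)))\<^sup>2 < \<delta> + 1 / real (Suc k)"
      by metis
    have mc: "m k \<in> carrier H" for k using m sub by auto
    \<comment> \<open>Parallelogram law for \<open>u - m i\<close> and \<open>u - m j\<close>: their
      difference is \<open>m i - m j\<close> up to sign, and their sum is twice the distance vector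
      from \<open>u\<close> to the midpoint, which lies in \<open>M\<close> and is thus at squared
      distance at least \<open>\<delta>\<close>.\<close>
    have close: "(vnorm H (vsub H (m i) (m j)))\<^sup>2 \<le> 2 / real (Suc i) + 2 / real (Suc j)" for i j
    proof -
      let ?a = "vsub H u (m i)" and ?b = "vsub H u (m j)"
      let ?c = "vscale H (1/2) (vadd H (m i) (m j))"
      have 1: "vsub H ?b ?a = vsub H (m i) (m j)"
        using u mc by (intro vector_eqI) (auto simp: ip_expand)
      have 2: "vadd H ?b ?a = vscale H 2 (vsub H u ?c)"
        using u mc by (intro vector_eqI) (auto simp: ip_expand algebra_simps)
      have "4 * \<delta> \<le> (vnorm H (vadd H ?b ?a))\<^sup>2"
        unfolding 2 using u mc lower[of ?c] m
        by (simp add: vnorm_scale sub_closed add_closed scale_closed power_mult_distrib add scale)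
      then show ?thesis
        using parallelogram[of ?b ?a] u mc mless[of i] mless[of j]
        unfolding 1 by (simp add: sub_closed)
    qed
    have "\<exists>z. limitin (vtop H) m z sequentially"
    proof (rule hilbert_spaceD[OF hil mc])
      fix e :: real assume e: "e > 0"
      obtain N where N: "4 / e\<^sup>2 < real N" using reals_Archimedean2 by blast
      have "vnorm H (vsub H (m i) (m j)) < e" if "i \<ge> N" "j \<ge> N" for i j
      proof -
        have N0: "real N > 0"
          using N e by (smt (verit) divide_nonneg_nonneg zero_le_power2)
        have "2 / real (Suc i) < 2 / real N" "2 / real (Suc j) < 2 / real N"
          using that N0 by (auto intro!: divide_strict_left_mono mult_pos_pos)
        then have "(vnorm H (vsub H (m i) (m j)))\<^sup>2 < 4 / real N"
          using close[of i j] by linarith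
        also have "\<dots> < e\<^sup>2"
          using N N0 e by (simp add: field_simps)
        finally show ?thesis
          using e by (meson less_eq_real_def power2_less_imp_less)
      qed
      then show "\<exists>N. \<forall>i\<ge>N. \<forall>j\<ge>N. vnorm H (vsub H (m i) (m j)) < e" by blast
    qed
    then obtain z where z: "limitin (vtop H) m z sequentially" ..
    then have zc: "z \<in> carrier H" by (simp add: limitin_vtop_iff)
    define w where "w = vsub H u z"
    have wc: "w \<in> carrier H" using u zc by (simp add: w_def sub_closed)
    \<comment> \<open>The competitor \<open>m k + f\<close> cannot beat the infimum; letting
      \<open>k\<close> tend to infinity leaves a one-sided inequality, which rescaling
      \<open>f\<close> turns into orthogonality.\<close>
    have orth: "2 * Re (ip H f w) \<le> (vnorm H f)\<^sup>2" if f: "f \<in> M" for f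
    proof -
      have fc: "f \<in> carrier H" using f sub by auto
      have "\<delta> \<le> \<delta> + 1 / real (Suc k) + ((vnorm H f)\<^sup>2 - 2 * Re (ip H u f) + 2 * Re (ip H (m k) f))"
        for k
      proof -
        have "\<delta> \<le> (vnorm H (vsub H u (vadd H (m k) f)))\<^sup>2"
          by (intro lower add m f)
        also have "vsub H u (vadd H (m k) f) = vsub H (vsub H u (m k)) f"
          using u mc fc by (intro vector_eqI) (auto simp: ip_expand)
        also have "(vnorm H \<dots>)\<^sup>2 = (vnorm H (vsub H u (m k)))\<^sup>2 + (vnorm H f)\<^sup>2
            - 2 * Re (ip H (vsub H u (m k)) f)"
          using u mc fc by (intro vnorm_sub_power2) (auto simp: sub_closed)
        also have "Re (ip H (vsub H u (m k)) f) = Re (ip H u f) - Re (ip H (m k) f)"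
          using u mc fc by (simp add: ip_expand)
        finally show ?thesis using mless[of k] by (simp add: algebra_simps)
      qed
      moreover have "(\<lambda>k. \<delta> + 1 / real (Suc k) + ((vnorm H f)\<^sup>2 - 2 * Re (ip H u f) + 2 * Re (ip H (m k) f)))
        \<longlonglongrightarrow> \<delta> + 0 + ((vnorm H f)\<^sup>2 - 2 * Re (ip H u f) + 2 * Re (ip H z f))"
        by (intro tendsto_intros ip_tendsto z mc fc LIMSEQ_Suc[OF lim_1_over_n])
      ultimately have "\<delta> \<le> \<delta> + 0 + ((vnorm H f)\<^sup>2 - 2 * Re (ip H u f) + 2 * Re (ip H z f))"
        by (intro LIMSEQ_le_const) auto
      moreover have "Re (ip H f w) = Re (ip H u f) - Re (ip H z f)"
        using u zc fc ip_cnj[of w f] wc by (simp add: w_def ip_expand)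
      ultimately show ?thesis by simp
    qed
    have "w = vzero H"
    proof (rule total[OF wc])
      fix f assume f: "f \<in> M"
      then have fc: "f \<in> carrier H" using sub by auto
      let ?p = "ip H f w"
      \<comment> \<open>The phase of the factor makes the inner product real. The left side is
        linear in \<open>t\<close> and the right side quadratic, so a small positive
        \<open>t\<close> forces \<open>?p = 0\<close>; \<open>t = 1 / (n + 1)\<close> is small
        enough.\<close>
      have key: "2 * t * (cmod ?p)\<^sup>2 \<le> t\<^sup>2 * (cmod ?p)\<^sup>2 * (vnorm H f)\<^sup>2" for t :: real
      proof -
        have "ip H (vscale H (of_real t * cnj ?p) f) w = of_real (t * (cmod ?p)\<^sup>2)"
          using fc wc complex_norm_square[of ?p] by (simp add: ip_expand)
        then show ?thesis
          using orth[OF scale[OF f], of "of_real t * cnj ?p"] fc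
          by (simp add: vnorm_scale norm_mult power_mult_distrib)
      qed
      define n where "n = (vnorm H f)\<^sup>2"
      define t where "t = 1 / (n + 1)"
      have n: "n \<ge> 0" by (simp add: n_def)
      then have t: "t > 0" "t * n \<le> 1" by (auto simp: t_def divide_le_eq)
      have "2 * t * (cmod ?p)\<^sup>2 \<le> t * (t * n) * (cmod ?p)\<^sup>2"
        using key[of t] by (simp add: n_def power2_eq_square mult_ac)
      also have "\<dots> \<le> t * 1 * (cmod ?p)\<^sup>2"
        using t by (intro mult_right_mono mult_left_mono) auto
      finally have "t * (cmod ?p)\<^sup>2 \<le> 0" by simp
      then show "?p = 0"
        using t by (simp add: mult_le_0_iff)
    qed
    then have "u = z"
      using u zc unfolding w_def by (rule_tac sub_eq_zeroD)
    then obtain k where "vnorm H (vsub H (m k) u) < r"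
      using z r unfolding limitin_vtop_iff by blast
    then show ?thesis
      using m u mc vnorm_sub_commute by metis
  qed
  then have "\<exists>y\<in>M. y \<in> met.mball u r" if "u \<in> carrier H" "r > 0" for u r
    using that sub by (force simp: vdist_def met.in_mball)
  then show ?thesis
    unfolding vtop_def met.metric_closure_of by blast
qed

end


section \<open>Boundary triplets with explicit bounds\<close>

text \<open>The graph of the adjoint as a relation. \<open>adj\<close> selects its value by
  \<open>THE\<close>, which says nothing until uniqueness is established, whereas this relation can
  be worked with at once.\<close>

definition adj_pair :: "'a inner_space \<Rightarrow> ('a \<rightharpoonup> 'a) \<Rightarrow> 'a \<Rightarrow> 'a \<Rightarrow> bool" where
  "adj_pair H S g h \<longleftrightarrow> g \<in> carrier H \<and> h \<in> carrier H \<and> (\<forall>f\<in>dom S. ip H (the (S f)) g = ip H f h)"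

lemma linear_opD:
  assumes "linear_op H K T"
  shows "f \<in> dom T \<Longrightarrow> f \<in> carrier H"
    and "f \<in> dom T \<Longrightarrow> the (T f) \<in> carrier K"
    and "vzero H \<in> dom T"
    and "f \<in> dom T \<Longrightarrow> g \<in> dom T \<Longrightarrow> T (vadd H f g) = Some (vadd K (the (T f)) (the (T g)))"
    and "f \<in> dom T \<Longrightarrow> T (vscale H a f) = Some (vscale K a (the (T f)))"
  using assms unfolding linear_op_def by (auto simp: subset_iff ran_def)

lemma linear_op_zero:
  assumes "linear_op H K T" "complex_inner_space H" "complex_inner_space K"
  shows "T (vzero H) = Some (vzero K)"
proof -
  have "T (vscale H 0 (vzero H)) = Some (vscale K 0 (the (T (vzero H))))"
    using linear_opD[OF assms(1)] by blast
  then show ?thesis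
    using linear_opD[OF assms(1)] assms(2,3)
    by (simp add: complex_inner_space.scale_zero complex_inner_space.zero_closed)
qed

text \<open>Two candidates for the value differ by a vector orthogonal to \<open>dom S\<close>,
  which \<open>total\<close> sends to zero; hence the description in \<open>adj\<close> is well
  defined.\<close>

lemma (in complex_inner_space) adj_eq_Some_iff:
  assumes S: "dom S \<subseteq> carrier H"
    and total: "\<And>h. h \<in> carrier H \<Longrightarrow> (\<And>f. f \<in> dom S \<Longrightarrow> ip H f h = 0) \<Longrightarrow> h = vzero H"
  shows "adj H S g = Some h \<longleftrightarrow> adj_pair H S g h"
proof -
  have uniq: "h = h'" if "adj_pair H S g h" "adj_pair H S g h'" for h h'
  proof (rule sub_eq_zeroD)
    show "vsub H h h' = vzero H"
    proof (rule total)
      fix f assume "f \<in> dom S"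
      moreover from this have "f \<in> carrier H" using S by auto
      ultimately show "ip H f (vsub H h h') = 0"
        using that unfolding adj_pair_def by (auto simp: ip_expand)
    qed (use that in \<open>auto simp: adj_pair_def sub_closed\<close>)
  qed (use that in \<open>auto simp: adj_pair_def\<close>)
  have eq: "adj H S g = (if \<exists>h. adj_pair H S g h then Some (THE h. adj_pair H S g h) else None)"
    unfolding adj_def adj_pair_def by (auto intro!: arg_cong[where f = The])
  show ?thesis
  proof
    assume "adj_pair H S g h"
    then show "adj H S g = Some h"
      unfolding eq using uniq by (auto intro!: the_equality)
  next
    assume "adj H S g = Some h"
    then obtain h' where h': "adj_pair H S g h'" and "h = (THE h. adj_pair H S g h)"
      unfolding eq by (auto split: if_splits)
    then show "adj_pair H S g h"
      using uniq by (metis the_equality)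
  qed
qed

text \<open>Zorn's lemma on orthonormal subsets of \<open>N\<close>. A nonzero vector of
  \<open>N\<close> orthogonal to a maximal one could be normalized, which stays in \<open>N\<close>
  by \<open>scale\<close>, and then adjoined.\<close>

lemma (in complex_inner_space) orthonormal_basis_exists:
  assumes N: "N \<subseteq> carrier H" and scale: "\<And>a f. f \<in> N \<Longrightarrow> vscale H a f \<in> N"
  shows "\<exists>B. orthonormal_basis H N B"
proof -
  define ON where "ON B \<longleftrightarrow> (\<forall>e\<in>B. \<forall>e'\<in>B. ip H e e' = (if e = e' then 1 else 0))" for B
  have "\<exists>B\<in>{B. B \<subseteq> N \<and> ON B}. \<forall>X\<in>{B. B \<subseteq> N \<and> ON B}. B \<subseteq> X \<longrightarrow> X = B"
  proof (rule subset_Zorn')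
    fix \<C> assume ch: "subset.chain {B. B \<subseteq> N \<and> ON B} \<C>"
    have "ip H e e' = (if e = e' then 1 else 0)" if "e \<in> \<Union>\<C>" "e' \<in> \<Union>\<C>" for e e'
    proof -
      obtain X Y where XY: "X \<in> \<C>" "Y \<in> \<C>" "e \<in> X" "e' \<in> Y"
        using \<open>e \<in> \<Union>\<C>\<close> \<open>e' \<in> \<Union>\<C>\<close> by auto
      then have "X \<subseteq> Y \<or> Y \<subseteq> X" "ON X" "ON Y"
        using ch unfolding subset.chain_def by blast+
      then show ?thesis
        using XY unfolding ON_def by blast
    qed
    then show "\<Union>\<C> \<in> {B. B \<subseteq> N \<and> ON B}"
      using ch unfolding subset.chain_def ON_def by auto
  qed
  then obtain B where B: "B \<subseteq> N" "ON B" and max: "\<And>X. X \<subseteq> N \<Longrightarrow> ON X \<Longrightarrow> B \<subseteq> X \<Longrightarrow> X = B"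
    by auto
  have "f = vzero H" if f: "f \<in> N" and orth: "\<forall>e\<in>B. ip H f e = 0" for f
  proof (rule ccontr)
    assume nz: "f \<noteq> vzero H"
    have fc: "f \<in> carrier H" using f N by auto
    have pos: "vnorm H f > 0"
      using nz fc vnorm_eq_0_iff[OF fc] vnorm_nonneg[OF fc] by linarith
    define e where "e = vscale H (of_real (1 / vnorm H f)) f"
    have e: "e \<in> N" "e \<in> carrier H"
      unfolding e_def using f fc scale by (auto simp: scale_closed)
    have "vnorm H e = 1"
      unfolding e_def using fc pos by (simp add: vnorm_scale norm_divide)
    then have ee: "ip H e e = 1"
      using ip_self[OF e(2)] by simp
    have "ip H e b = 0 \<and> ip H b e = 0" if "b \<in> B" for b
    proof -
      have bc: "b \<in> carrier H" using that B N by auto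
      have "ip H e b = 0"
        unfolding e_def using orth that fc bc by (simp add: ip_expand)
      then show ?thesis using ip_cnj[OF e(2) bc] by simp
    qed
    then have "ON (insert e B)"
      using B(2) ee unfolding ON_def by auto
    then have "insert e B = B"
      using max[of "insert e B"] e B by auto
    then show False
      using ee \<open>\<And>b. b \<in> B \<Longrightarrow> ip H e b = 0 \<and> ip H b e = 0\<close> by (metis insertI1 zero_neq_one)
  qed
  then show ?thesis
    using B unfolding orthonormal_basis_def ON_def by blast
qed

text \<open>
  \<open>T\<close> plays the role of \<open>S*\<close>.  The constant \<open>C\<close> bounds the boundary mappings and a right inverse
  of \<open>{\<Gamma>\<^sub>0, \<Gamma>\<^sub>1}\<close>, so that the notion passes to direct sums when \<open>C\<close> is uniform.  The conjugation
  \<open>J\<close> exchanges \<open>ker (T - i)\<close> and \<open>ker (T + i)\<close>.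
\<close>

locale bounded_triplet =
  fixes H :: "'a inner_space" and S T :: "'a \<rightharpoonup> 'a" and G :: "'g inner_space"
    and \<Gamma>\<^sub>0 \<Gamma>\<^sub>1 :: "'a \<rightharpoonup> 'g" and J :: "'a \<Rightarrow> 'a" and C :: real
  assumes hilbert: "hilbert_space H" "hilbert_space G"
    and T_iff: "\<And>g h. T g = Some h \<longleftrightarrow> adj_pair H S g h"
    and total: "\<And>h. h \<in> carrier H \<Longrightarrow> (\<And>f. f \<in> dom S \<Longrightarrow> ip H f h = 0) \<Longrightarrow> h = vzero H"
    and S_eq: "S = T |` {f. \<Gamma>\<^sub>0 f = Some (vzero G) \<and> \<Gamma>\<^sub>1 f = Some (vzero G)}"
    and dom_\<Gamma>: "dom \<Gamma>\<^sub>0 = dom T" "dom \<Gamma>\<^sub>1 = dom T"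
    and linear_\<Gamma>: "linear_op H G \<Gamma>\<^sub>0" "linear_op H G \<Gamma>\<^sub>1"
    and bound:
      "\<And>f. f \<in> dom T \<Longrightarrow> (vnorm G (the (\<Gamma>\<^sub>0 f)))\<^sup>2 \<le> C * ((vnorm H f)\<^sup>2 + (vnorm H (the (T f)))\<^sup>2)"
      "\<And>f. f \<in> dom T \<Longrightarrow> (vnorm G (the (\<Gamma>\<^sub>1 f)))\<^sup>2 \<le> C * ((vnorm H f)\<^sup>2 + (vnorm H (the (T f)))\<^sup>2)"
    and green: "\<And>f g. f \<in> dom T \<Longrightarrow> g \<in> dom T \<Longrightarrow>
        ip H (the (T f)) g - ip H f (the (T g)) =
        ip G (the (\<Gamma>\<^sub>1 f)) (the (\<Gamma>\<^sub>0 g)) - ip G (the (\<Gamma>\<^sub>0 f)) (the (\<Gamma>\<^sub>1 g))"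
    and surj: "\<And>u v. u \<in> carrier G \<Longrightarrow> v \<in> carrier G \<Longrightarrow>
        \<exists>f. \<Gamma>\<^sub>0 f = Some u \<and> \<Gamma>\<^sub>1 f = Some v \<and>
          (vnorm H f)\<^sup>2 + (vnorm H (the (T f)))\<^sup>2 \<le> C * ((vnorm G u)\<^sup>2 + (vnorm G v)\<^sup>2)"
    and J_closed: "\<And>u. u \<in> carrier H \<Longrightarrow> J u \<in> carrier H"
    and J_J: "\<And>u. u \<in> carrier H \<Longrightarrow> J (J u) = u"
    and ip_J: "\<And>u v. u \<in> carrier H \<Longrightarrow> v \<in> carrier H \<Longrightarrow> ip H (J u) (J v) = cnj (ip H u v)"
    and S_J: "\<And>f. f \<in> dom S \<Longrightarrow> S (J f) = Some (J (the (S f)))"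
begin

sublocale H: complex_inner_space H
  using hilbert by (simp add: hilbert_space_def)

sublocale G: complex_inner_space G
  using hilbert by (simp add: hilbert_space_def)

lemma T_carrier:
  assumes "f \<in> dom T"
  shows "f \<in> carrier H" "the (T f) \<in> carrier H"
proof -
  obtain h where h: "T f = Some h" using assms by blast
  then have "adj_pair H S f h" by (simp add: T_iff)
  then show "f \<in> carrier H" "the (T f) \<in> carrier H" using h by (simp_all add: adj_pair_def)
qed

lemma dom_S_iff: "f \<in> dom S \<longleftrightarrow> f \<in> dom T \<and> \<Gamma>\<^sub>0 f = Some (vzero G) \<and> \<Gamma>\<^sub>1 f = Some (vzero G)"
  by (subst S_eq) auto

lemma S_subset_T:
  assumes "f \<in> dom S"
  shows "f \<in> dom T" "S f = T f"
proof -
  show "f \<in> dom T" using assms by (simp add: dom_S_iff)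
  show "S f = T f" using assms by (subst S_eq) (simp add: dom_S_iff)
qed

lemma S_carrier:
  assumes "f \<in> dom S"
  shows "f \<in> carrier H" "the (S f) \<in> carrier H"
  using S_subset_T[OF assms] T_carrier by auto

section \<open>Properties of \<open>S\<close> deduced from its adjoint \<open>T\<close>\<close>

lemma adj_eq: "adj H S = T"
proof
  fix g
  have "adj H S g = Some h \<longleftrightarrow> T g = Some h" for h
    unfolding T_iff using S_carrier total by (intro H.adj_eq_Some_iff) auto
  then show "adj H S g = T g"
    by (metis not_Some_eq)
qed

lemma linear_T: "linear_op H H T"
  unfolding linear_op_def
proof (intro conjI ballI allI)
  show "dom T \<subseteq> carrier H" "ran T \<subseteq> carrier H"
    using T_carrier by (auto simp: ran_def domIff T_iff adj_pair_def)
  have "T (vzero H) = Some (vzero H)"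
    using S_carrier by (auto simp: T_iff adj_pair_def H.ip_expand)
  then show "vzero H \<in> dom T" by auto
  fix f a assume f: "f \<in> dom T"
  then have pf: "adj_pair H S f (the (T f))" by (auto simp flip: T_iff)
  then show "T (vscale H a f) = Some (vscale H a (the (T f)))"
    using S_carrier by (auto simp: T_iff adj_pair_def H.ip_expand)
  fix g assume "g \<in> dom T"
  then have "adj_pair H S g (the (T g))" by (auto simp flip: T_iff)
  with pf show "T (vadd H f g) = Some (vadd H (the (T f)) (the (T g)))"
    using S_carrier by (auto simp: T_iff adj_pair_def H.ip_expand)
qed

lemma linear_S: "linear_op H H S"
  unfolding linear_op_def
proof (intro conjI ballI allI)
  note lin = linear_opD(4,5)[OF linear_T] linear_opD(4,5)[OF linear_\<Gamma>(1), unfolded dom_\<Gamma>]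
    linear_opD(4,5)[OF linear_\<Gamma>(2), unfolded dom_\<Gamma>]
  have G0: "vscale G a (vzero G) = vzero G" for a
    using G.scale_zero[OF G.zero_closed] G.scale_scale[OF G.zero_closed, of a 0] by simp
  show "dom S \<subseteq> carrier H" "ran S \<subseteq> carrier H"
    using S_carrier by (auto simp: ran_def) (metis domI option.sel)
  show "vzero H \<in> dom S"
    unfolding dom_S_iff using linear_opD(3)[OF linear_T] linear_\<Gamma>
    by (auto intro!: linear_op_zero H.complex_inner_space_axioms G.complex_inner_space_axioms)
  fix f a assume f: "f \<in> dom S"
  note fT = S_subset_T[OF f] f[unfolded dom_S_iff]
  have "vscale H a f \<in> dom S"
    unfolding dom_S_iff domIff[of _ T] by (simp add: lin G0 fT)
  then show "S (vscale H a f) = Some (vscale H a (the (S f)))"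
    using fT by (simp add: S_subset_T(2) lin)
  fix g assume g: "g \<in> dom S"
  note gT = S_subset_T[OF g] g[unfolded dom_S_iff]
  have "vadd H f g \<in> dom S"
    unfolding dom_S_iff domIff[of _ T] by (simp add: lin G.add_zero G.zero_closed fT gT)
  then show "S (vadd H f g) = Some (vadd H (the (S f)) (the (S g)))"
    using fT gT by (simp add: S_subset_T(2) lin)
qed

lemma densely_defined_S: "densely_defined H S"
  unfolding densely_defined_def
proof (rule H.dense_if_total[OF hilbert(1)])
  show "dom S \<subseteq> carrier H" "vzero H \<in> dom S"
    using linear_opD[OF linear_S] by blast+
  show "vadd H u v \<in> dom S" if "u \<in> dom S" "v \<in> dom S" for u v
    using linear_opD(4)[OF linear_S that] by blast
  show "vscale H a u \<in> dom S" if "u \<in> dom S" for a u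
    using linear_opD(5)[OF linear_S that] by blast
qed (rule total)

lemma \<Gamma>_carrier:
  assumes "f \<in> dom T"
  shows "the (\<Gamma>\<^sub>0 f) \<in> carrier G" "the (\<Gamma>\<^sub>1 f) \<in> carrier G"
  using linear_opD(2)[OF linear_\<Gamma>(1)] linear_opD(2)[OF linear_\<Gamma>(2)] dom_\<Gamma> assms by auto

lemma green_S:
  assumes "f \<in> dom S" "g \<in> dom T"
  shows "ip H (the (S f)) g = ip H f (the (T g))"
proof -
  note f = S_subset_T[OF assms(1)] assms(1)[unfolded dom_S_iff]
  have "ip H (the (T f)) g - ip H f (the (T g)) = 0"
    using green[OF f(1) assms(2)] f \<Gamma>_carrier[OF assms(2)] by (simp add: G.ip_zero_left)
  then show ?thesis using f by simp
qed

lemma symmetric_S: "symmetric_op H S"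
  unfolding symmetric_op_def using green_S S_subset_T by metis

text \<open>Passing to the limit in \<open>green_S\<close> keeps the identity against all of
  \<open>dom T\<close>. Testing with \<open>dom S\<close> gives \<open>T f = Some g\<close>; testing
  with the rest of \<open>dom T\<close> must then make the boundary terms vanish.\<close>

lemma closed_S: "closed_op H S"
  unfolding closed_op_def
proof (intro allI impI)
  fix F f g
  assume F: "\<forall>k::nat. F k \<in> dom S" and f: "limitin (vtop H) F f sequentially"
    and g: "limitin (vtop H) (\<lambda>k. the (S (F k))) g sequentially"
  have car: "f \<in> carrier H" "g \<in> carrier H"
    using f g by (auto simp: H.limitin_vtop_iff)
  have key: "ip H g h = ip H f (the (T h))" if h: "h \<in> dom T" for h
  proof (rule LIMSEQ_unique)
    show "(\<lambda>k. ip H (the (S (F k))) h) \<longlonglongrightarrow> ip H g h"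
      using F S_carrier T_carrier[OF h] by (intro H.ip_tendsto g) auto
    have "(\<lambda>k. ip H (F k) (the (T h))) \<longlonglongrightarrow> ip H f (the (T h))"
      using F S_carrier T_carrier[OF h] by (intro H.ip_tendsto f) auto
    then show "(\<lambda>k. ip H (the (S (F k))) h) \<longlonglongrightarrow> ip H f (the (T h))"
      using F h by (simp add: green_S)
  qed
  have "ip H (the (S h)) f = ip H h g" if h: "h \<in> dom S" for h
    using key[OF S_subset_T(1)[OF h]] S_subset_T(2)[OF h] S_carrier[OF h] car H.ip_cnj
    by metis
  then have Tf: "T f = Some g"
    using car by (simp add: T_iff adj_pair_def)
  \<comment> \<open>Since the pair \<open>u\<close>, \<open>v\<close> is arbitrary by surjectivity,
    setting either one to zero kills the boundary value paired with the other.\<close>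
  have zero: "ip G (the (\<Gamma>\<^sub>1 f)) u = ip G (the (\<Gamma>\<^sub>0 f)) v"
    if "u \<in> carrier G" "v \<in> carrier G" for u v
  proof -
    obtain h where h: "\<Gamma>\<^sub>0 h = Some u" "\<Gamma>\<^sub>1 h = Some v"
      using surj[OF \<open>u \<in> carrier G\<close> \<open>v \<in> carrier G\<close>] by blast
    then have "h \<in> dom T" using dom_\<Gamma> by auto
    then show ?thesis
      using green[of f h] key[of h] h Tf by auto
  qed
  have fT: "f \<in> dom T" using Tf by auto
  have "the (\<Gamma>\<^sub>1 f) = vzero G"
    using zero[OF _ G.zero_closed] \<Gamma>_carrier[OF fT]
    by (intro G.vector_eqI) (auto simp: G.ip_expand)
  moreover have "the (\<Gamma>\<^sub>0 f) = vzero G"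
    using zero[OF G.zero_closed] \<Gamma>_carrier[OF fT]
    by (intro G.vector_eqI) (auto simp: G.ip_expand)
  ultimately have "f \<in> dom S"
    using fT dom_\<Gamma> unfolding dom_S_iff by (metis domD option.sel)
  then show "S f = Some g"
    using S_subset_T(2) Tf by metis
qed

text \<open>Antilinearity is forced by \<open>ip_J\<close> and \<open>J_J\<close>: every
  \<open>w\<close> has the form \<open>J (J w)\<close>, so inner products with \<open>w\<close> can
  be conjugated.\<close>

lemma J_scale:
  assumes u: "u \<in> carrier H"
  shows "J (vscale H a u) = vscale H (cnj a) (J u)"
proof (rule H.vector_eqI)
  fix w assume w: "w \<in> carrier H"
  have "ip H (J (vscale H a u)) (J (J w)) = cnj a * ip H (J u) (J (J w))"
    using u w by (simp add: ip_J[of _ "J w"] J_closed H.ip_expand)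
  then show "ip H (J (vscale H a u)) w = ip H (vscale H (cnj a) (J u)) w"
    using u w by (simp add: J_J J_closed H.ip_expand)
qed (use u in \<open>auto simp: J_closed H.scale_closed\<close>)

text \<open>Commutation with \<open>J\<close> is assumed for \<open>S\<close> and passes to the
  adjoint: the defining relation for \<open>f\<close> is tested at \<open>J e\<close> instead of
  \<open>e\<close> and then conjugated.\<close>

lemma deficiency_J:
  assumes f: "f \<in> deficiency_space H S z"
  shows "J f \<in> deficiency_space H S (cnj z)"
proof -
  have pair: "adj_pair H S f (vscale H z f)"
    using f by (auto simp: deficiency_space_def adj_eq simp flip: T_iff)
  then have fc: "f \<in> carrier H" by (simp add: adj_pair_def)
  have "ip H (the (S e)) (J f) = ip H e (J (vscale H z f))" if e: "e \<in> dom S" for e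
  proof -
    have ec: "e \<in> carrier H" "the (S e) \<in> carrier H" using S_carrier[OF e] by auto
    have Je: "J e \<in> dom S" "the (S (J e)) = J (the (S e))" using S_J[OF e] by auto
    have "ip H (the (S (J e))) f = ip H (J e) (vscale H z f)"
      using pair Je(1) by (simp add: adj_pair_def)
    then have "ip H (J (the (S e))) (J (J f)) = ip H (J e) (J (J (vscale H z f)))"
      using Je fc by (simp add: J_J H.scale_closed)
    then show ?thesis
      using ec fc by (simp add: ip_J J_closed H.scale_closed)
  qed
  then have "T (J f) = Some (J (vscale H z f))"
    using fc by (simp add: T_iff adj_pair_def J_closed H.scale_closed)
  then show ?thesis
    using fc by (auto simp: deficiency_space_def adj_eq J_scale)
qed

text \<open>The image under \<open>J\<close> of a basis for \<open>\<i>\<close> is a basis for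
  \<open>- \<i>\<close>. Maximality is seen by applying \<open>J\<close> once more: a vector
  orthogonal to the image returns to the first space, orthogonal to \<open>B\<close>.\<close>

lemma equal_deficiency: "equal_deficiency_indices H S"
proof -
  have car: "deficiency_space H S z \<subseteq> carrier H" for z
    using T_carrier by (auto simp: deficiency_space_def adj_eq)
  have "vscale H a f \<in> deficiency_space H S z" if f: "f \<in> deficiency_space H S z" for a f z
  proof -
    have fc: "f \<in> carrier H" using f car by auto
    have "T (vscale H a f) = Some (vscale H a (vscale H z f))"
      using f linear_T by (auto simp: deficiency_space_def adj_eq linear_op_def)
    then show ?thesis
      using fc by (auto simp: deficiency_space_def adj_eq H.scale_scale mult.commute)
  qed
  then obtain B where B: "orthonormal_basis H (deficiency_space H S \<i>) B"
    using H.orthonormal_basis_exists[OF car] by blast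
  have Bc: "e \<in> carrier H" if "e \<in> B" for e
    using B car that by (auto simp: orthonormal_basis_def)
  have "orthonormal_basis H (deficiency_space H S (- \<i>)) (J ` B)"
    unfolding orthonormal_basis_def
  proof (intro conjI ballI impI)
    show "J ` B \<subseteq> deficiency_space H S (- \<i>)"
      using B deficiency_J[of _ \<i>] by (auto simp: orthonormal_basis_def)
    show "ip H e e' = (if e = e' then 1 else 0)" if ee: "e \<in> J ` B" "e' \<in> J ` B" for e e'
    proof -
      obtain b b' where b: "b \<in> B" "b' \<in> B" "e = J b" "e' = J b'" using ee by auto
      then have "e = e' \<longleftrightarrow> b = b'" using J_J Bc by metis
      then show ?thesis
        using B b Bc by (simp add: ip_J orthonormal_basis_def)
    qed
    show "f = vzero H"
      if f: "f \<in> deficiency_space H S (- \<i>)" and orth: "\<forall>e\<in>J ` B. ip H f e = 0" for f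
    proof -
      have fc: "f \<in> carrier H" using f car by auto
      have "ip H (J f) e = 0" if "e \<in> B" for e
      proof -
        have "ip H (J f) (J (J e)) = 0"
          using orth that fc Bc by (simp add: ip_J J_closed)
        then show ?thesis using J_J Bc that by simp
      qed
      then have "J f = vzero H"
        using B deficiency_J[OF f] by (auto simp: orthonormal_basis_def)
      then have "ip H f f = 0"
        using ip_J[OF fc fc] H.zero_closed by (simp add: H.ip_zero_left)
      then show ?thesis using H.ip_definite fc by blast
    qed
  qed
  moreover have "B \<approx> J ` B"
    unfolding eqpoll_def
    by (intro exI[of _ J] inj_on_imp_bij_betw inj_onI) (metis Bc J_J)
  ultimately show ?thesis
    using B unfolding equal_deficiency_indices_def by blast
qed

theorem boundary_triplet: "boundary_triplet H S G \<Gamma>\<^sub>0 \<Gamma>\<^sub>1"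
proof -
  \<comment> \<open>The locale bounds squared norms, because squares are what add up in a direct
    sum; taking roots recovers the form required by the definition.\<close>
  have sq: "vnorm G (the (\<Gamma> f)) \<le> sqrt C * sqrt ((vnorm H f)\<^sup>2 + (vnorm H (the (T f)))\<^sup>2)"
    if "(vnorm G (the (\<Gamma> f)))\<^sup>2 \<le> C * ((vnorm H f)\<^sup>2 + (vnorm H (the (T f)))\<^sup>2)" for \<Gamma> f
    using real_sqrt_le_mono[OF that] by (simp add: real_sqrt_mult)
  have bd: "\<exists>C. \<forall>f\<in>dom T. vnorm G (the (\<Gamma> f)) \<le> C * sqrt ((vnorm H f)\<^sup>2 + (vnorm H (the (T f)))\<^sup>2)"
    if "\<Gamma> = \<Gamma>\<^sub>0 \<or> \<Gamma> = \<Gamma>\<^sub>1" for \<Gamma>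
    using that bound by (intro exI[of _ "sqrt C"] ballI sq) auto
  have su: "\<exists>f\<in>dom T. \<Gamma>\<^sub>0 f = Some u \<and> \<Gamma>\<^sub>1 f = Some v" if "u \<in> carrier G" "v \<in> carrier G" for u v
    using surj[OF that] dom_\<Gamma> by blast
  show ?thesis
    unfolding boundary_triplet_def adj_eq
    using hilbert linear_S densely_defined_S closed_S symmetric_S equal_deficiency
      bd su green dom_\<Gamma> linear_\<Gamma> by auto
qed

end


section \<open>Direct sums\<close>

locale inner_space_family =
  fixes H :: "nat \<Rightarrow> 'a inner_space"
  assumes inner_space: "\<And>n. complex_inner_space (H n)"
begin

sublocale H: complex_inner_space "H n" for n
  by (rule inner_space)

lemma carrier_dsum_iff:
  "f \<in> carrier (dsum_space H) \<longleftrightarrow>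
     (\<forall>n. f n \<in> carrier (H n)) \<and> summable (\<lambda>n. (vnorm (H n) (f n))\<^sup>2)"
  by (simp add: dsum_space_def)

lemma dsum_simps:
  "vadd (dsum_space H) f g = (\<lambda>n. vadd (H n) (f n) (g n))"
  "vscale (dsum_space H) a f = (\<lambda>n. vscale (H n) a (f n))"
  "vzero (dsum_space H) = (\<lambda>n. vzero (H n))"
  "ip (dsum_space H) f g = (\<Sum>n. ip (H n) (f n) (g n))"
  by (simp_all add: dsum_space_def)

lemma summable_ip:
  assumes f: "f \<in> carrier (dsum_space H)" and g: "g \<in> carrier (dsum_space H)"
  shows "summable (\<lambda>n. ip (H n) (f n) (g n))"
proof (rule summable_comparison_test')
  show "summable (\<lambda>n. (vnorm (H n) (f n))\<^sup>2 + (vnorm (H n) (g n))\<^sup>2)"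
    using f g by (intro summable_add) (auto simp: carrier_dsum_iff)
  show "norm (ip (H n) (f n) (g n)) \<le> (vnorm (H n) (f n))\<^sup>2 + (vnorm (H n) (g n))\<^sup>2"
    if "n \<ge> 0" for n
  proof -
    have "norm (ip (H n) (f n) (g n)) \<le> vnorm (H n) (f n) * vnorm (H n) (g n)"
      using f g by (intro H.Cauchy_Schwarz) (auto simp: carrier_dsum_iff)
    also have "\<dots> \<le> (vnorm (H n) (f n))\<^sup>2 + (vnorm (H n) (g n))\<^sup>2"
      using sum_squares_bound[of "vnorm (H n) (f n)" "vnorm (H n) (g n)"]
        zero_le_power2[of "vnorm (H n) (f n)"] zero_le_power2[of "vnorm (H n) (g n)"]
      by linarith
    finally show ?thesis .
  qed
qed

sublocale sum: complex_inner_space "dsum_space H"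
proof
  fix f g :: "nat \<Rightarrow> 'a" and a
  assume f: "f \<in> carrier (dsum_space H)"
  then have fn: "f n \<in> carrier (H n)" for n by (auto simp: carrier_dsum_iff)
  show "vscale (dsum_space H) a f \<in> carrier (dsum_space H)"
    using f by (auto simp: carrier_dsum_iff dsum_simps H.scale_closed H.vnorm_scale power_mult_distrib
        intro: summable_mult)
  have re: "Re (ip (dsum_space H) f f) = (\<Sum>n. Re (ip (H n) (f n) (f n)))"
    unfolding dsum_simps by (intro bounded_linear.suminf[OF bounded_linear_Re] summable_ip f)
  have nonneg: "0 \<le> Re (ip (H n) (f n) (f n))" for n
    using fn H.ip_nonneg by auto
  have sre: "summable (\<lambda>n. Re (ip (H n) (f n) (f n)))"
    by (intro bounded_linear.summable[OF bounded_linear_Re] summable_ip f)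
  show "0 \<le> Re (ip (dsum_space H) f f)"
    unfolding re by (intro suminf_nonneg nonneg sre)
  show "f = vzero (dsum_space H)" if "ip (dsum_space H) f f = 0"
  proof -
    have "(\<Sum>n. Re (ip (H n) (f n) (f n))) = 0"
      using re that by simp
    then have "Re (ip (H n) (f n) (f n)) = 0" for n
      using suminf_eq_zero_iff[OF sre nonneg] by blast
    then have "vnorm (H n) (f n) = 0" for n by (simp add: vnorm_def)
    then show ?thesis using fn by (auto simp: H.vnorm_eq_0_iff dsum_simps)
  qed
  show "vadd (dsum_space H) f (vzero (dsum_space H)) = f" "vscale (dsum_space H) 1 f = f"
    "vadd (dsum_space H) f (vscale (dsum_space H) (-1) f) = vzero (dsum_space H)"
    using fn by (auto simp: dsum_simps H.add_zero H.scale_one H.add_inverse)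
  show "vscale (dsum_space H) a (vscale (dsum_space H) a' f) = vscale (dsum_space H) (a * a') f"
    "vscale (dsum_space H) (a + a') f = vadd (dsum_space H) (vscale (dsum_space H) a f) (vscale (dsum_space H) a' f)"
    for a'
    using fn by (auto simp: dsum_simps H.scale_scale H.add_scale)
  assume g: "g \<in> carrier (dsum_space H)"
  then have gn: "g n \<in> carrier (H n)" for n by (auto simp: carrier_dsum_iff)
  have "summable (\<lambda>n. (vnorm (H n) (vadd (H n) (f n) (g n)))\<^sup>2)"
  proof (rule summable_comparison_test')
    show "summable (\<lambda>n. 2 * (vnorm (H n) (f n))\<^sup>2 + 2 * (vnorm (H n) (g n))\<^sup>2)"
      using f g by (intro summable_add summable_mult) (auto simp: carrier_dsum_iff)
    show "norm ((vnorm (H n) (vadd (H n) (f n) (g n)))\<^sup>2) \<le> 2 * (vnorm (H n) (f n))\<^sup>2 + 2 * (vnorm (H n) (g n))\<^sup>2"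
      if "n \<ge> 0" for n
    proof -
      have "0 \<le> (vnorm (H n) (vsub (H n) (f n) (g n)))\<^sup>2" by simp
      then show ?thesis
        using H.parallelogram[OF fn[of n] gn[of n]] unfolding real_norm_def abs_power2 by linarith
    qed
  qed
  then show "vadd (dsum_space H) f g \<in> carrier (dsum_space H)"
    using fn gn by (auto simp: carrier_dsum_iff dsum_simps H.add_closed)
  show "vadd (dsum_space H) f g = vadd (dsum_space H) g f"
    using fn gn by (auto simp: dsum_simps H.add_commute)
  show "vscale (dsum_space H) a (vadd (dsum_space H) f g) =
      vadd (dsum_space H) (vscale (dsum_space H) a f) (vscale (dsum_space H) a g)"
    using fn gn by (auto simp: dsum_simps H.scale_add)
  show "ip (dsum_space H) (vscale (dsum_space H) a f) g = a * ip (dsum_space H) f g"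
    unfolding dsum_simps H.ip_scale[OF fn gn] by (rule suminf_mult[OF summable_ip[OF f g]])
  show "ip (dsum_space H) g f = cnj (ip (dsum_space H) f g)"
    unfolding dsum_simps bounded_linear.suminf[OF bounded_linear_cnj summable_ip[OF f g]]
    by (intro suminf_cong H.ip_cnj fn gn)
  fix h assume h: "h \<in> carrier (dsum_space H)"
  then have hn: "h n \<in> carrier (H n)" for n by (auto simp: carrier_dsum_iff)
  show "vadd (dsum_space H) (vadd (dsum_space H) f g) h = vadd (dsum_space H) f (vadd (dsum_space H) g h)"
    using fn gn hn by (auto simp: dsum_simps H.add_assoc)
  show "ip (dsum_space H) (vadd (dsum_space H) f g) h = ip (dsum_space H) f h + ip (dsum_space H) g h"
    unfolding dsum_simps H.ip_add[OF fn gn hn]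
    by (rule suminf_add[OF summable_ip[OF f h] summable_ip[OF g h], symmetric])
next
  show "vzero (dsum_space H) \<in> carrier (dsum_space H)"
    using H.vnorm_eq_0_iff[OF H.zero_closed] by (auto simp: carrier_dsum_iff dsum_simps H.zero_closed)
qed

lemma vnorm_dsum_sums:
  assumes "f \<in> carrier (dsum_space H)"
  shows "(\<lambda>n. (vnorm (H n) (f n))\<^sup>2) sums (vnorm (dsum_space H) f)\<^sup>2"
proof -
  have "(\<lambda>n. Re (ip (H n) (f n) (f n))) sums Re (ip (dsum_space H) f f)"
    unfolding dsum_simps
    by (intro bounded_linear.sums[OF bounded_linear_Re] summable_sums summable_ip assms)
  then show ?thesis
    using assms by (simp add: sum.vnorm_power2[OF assms] H.vnorm_power2 carrier_dsum_iff)
qed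

lemma carrier_dsum_nth: "f \<in> carrier (dsum_space H) \<Longrightarrow> f n \<in> carrier (H n)"
  by (simp add: carrier_dsum_iff)

lemma vnorm_nth_le:
  assumes "f \<in> carrier (dsum_space H)"
  shows "vnorm (H n) (f n) \<le> vnorm (dsum_space H) f"
proof (rule power2_le_imp_le)
  have "(\<Sum>k\<in>{n}. (vnorm (H k) (f k))\<^sup>2) \<le> (vnorm (dsum_space H) f)\<^sup>2"
    unfolding sums_unique[OF vnorm_dsum_sums[OF assms]]
    by (intro sum_le_suminf) (use assms in \<open>auto simp: carrier_dsum_iff\<close>)
  then show "(vnorm (H n) (f n))\<^sup>2 \<le> (vnorm (dsum_space H) f)\<^sup>2" by simp
qed (use assms sum.vnorm_nonneg in auto)

text \<open>Each component is Cauchy because it is dominated by the norm of the sum. The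
  componentwise limit is then shown to be a limit in norm by estimating partial sums
  uniformly.\<close>

lemma hilbert_space_dsum:
  assumes hil: "\<And>n. hilbert_space (H n)"
  shows "hilbert_space (dsum_space H)"
proof (rule sum.hilbert_spaceI)
  fix F :: "nat \<Rightarrow> nat \<Rightarrow> 'a"
  assume F: "\<And>k. F k \<in> carrier (dsum_space H)"
    and Cauchy: "\<And>e. e > 0 \<Longrightarrow> \<exists>N. \<forall>i\<ge>N. \<forall>j\<ge>N. vnorm (dsum_space H) (vsub (dsum_space H) (F i) (F j)) < e"
  note Fn = carrier_dsum_nth[OF F]
  have "\<exists>l. limitin (vtop (H n)) (\<lambda>k. F k n) l sequentially" for n
  proof (rule H.hilbert_spaceD[OF hil Fn])
    fix e :: real assume "e > 0"
    then obtain N where N: "\<forall>i\<ge>N. \<forall>j\<ge>N. vnorm (dsum_space H) (vsub (dsum_space H) (F i) (F j)) < e"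
      using Cauchy by blast
    have "vnorm (H n) (vsub (H n) (F i n) (F j n)) \<le> vnorm (dsum_space H) (vsub (dsum_space H) (F i) (F j))"
      for i j
      using vnorm_nth_le[OF sum.sub_closed[OF F F], of n i j] by (simp add: dsum_simps)
    then show "\<exists>N. \<forall>i\<ge>N. \<forall>j\<ge>N. vnorm (H n) (vsub (H n) (F i n) (F j n)) < e"
      using N by (meson le_less_trans)
  qed
  then obtain f where f: "\<And>n. limitin (vtop (H n)) (\<lambda>k. F k n) (f n) sequentially"
    by metis
  then have fn: "f n \<in> carrier (H n)" for n
    using H.limitin_vtop_iff by blast
  have close: "vsub (dsum_space H) (F i) f \<in> carrier (dsum_space H) \<and>
      vnorm (dsum_space H) (vsub (dsum_space H) (F i) f) \<le> e"
    if e: "e > 0" and N: "\<forall>i\<ge>N. \<forall>j\<ge>N. vnorm (dsum_space H) (vsub (dsum_space H) (F i) (F j)) < e"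
      and i: "i \<ge> N" for e N i
  proof -
    define d where "d j n = vnorm (H n) (vsub (H n) (F i n) (F j n))" for j n
    define d' where "d' n = vnorm (H n) (vsub (H n) (F i n) (f n))" for n
    have lim: "(\<lambda>j. d j n) \<longlonglongrightarrow> d' n" for n
    proof (rule LIMSEQ_I)
      fix r :: real assume "r > 0"
      then obtain N where N: "\<And>j. j \<ge> N \<Longrightarrow> vnorm (H n) (vsub (H n) (F j n) (f n)) < r"
        using f[of n] unfolding H.limitin_vtop_iff by meson
      have "\<bar>d j n - d' n\<bar> \<le> vnorm (H n) (vsub (H n) (F j n) (f n))" for j
        unfolding d_def d'_def
        using H.vnorm_sub_triangle[OF Fn[of i n] Fn[of j n] fn[of n]]
          H.vnorm_sub_triangle[OF Fn[of i n] fn[of n] Fn[of j n]]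
          H.vnorm_sub_commute[OF Fn[of j n] fn[of n]] by simp
      then show "\<exists>N. \<forall>j\<ge>N. norm (d j n - d' n) < r"
        using N by (metis le_less_trans real_norm_def)
    qed
    \<comment> \<open>Componentwise convergence allows the limit only in finite sums; the bound
      \<open>e\<^sup>2\<close> does not depend on \<open>m\<close> and therefore extends to the
      whole series.\<close>
    have part: "(\<Sum>n<m. (d' n)\<^sup>2) \<le> e\<^sup>2" for m
    proof (rule LIMSEQ_le_const2)
      show "(\<lambda>j. \<Sum>n<m. (d j n)\<^sup>2) \<longlonglongrightarrow> (\<Sum>n<m. (d' n)\<^sup>2)"
        by (intro tendsto_intros lim)
      have "(\<Sum>n<m. (d j n)\<^sup>2) \<le> e\<^sup>2" if "j \<ge> N" for j
      proof -
        have car: "vsub (dsum_space H) (F i) (F j) \<in> carrier (dsum_space H)"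
          by (intro sum.sub_closed F)
        have "(\<Sum>n<m. (d j n)\<^sup>2) \<le> (vnorm (dsum_space H) (vsub (dsum_space H) (F i) (F j)))\<^sup>2"
          unfolding sums_unique[OF vnorm_dsum_sums[OF car]] unfolding d_def
          using vnorm_dsum_sums[OF car] by (simp add: dsum_simps sums_summable sum_le_suminf)
        also have "\<dots> \<le> e\<^sup>2"
          using N i that sum.vnorm_nonneg[OF car] by (intro power_mono) (auto intro: less_imp_le)
        finally show ?thesis .
      qed
      then show "\<exists>N. \<forall>j\<ge>N. (\<Sum>n<m. (d j n)\<^sup>2) \<le> e\<^sup>2" by blast
    qed
    have summ: "summable (\<lambda>n. (d' n)\<^sup>2)"
      by (rule summableI_nonneg_bounded[OF _ part]) simp
    then have car: "vsub (dsum_space H) (F i) f \<in> carrier (dsum_space H)"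
      using Fn fn by (simp add: carrier_dsum_iff dsum_simps H.sub_closed d'_def)
    have "(vnorm (dsum_space H) (vsub (dsum_space H) (F i) f))\<^sup>2 = (\<Sum>n. (d' n)\<^sup>2)"
      using sums_unique[OF vnorm_dsum_sums[OF car]] by (simp add: dsum_simps d'_def)
    also have "\<dots> \<le> e\<^sup>2"
      by (intro suminf_le_const summ part)
    finally show ?thesis
      using car e by (meson less_imp_le power2_le_imp_le)
  qed
  have "f \<in> carrier (dsum_space H)"
  proof -
    obtain N where "\<forall>i\<ge>N. \<forall>j\<ge>N. vnorm (dsum_space H) (vsub (dsum_space H) (F i) (F j)) < 1"
      using Cauchy[of 1] by auto
    then have "vsub (dsum_space H) (F N) f \<in> carrier (dsum_space H)"
      using close[of 1 N N] by simp
    \<comment> \<open>Square summability is known for the difference \<open>F N - f\<close> only;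
      \<open>f\<close> is recovered as \<open>F N\<close> minus this difference.\<close>
    then have car: "vsub (dsum_space H) (F N) (vsub (dsum_space H) (F N) f) \<in> carrier (dsum_space H)"
      by (rule sum.sub_closed[OF F])
    have "vsub (H n) (F N n) (vsub (H n) (F N n) (f n)) = f n" for n
      using Fn fn by (intro H.vector_eqI) (auto simp: H.ip_expand)
    then have eq: "vsub (dsum_space H) (F N) (vsub (dsum_space H) (F N) f) = f"
      unfolding dsum_simps by (rule ext)
    show ?thesis using car unfolding eq .
  qed
  moreover have "\<exists>N. \<forall>n\<ge>N. vnorm (dsum_space H) (vsub (dsum_space H) (F n) f) < e" if "e > 0" for e
  proof -
    obtain N where "\<forall>i\<ge>N. \<forall>j\<ge>N. vnorm (dsum_space H) (vsub (dsum_space H) (F i) (F j)) < e / 2"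
      using Cauchy[of "e/2"] \<open>e > 0\<close> by auto
    then have "\<forall>n\<ge>N. vnorm (dsum_space H) (vsub (dsum_space H) (F n) f) \<le> e / 2"
      using close[of "e/2" N] \<open>e > 0\<close> by auto
    then have "\<forall>n\<ge>N. vnorm (dsum_space H) (vsub (dsum_space H) (F n) f) < e"
      using \<open>e > 0\<close> by fastforce
    then show ?thesis ..
  qed
  ultimately show "\<exists>f\<in>carrier (dsum_space H). \<forall>e>0. \<exists>N. \<forall>n\<ge>N. vnorm (dsum_space H) (vsub (dsum_space H) (F n) f) < e"
    by blast
qed

text \<open>Test vectors: pairing with \<open>single n u\<close> reads off component
  \<open>n\<close>, which reduces statements about the direct sum to its summands.\<close>

definition single :: "nat \<Rightarrow> 'a \<Rightarrow> nat \<Rightarrow> 'a" where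
  "single n u = (\<lambda>m. if m = n then u else vzero (H m))"

lemma single_closed:
  assumes "u \<in> carrier (H n)"
  shows "single n u \<in> carrier (dsum_space H)"
proof -
  have "summable (\<lambda>m. (vnorm (H m) (single n u m))\<^sup>2)"
    by (rule summable_finite[of "{n}"]) (auto simp: single_def H.vnorm_eq_0_iff H.zero_closed)
  then show ?thesis
    using assms by (auto simp: carrier_dsum_iff single_def H.zero_closed)
qed

lemma ip_single:
  assumes "u \<in> carrier (H n)" "g \<in> carrier (dsum_space H)"
  shows "ip (dsum_space H) (single n u) g = ip (H n) u (g n)"
proof -
  have "(\<lambda>m. ip (H m) (single n u m) (g m)) sums (\<Sum>m\<in>{n}. ip (H m) (single n u m) (g m))"
    using carrier_dsum_nth[OF assms(2)]
    by (intro sums_finite) (auto simp: single_def H.ip_zero_left)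
  then show ?thesis
    unfolding dsum_simps by (auto simp: single_def dest: sums_unique)
qed

end

section \<open>Operators acting componentwise\<close>

lemma dsum_op_eq_Some_iff:
  "dsum_op H K T f = Some h \<longleftrightarrow>
     f \<in> carrier (dsum_space H) \<and> h \<in> carrier (dsum_space K) \<and> (\<forall>n. T n (f n) = Some (h n))"
proof -
  have "(\<forall>n. f n \<in> dom (T n)) \<and> h = (\<lambda>n. the (T n (f n))) \<longleftrightarrow> (\<forall>n. T n (f n) = Some (h n))"
    unfolding fun_eq_iff by (metis domD domI option.sel)
  then show ?thesis
    unfolding dsum_op_def by auto
qed

lemma linear_dsum_op:
  assumes H: "inner_space_family H" and K: "inner_space_family K"
    and lin: "\<And>n. linear_op (H n) (K n) (T n)"
  shows "linear_op (dsum_space H) (dsum_space K) (dsum_op H K T)"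
proof -
  interpret H: inner_space_family H by (rule H)
  interpret K: inner_space_family K by (rule K)
  let ?T = "dsum_op H K T"
  show ?thesis
    unfolding linear_op_def
  proof (intro conjI ballI allI)
    show "dom ?T \<subseteq> carrier (dsum_space H)" "ran ?T \<subseteq> carrier (dsum_space K)"
      by (auto simp: ran_def dsum_op_eq_Some_iff)
    have "T n (vzero (H n)) = Some (vzero (K n))" for n
      by (intro linear_op_zero lin H.inner_space K.inner_space)
    then have "?T (vzero (dsum_space H)) = Some (vzero (dsum_space K))"
      using H.sum.zero_closed K.sum.zero_closed
      by (simp add: dsum_op_eq_Some_iff H.dsum_simps K.dsum_simps)
    then show "vzero (dsum_space H) \<in> dom ?T" by blast
    fix f a assume "f \<in> dom ?T"
    then obtain f' where f: "?T f = Some f'" by auto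
    note f' = f[unfolded dsum_op_eq_Some_iff]
    have "T n (vscale (H n) a (f n)) = Some (vscale (K n) a (f' n))" for n
      using linear_opD(5)[OF lin, of "f n" n a] f' by auto
    then show "?T (vscale (dsum_space H) a f) = Some (vscale (dsum_space K) a (the (?T f)))"
      unfolding f option.sel using f' H.sum.scale_closed[of f a] K.sum.scale_closed[of f' a]
      by (simp add: dsum_op_eq_Some_iff H.dsum_simps K.dsum_simps)
    fix g assume "g \<in> dom ?T"
    then obtain g' where g: "?T g = Some g'" by auto
    note g' = g[unfolded dsum_op_eq_Some_iff]
    have "T n (vadd (H n) (f n) (g n)) = Some (vadd (K n) (f' n) (g' n))" for n
      using linear_opD(4)[OF lin, of "f n" n "g n"] f' g' by auto
    then show "?T (vadd (dsum_space H) f g) = Some (vadd (dsum_space K) (the (?T f)) (the (?T g)))"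
      unfolding f g option.sel using f' g' H.sum.add_closed[of f g] K.sum.add_closed[of f' g']
      by (simp add: dsum_op_eq_Some_iff H.dsum_simps K.dsum_simps)
  qed
qed

lemma linear_op_restrict:
  assumes A: "linear_op H K A" and T: "linear_op H L T"
  shows "linear_op H K (A |` dom T)"
  unfolding linear_op_def
proof (intro conjI ballI allI)
  show "dom (A |` dom T) \<subseteq> carrier H" "ran (A |` dom T) \<subseteq> carrier K"
    using A unfolding linear_op_def ran_def restrict_map_def by (auto split: if_splits)
  show "vzero H \<in> dom (A |` dom T)"
    using linear_opD(3)[OF A] linear_opD(3)[OF T] by simp
  fix f a assume "f \<in> dom (A |` dom T)"
  then have f: "f \<in> dom A" "f \<in> dom T" by auto
  show "(A |` dom T) (vscale H a f) = Some (vscale K a (the ((A |` dom T) f)))"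
    using linear_opD(5)[OF A f(1)] linear_opD(5)[OF T f(2)] f(2) by (simp add: domIff)
  fix g assume "g \<in> dom (A |` dom T)"
  then have g: "g \<in> dom A" "g \<in> dom T" by auto
  show "(A |` dom T) (vadd H f g) = Some (vadd K (the ((A |` dom T) f)) (the ((A |` dom T) g)))"
    using linear_opD(4)[OF A f(1) g(1)] linear_opD(4)[OF T f(2) g(2)] f(2) g(2) by (simp add: domIff)
qed

text \<open>Algebraic identities are summed over the components. The common constant
  \<open>C\<close> is used twice: boundary values of vectors in the domain of the adjoint are square
  summable, so the restricted mappings have that whole domain, and componentwise preimages of
  boundary data assemble to a vector in it.\<close>

theorem bounded_triplet_dsum:
  fixes H :: "nat \<Rightarrow> 'a inner_space" and G :: "nat \<Rightarrow> 'g inner_space"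
  assumes bt: "\<And>n. bounded_triplet (H n) (S n) (T n) (G n) (\<Gamma> n) (\<Gamma>' n) (J n) C"
  defines "S' \<equiv> dsum_op H H S"
  shows "bounded_triplet (dsum_space H) S' (dsum_op H H T) (dsum_space G)
     (dsum_op H G \<Gamma> |` dom (adj (dsum_space H) S')) (dsum_op H G \<Gamma>' |` dom (adj (dsum_space H) S'))
     (\<lambda>f n. J n (f n)) C"
proof -
  interpret n: bounded_triplet "H n" "S n" "T n" "G n" "\<Gamma> n" "\<Gamma>' n" "J n" C for n
    by (rule bt)
  interpret H: inner_space_family H
    by (rule inner_space_family.intro) (rule n.H.complex_inner_space_axioms)
  interpret G: inner_space_family G
    by (rule inner_space_family.intro) (rule n.G.complex_inner_space_axioms)
  let ?H = "dsum_space H" and ?G = "dsum_space G" and ?T = "dsum_op H H T"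
  note S'_iff = dsum_op_eq_Some_iff[of H H S, folded S'_def]
  have S_zero: "S n (vzero (H n)) = Some (vzero (H n))" for n
    by (intro linear_op_zero n.linear_S n.H.complex_inner_space_axioms)
  have S'_carrier: "f \<in> carrier ?H" if "f \<in> dom S'" for f
    using that S'_iff by blast
  have S'_single: "S' (H.single n f) = Some (H.single n (the (S n f)))" if f: "f \<in> dom (S n)" for n f
    unfolding S'_iff using n.S_carrier[OF f] f S_zero
    by (auto simp: H.single_closed) (auto simp: H.single_def)
  have T_iff: "?T g = Some h \<longleftrightarrow> adj_pair ?H S' g h" for g h
  proof
    assume "?T g = Some h"
    then have gh: "g \<in> carrier ?H" "h \<in> carrier ?H" "\<And>n. adj_pair (H n) (S n) (g n) (h n)"
      by (auto simp: dsum_op_eq_Some_iff n.T_iff)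
    have "ip ?H (the (S' f)) g = ip ?H f h" if f: "f \<in> dom S'" for f
    proof -
      obtain f' where f': "S' f = Some f'" using f by auto
      then have "S n (f n) = Some (f' n)" for n by (simp add: S'_iff)
      then have "ip (H n) (f' n) (g n) = ip (H n) (f n) (h n)" for n
        using gh(3)[of n] unfolding adj_pair_def by (metis domI option.sel)
      then show ?thesis using f' by (simp add: H.dsum_simps)
    qed
    then show "adj_pair ?H S' g h" using gh by (simp add: adj_pair_def)
  next
    assume gh: "adj_pair ?H S' g h"
    then have car: "g \<in> carrier ?H" "h \<in> carrier ?H" by (auto simp: adj_pair_def)
    \<comment> \<open>A vector with one nonzero component isolates the adjoint relation in component
      \<open>n\<close>.\<close>
    have "ip (H n) (the (S n f)) (g n) = ip (H n) f (h n)" if f: "f \<in> dom (S n)" for n f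
    proof -
      have "H.single n f \<in> dom S'" "the (S' (H.single n f)) = H.single n (the (S n f))"
        using S'_single[OF f] by auto
      then have "ip ?H (H.single n (the (S n f))) g = ip ?H (H.single n f) h"
        using gh unfolding adj_pair_def by metis
      then show ?thesis
        using n.S_carrier[OF f] car by (simp add: H.ip_single)
    qed
    then have "T n (g n) = Some (h n)" for n
      using car by (simp add: n.T_iff adj_pair_def H.carrier_dsum_nth)
    then show "?T g = Some h"
      using car by (simp add: dsum_op_eq_Some_iff)
  qed
  have total: "h = vzero ?H" if h: "h \<in> carrier ?H" and orth: "\<And>f. f \<in> dom S' \<Longrightarrow> ip ?H f h = 0" for h
  proof -
    have "h n = vzero (H n)" for n
    proof (rule n.total)
      show "h n \<in> carrier (H n)" using h by (rule H.carrier_dsum_nth)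
      fix f assume f: "f \<in> dom (S n)"
      then have "H.single n f \<in> dom S'" using S'_single by blast
      then show "ip (H n) f (h n) = 0"
        using orth n.S_carrier[OF f] h by (metis H.ip_single)
    qed
    then show ?thesis by (auto simp: H.dsum_simps)
  qed
  have adj: "adj ?H S' = ?T"
  proof
    fix g
    have "adj ?H S' g = Some h \<longleftrightarrow> ?T g = Some h" for h
      unfolding T_iff using S'_carrier total by (intro H.sum.adj_eq_Some_iff) auto
    then show "adj ?H S' g = ?T g" by (metis not_Some_eq)
  qed
  have dom_T: "f \<in> carrier ?H" "\<And>n. f n \<in> dom (T n)" "the (?T f) = (\<lambda>n. the (T n (f n)))"
    "(\<lambda>n. the (T n (f n))) \<in> carrier ?H" if "f \<in> dom ?T" for f
  proof -
    obtain h where h: "?T f = Some h" using \<open>f \<in> dom ?T\<close> by auto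
    note h' = h[unfolded dsum_op_eq_Some_iff]
    show "f \<in> carrier ?H" "\<And>n. f n \<in> dom (T n)" using h' by auto
    show "the (?T f) = (\<lambda>n. the (T n (f n)))" using h h' by simp
    show "(\<lambda>n. the (T n (f n))) \<in> carrier ?H" using h' by simp
  qed
  have sums_T: "(\<lambda>n. C * ((vnorm (H n) (f n))\<^sup>2 + (vnorm (H n) (the (T n (f n))))\<^sup>2)) sums
      (C * ((vnorm ?H f)\<^sup>2 + (vnorm ?H (the (?T f)))\<^sup>2))" if "f \<in> dom ?T" for f
    using H.vnorm_dsum_sums[OF dom_T(1)[OF that]] H.vnorm_dsum_sums[OF dom_T(4)[OF that]]
    unfolding dom_T(3)[OF that] by (intro sums_mult sums_add)
  \<comment> \<open>A bound varying with \<open>n\<close> would leave the sequence of boundary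
    values possibly not summable; with one \<open>C\<close> it is dominated by the convergent series
    \<open>sums_T\<close>.\<close>
  have bnd: "\<exists>u. dsum_op H G \<Delta> f = Some u \<and>
      (vnorm ?G u)\<^sup>2 \<le> C * ((vnorm ?H f)\<^sup>2 + (vnorm ?H (the (?T f)))\<^sup>2)"
    if f: "f \<in> dom ?T" and dom: "\<And>n. dom (\<Delta> n) = dom (T n)"
      and lin: "\<And>n. linear_op (H n) (G n) (\<Delta> n)"
      and b: "\<And>n f. f \<in> dom (T n) \<Longrightarrow> (vnorm (G n) (the (\<Delta> n f)))\<^sup>2 \<le>
        C * ((vnorm (H n) f)\<^sup>2 + (vnorm (H n) (the (T n f)))\<^sup>2)" for \<Delta> f
  proof -
    define u where "u n = the (\<Delta> n (f n))" for n
    have fn: "f n \<in> dom (\<Delta> n)" for n using dom_T(2)[OF f] dom by simp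
    have le: "(vnorm (G n) (u n))\<^sup>2 \<le> C * ((vnorm (H n) (f n))\<^sup>2 + (vnorm (H n) (the (T n (f n))))\<^sup>2)" for n
      unfolding u_def by (rule b[OF dom_T(2)[OF f]])
    have "summable (\<lambda>n. (vnorm (G n) (u n))\<^sup>2)"
      by (rule summable_comparison_test'[OF sums_summable[OF sums_T[OF f]], of 0]) (use le in simp)
    moreover have "u n \<in> carrier (G n)" for n
      unfolding u_def by (rule linear_opD(2)[OF lin fn])
    ultimately have u: "u \<in> carrier ?G" by (simp add: G.carrier_dsum_iff)
    have "dsum_op H G \<Delta> f = Some u"
      using u fn dom_T(1)[OF f] by (simp add: dsum_op_eq_Some_iff u_def domIff)
    moreover have "(vnorm ?G u)\<^sup>2 \<le> C * ((vnorm ?H f)\<^sup>2 + (vnorm ?H (the (?T f)))\<^sup>2)"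
      by (rule sums_le[OF le G.vnorm_dsum_sums[OF u] sums_T[OF f]])
    ultimately show ?thesis by blast
  qed
  note bnd0 = bnd[OF _ n.dom_\<Gamma>(1) n.linear_\<Gamma>(1) n.bound(1)]
  note bnd1 = bnd[OF _ n.dom_\<Gamma>(2) n.linear_\<Gamma>(2) n.bound(2)]
  have linT: "linear_op ?H ?H ?T"
    by (intro linear_dsum_op n.linear_T H.inner_space_family_axioms)
  have lin: "linear_op ?H ?G (dsum_op H G \<Delta> |` dom ?T)" if "\<And>n. linear_op (H n) (G n) (\<Delta> n)" for \<Delta>
    by (intro linear_op_restrict[OF _ linT] linear_dsum_op that H.inner_space_family_axioms
        G.inner_space_family_axioms)
  show ?thesis
    unfolding adj
  proof (unfold_locales)
    show "hilbert_space ?H" "hilbert_space ?G"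
      using n.hilbert by (auto intro: H.hilbert_space_dsum G.hilbert_space_dsum)
    show "?T g = Some h \<longleftrightarrow> adj_pair ?H S' g h" for g h by (rule T_iff)
    show "h = vzero ?H" if "h \<in> carrier ?H" "\<And>f. f \<in> dom S' \<Longrightarrow> ip ?H f h = 0" for h
      using that by (rule total)
    show "dom (dsum_op H G \<Gamma> |` dom ?T) = dom ?T" "dom (dsum_op H G \<Gamma>' |` dom ?T) = dom ?T"
      using bnd0 bnd1 by auto
    show "linear_op ?H ?G (dsum_op H G \<Gamma> |` dom ?T)" "linear_op ?H ?G (dsum_op H G \<Gamma>' |` dom ?T)"
      by (intro lin n.linear_\<Gamma>)+
    show "(vnorm ?G (the ((dsum_op H G \<Gamma> |` dom ?T) f)))\<^sup>2 \<le> C * ((vnorm ?H f)\<^sup>2 + (vnorm ?H (the (?T f)))\<^sup>2)"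
      "(vnorm ?G (the ((dsum_op H G \<Gamma>' |` dom ?T) f)))\<^sup>2 \<le> C * ((vnorm ?H f)\<^sup>2 + (vnorm ?H (the (?T f)))\<^sup>2)"
      if "f \<in> dom ?T" for f
      using bnd0[OF that] bnd1[OF that] that by auto
    show "S' = ?T |` {f. (dsum_op H G \<Gamma> |` dom ?T) f = Some (vzero ?G) \<and>
        (dsum_op H G \<Gamma>' |` dom ?T) f = Some (vzero ?G)}" (is "_ = ?T |` ?Z")
    proof
      fix f
      have "S' f = Some h \<longleftrightarrow> ?T f = Some h \<and> f \<in> ?Z" for h
      proof -
        have "S n (f n) = Some (h n) \<longleftrightarrow> T n (f n) = Some (h n) \<and>
            \<Gamma> n (f n) = Some (vzero (G n)) \<and> \<Gamma>' n (f n) = Some (vzero (G n))" for n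
          by (subst n.S_eq) (auto simp: restrict_map_def)
        then have "S' f = Some h \<longleftrightarrow> ?T f = Some h \<and> dsum_op H G \<Gamma> f = Some (vzero ?G) \<and>
            dsum_op H G \<Gamma>' f = Some (vzero ?G)"
          using G.sum.zero_closed unfolding S'_iff dsum_op_eq_Some_iff by (auto simp: G.dsum_simps)
        then show ?thesis by (auto simp: restrict_map_def)
      qed
      then show "S' f = (?T |` ?Z) f"
        by (metis (no_types, lifting) not_Some_eq restrict_in restrict_out)
    qed
    show "ip ?H (the (?T f)) g - ip ?H f (the (?T g)) =
        ip ?G (the ((dsum_op H G \<Gamma>' |` dom ?T) f)) (the ((dsum_op H G \<Gamma> |` dom ?T) g)) -
        ip ?G (the ((dsum_op H G \<Gamma> |` dom ?T) f)) (the ((dsum_op H G \<Gamma>' |` dom ?T) g))"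
      if f: "f \<in> dom ?T" and g: "g \<in> dom ?T" for f g
    proof -
      obtain f0 f1 g0 g1 where
        fg: "dsum_op H G \<Gamma> f = Some f0" "dsum_op H G \<Gamma>' f = Some f1"
          "dsum_op H G \<Gamma> g = Some g0" "dsum_op H G \<Gamma>' g = Some g1"
        using bnd0[OF f] bnd1[OF f] bnd0[OF g] bnd1[OF g] by blast
      note fg' = fg[unfolded dsum_op_eq_Some_iff]
      have "ip (H n) (the (T n (f n))) (g n) - ip (H n) (f n) (the (T n (g n))) =
          ip (G n) (f1 n) (g0 n) - ip (G n) (f0 n) (g1 n)" for n
        using n.green[OF dom_T(2)[OF f] dom_T(2)[OF g], of n] fg' by simp
      then have "(\<Sum>n. ip (H n) (the (T n (f n))) (g n) - ip (H n) (f n) (the (T n (g n)))) =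
          (\<Sum>n. ip (G n) (f1 n) (g0 n) - ip (G n) (f0 n) (g1 n))"
        by simp
      moreover have "(\<Sum>n. ip (H n) (the (T n (f n))) (g n) - ip (H n) (f n) (the (T n (g n)))) =
          ip ?H (the (?T f)) g - ip ?H f (the (?T g))"
        unfolding dom_T(3)[OF f] dom_T(3)[OF g] H.dsum_simps using dom_T[OF f] dom_T[OF g]
        by (intro suminf_diff[symmetric] H.summable_ip) auto
      moreover have "(\<Sum>n. ip (G n) (f1 n) (g0 n) - ip (G n) (f0 n) (g1 n)) = ip ?G f1 g0 - ip ?G f0 g1"
        unfolding G.dsum_simps using fg' by (intro suminf_diff[symmetric] G.summable_ip) auto
      ultimately show ?thesis using fg f g by simp
    qed
    show "\<exists>f. (dsum_op H G \<Gamma> |` dom ?T) f = Some u \<and> (dsum_op H G \<Gamma>' |` dom ?T) f = Some v \<and>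
        (vnorm ?H f)\<^sup>2 + (vnorm ?H (the (?T f)))\<^sup>2 \<le> C * ((vnorm ?G u)\<^sup>2 + (vnorm ?G v)\<^sup>2)"
      if u: "u \<in> carrier ?G" and v: "v \<in> carrier ?G" for u v
    proof -
      \<comment> \<open>The norm estimate is carried along in the choice of preimages: it is the
        reason why both \<open>f\<close> and its image under the componentwise adjoints are square
        summable.\<close>
      have "\<exists>f. \<Gamma> n f = Some (u n) \<and> \<Gamma>' n f = Some (v n) \<and> (vnorm (H n) f)\<^sup>2 + (vnorm (H n) (the (T n f)))\<^sup>2
          \<le> C * ((vnorm (G n) (u n))\<^sup>2 + (vnorm (G n) (v n))\<^sup>2)" for n
        by (intro n.surj G.carrier_dsum_nth u v)
      then obtain f where f: "\<And>n. \<Gamma> n (f n) = Some (u n)" "\<And>n. \<Gamma>' n (f n) = Some (v n)"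
        and le: "\<And>n. (vnorm (H n) (f n))\<^sup>2 + (vnorm (H n) (the (T n (f n))))\<^sup>2
          \<le> C * ((vnorm (G n) (u n))\<^sup>2 + (vnorm (G n) (v n))\<^sup>2)"
        by metis
      have fT: "f n \<in> dom (T n)" for n unfolding n.dom_\<Gamma>(1)[symmetric] using f(1) by (rule domI)
      have sums: "(\<lambda>n. C * ((vnorm (G n) (u n))\<^sup>2 + (vnorm (G n) (v n))\<^sup>2)) sums
          (C * ((vnorm ?G u)\<^sup>2 + (vnorm ?G v)\<^sup>2))"
        by (intro sums_mult sums_add G.vnorm_dsum_sums u v)
      have summ: "summable a" if "\<And>n. a n \<ge> 0"
        "\<And>n. a n \<le> (vnorm (H n) (f n))\<^sup>2 + (vnorm (H n) (the (T n (f n))))\<^sup>2" for a :: "nat \<Rightarrow> real"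
        by (rule summable_comparison_test'[OF sums_summable[OF sums], of 0])
          (use that order_trans[OF that(2) le] in simp)
      have "summable (\<lambda>n. (vnorm (H n) (f n))\<^sup>2)" "summable (\<lambda>n. (vnorm (H n) (the (T n (f n))))\<^sup>2)"
        by (auto intro!: summ)
      then have car: "f \<in> carrier ?H" "(\<lambda>n. the (T n (f n))) \<in> carrier ?H"
        using n.T_carrier[OF fT] by (simp_all add: H.carrier_dsum_iff)
      have Tf: "?T f = Some (\<lambda>n. the (T n (f n)))"
        using car fT by (simp add: dsum_op_eq_Some_iff domIff)
      have "(vnorm ?H f)\<^sup>2 + (vnorm ?H (the (?T f)))\<^sup>2 \<le> C * ((vnorm ?G u)\<^sup>2 + (vnorm ?G v)\<^sup>2)"
        unfolding Tf option.sel
        by (rule sums_le[OF le sums_add[OF H.vnorm_dsum_sums[OF car(1)] H.vnorm_dsum_sums[OF car(2)]] sums])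
      moreover have "dsum_op H G \<Gamma> f = Some u" "dsum_op H G \<Gamma>' f = Some v"
        using car u v f by (auto simp: dsum_op_eq_Some_iff)
      ultimately show ?thesis
        using Tf by (intro exI[of _ f]) (auto simp: restrict_map_def)
    qed
    have vnorm_J: "vnorm (H n) (J n u) = vnorm (H n) u" if "u \<in> carrier (H n)" for n u
      using n.ip_J[OF that that] by (simp add: vnorm_def)
    show J_closed: "(\<lambda>n. J n (f n)) \<in> carrier ?H" if "f \<in> carrier ?H" for f
      using that by (simp add: H.carrier_dsum_iff n.J_closed vnorm_J)
    show "(\<lambda>n. J n (J n (f n))) = f" if "f \<in> carrier ?H" for f
      using H.carrier_dsum_nth[OF that] by (simp add: n.J_J)
    show "ip ?H (\<lambda>n. J n (f n)) (\<lambda>n. J n (g n)) = cnj (ip ?H f g)"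
      if f: "f \<in> carrier ?H" and g: "g \<in> carrier ?H" for f g
      unfolding H.dsum_simps bounded_linear.suminf[OF bounded_linear_cnj H.summable_ip[OF f g]]
      using H.carrier_dsum_nth[OF f] H.carrier_dsum_nth[OF g] by (simp add: n.ip_J)
    show "S' (\<lambda>n. J n (f n)) = Some (\<lambda>n. J n (the (S' f) n))" if "f \<in> dom S'" for f
    proof -
      obtain h where h: "S' f = Some h" using \<open>f \<in> dom S'\<close> by auto
      note h' = h[unfolded S'_iff]
      have "S n (J n (f n)) = Some (J n (h n))" for n
        using n.S_J[of "f n" n] h' by auto
      then show ?thesis
        unfolding h option.sel S'_iff using J_closed h' by simp
    qed
  qed
qed


section \<open>The space of square integrable functions\<close>

lemma L2_fun_const: "finite_measure M \<Longrightarrow> (\<lambda>t. c) \<in> L2_fun M"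
  by (simp add: L2_fun_def finite_measure.integrable_const)

lemma L2_fun_zero: "(\<lambda>t. 0) \<in> L2_fun M"
  by (simp add: L2_fun_def)

lemma L2_fun_scale: "f \<in> L2_fun M \<Longrightarrow> (\<lambda>t. a * f t) \<in> L2_fun M"
  by (auto simp: L2_fun_def norm_mult power_mult_distrib)

lemma L2_fun_add:
  assumes "f \<in> L2_fun M" "g \<in> L2_fun M"
  shows "(\<lambda>t. f t + g t) \<in> L2_fun M"
proof -
  have "integrable M (\<lambda>t. (norm (f t + g t))\<^sup>2)"
  proof (rule Bochner_Integration.integrable_bound)
    show "integrable M (\<lambda>t. 2 * (norm (f t))\<^sup>2 + 2 * (norm (g t))\<^sup>2)"
      using assms by (auto simp: L2_fun_def)
    show "(\<lambda>t. (norm (f t + g t))\<^sup>2) \<in> borel_measurable M"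
      using assms by (auto simp: L2_fun_def)
    have "(norm (f t + g t))\<^sup>2 \<le> 2 * (norm (f t))\<^sup>2 + 2 * (norm (g t))\<^sup>2" for t
    proof -
      have "(norm (f t + g t))\<^sup>2 \<le> (norm (f t) + norm (g t))\<^sup>2"
        by (intro power_mono norm_triangle_ineq) auto
      then show ?thesis
        using sum_squares_bound[of "norm (f t)" "norm (g t)"] by (simp add: power2_sum)
    qed
    then show "AE t in M. norm ((norm (f t + g t))\<^sup>2) \<le> norm (2 * (norm (f t))\<^sup>2 + 2 * (norm (g t))\<^sup>2)"
      by simp
  qed
  then show ?thesis using assms by (auto simp: L2_fun_def)
qed

lemma L2_fun_diff: "f \<in> L2_fun M \<Longrightarrow> g \<in> L2_fun M \<Longrightarrow> (\<lambda>t. f t - g t) \<in> L2_fun M"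
  using L2_fun_add[of f M "\<lambda>t. - 1 * g t"] L2_fun_scale[of g M "- 1"] by simp

lemma L2_fun_minus: "f \<in> L2_fun M \<Longrightarrow> (\<lambda>t. - f t) \<in> L2_fun M"
  using L2_fun_scale[of f M "- 1"] by simp

lemma L2_fun_cnj: "f \<in> L2_fun M \<Longrightarrow> (\<lambda>t. cnj (f t)) \<in> L2_fun M"
  by (auto simp: L2_fun_def intro: borel_measurable_continuous_on continuous_on_cnj continuous_on_id)

lemma L2_fun_norm: "f \<in> L2_fun M \<Longrightarrow> (\<lambda>t. of_real (norm (f t))) \<in> L2_fun M"
  by (auto simp: L2_fun_def)

lemma L2_fun_mult_integrable:
  assumes "f \<in> L2_fun M" "g \<in> L2_fun M"
  shows "integrable M (\<lambda>t. f t * g t)"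
proof (rule Bochner_Integration.integrable_bound)
  show "integrable M (\<lambda>t. (norm (f t))\<^sup>2 + (norm (g t))\<^sup>2)"
    using assms by (auto simp: L2_fun_def)
  show "(\<lambda>t. f t * g t) \<in> borel_measurable M"
    using assms by (auto simp: L2_fun_def)
  have "norm (f t * g t) \<le> (norm (f t))\<^sup>2 + (norm (g t))\<^sup>2" for t
    using sum_squares_bound[of "norm (f t)" "norm (g t)"]
      zero_le_power2[of "norm (f t)"] zero_le_power2[of "norm (g t)"]
    unfolding norm_mult by linarith
  then show "AE t in M. norm (f t * g t) \<le> norm ((norm (f t))\<^sup>2 + (norm (g t))\<^sup>2)"
    by simp
qed

lemma L2_fun_mult_cnj_integrable:
  "f \<in> L2_fun M \<Longrightarrow> g \<in> L2_fun M \<Longrightarrow> integrable M (\<lambda>t. f t * cnj (g t))"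
  by (intro L2_fun_mult_integrable L2_fun_cnj)

lemma equiv_L2_rel: "equiv (L2_fun M) (L2_rel M)"
proof (rule equivI)
  show "sym (L2_rel M)"
    by (auto simp: L2_rel_def sym_def)
  show "trans (L2_rel M)"
  proof (rule transI)
    fix f g h assume fg: "(f, g) \<in> L2_rel M" and gh: "(g, h) \<in> L2_rel M"
    have "AE t in M. f t = h t"
      using fg gh unfolding L2_rel_def by (auto elim: eventually_elim2)
    then show "(f, h) \<in> L2_rel M"
      using fg gh by (auto simp: L2_rel_def)
  qed
qed (auto simp: L2_rel_def refl_on_def)

lemma mem_L2_class_iff:
  "g \<in> L2_class M f \<longleftrightarrow> f \<in> L2_fun M \<and> g \<in> L2_fun M \<and> (AE t in M. f t = g t)"
  by (auto simp: L2_class_def L2_rel_def)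

lemma L2_class_eqI:
  assumes "f \<in> L2_fun M" "g \<in> L2_fun M" "AE t in M. f t = g t"
  shows "L2_class M f = L2_class M g"
  unfolding L2_class_def using assms by (intro equiv_class_eq[OF equiv_L2_rel]) (simp add: L2_rel_def)

lemma L2_class_eq_iff:
  assumes "f \<in> L2_fun M" "g \<in> L2_fun M"
  shows "L2_class M f = L2_class M g \<longleftrightarrow> (AE t in M. f t = g t)"
  using assms L2_class_eqI[OF assms] mem_L2_class_iff[of g M f] mem_L2_class_iff[of g M g] by auto

lemma L2_class_closed: "f \<in> L2_fun M \<Longrightarrow> L2_class M f \<in> carrier (L2_space M)"
  unfolding L2_space_def L2_class_def by (auto intro: quotientI)

lemma L2_carrierE:
  assumes "u \<in> carrier (L2_space M)"
  obtains f where "f \<in> L2_fun M" "u = L2_class M f"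
  using assms unfolding L2_space_def L2_class_def by (auto elim: quotientE)

lemma L2_rep_class:
  assumes "f \<in> L2_fun M"
  shows "L2_rep (L2_class M f) \<in> L2_fun M" "AE t in M. L2_rep (L2_class M f) t = f t"
proof -
  have "f \<in> L2_class M f" using assms by (simp add: mem_L2_class_iff)
  then have "L2_rep (L2_class M f) \<in> L2_class M f"
    unfolding L2_rep_def by (rule someI[where P = "\<lambda>g. g \<in> L2_class M f"])
  then show "L2_rep (L2_class M f) \<in> L2_fun M" "AE t in M. L2_rep (L2_class M f) t = f t"
    by (auto simp: mem_L2_class_iff elim: eventually_mono)
qed

lemma L2_rep_closed:
  assumes "u \<in> carrier (L2_space M)"
  shows "L2_rep u \<in> L2_fun M" "L2_class M (L2_rep u) = u"
proof -
  obtain f where f: "f \<in> L2_fun M" "u = L2_class M f" using assms by (rule L2_carrierE)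
  then show "L2_rep u \<in> L2_fun M" by (simp add: L2_rep_class)
  show "L2_class M (L2_rep u) = u"
    unfolding f(2) by (intro L2_class_eqI L2_rep_class f)
qed

lemma mem_L2_carrier:
  assumes "u \<in> carrier (L2_space M)" "f \<in> u"
  shows "f \<in> L2_fun M" "L2_class M f = u"
proof -
  obtain g where g: "g \<in> L2_fun M" "u = L2_class M g" using assms(1) by (rule L2_carrierE)
  then show f: "f \<in> L2_fun M" using assms(2) by (simp add: mem_L2_class_iff)
  show "L2_class M f = u"
    unfolding g(2) using assms(2) g by (intro L2_class_eqI f) (auto simp: mem_L2_class_iff elim: eventually_mono)
qed

text \<open>The operations are defined through representatives selected by \<open>SOME\<close>. This
  rule and the following ones allow computing with any representative.\<close>

lemma L2_vadd_class:
  assumes "f \<in> L2_fun M" "g \<in> L2_fun M"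
  shows "vadd (L2_space M) (L2_class M f) (L2_class M g) = L2_class M (\<lambda>t. f t + g t)"
proof -
  have "AE t in M. L2_rep (L2_class M f) t + L2_rep (L2_class M g) t = f t + g t"
    using L2_rep_class(2)[OF assms(1)] L2_rep_class(2)[OF assms(2)] by eventually_elim simp
  then show ?thesis
    unfolding L2_space_def inner_space.simps using assms
    by (intro L2_class_eqI L2_fun_add L2_rep_class)
qed

lemma L2_vscale_class:
  assumes "f \<in> L2_fun M"
  shows "vscale (L2_space M) a (L2_class M f) = L2_class M (\<lambda>t. a * f t)"
proof -
  have "AE t in M. a * L2_rep (L2_class M f) t = a * f t"
    using L2_rep_class(2)[OF assms(1)] by eventually_elim simp
  then show ?thesis
    unfolding L2_space_def inner_space.simps using assms
    by (intro L2_class_eqI L2_fun_scale L2_rep_class)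
qed

lemma L2_ip_class:
  assumes "f \<in> L2_fun M" "g \<in> L2_fun M"
  shows "ip (L2_space M) (L2_class M f) (L2_class M g) = (LINT t|M. f t * cnj (g t))"
proof -
  have "AE t in M. L2_rep (L2_class M f) t * cnj (L2_rep (L2_class M g) t) = f t * cnj (g t)"
    using L2_rep_class(2)[OF assms(1)] L2_rep_class(2)[OF assms(2)] by eventually_elim simp
  then show ?thesis
    using assms by (simp add: L2_space_def)
      (intro integral_cong_AE borel_measurable_integrable L2_fun_mult_cnj_integrable L2_rep_class, auto)
qed

lemma L2_vzero: "vzero (L2_space M) = L2_class M (\<lambda>t. 0)"
  by (simp add: L2_space_def)

lemma L2_vsub_class:
  assumes "f \<in> L2_fun M" "g \<in> L2_fun M"
  shows "vsub (L2_space M) (L2_class M f) (L2_class M g) = L2_class M (\<lambda>t. f t - g t)"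
  using assms L2_vadd_class[OF assms(1) L2_fun_minus[OF assms(2)]]
  by (simp add: L2_vscale_class)

lemma L2_Re_ip_class:
  assumes "f \<in> L2_fun M"
  shows "Re (ip (L2_space M) (L2_class M f) (L2_class M f)) = (LINT t|M. (norm (f t))\<^sup>2)"
proof -
  have "(LINT t|M. f t * cnj (f t)) = (LINT t|M. of_real ((norm (f t))\<^sup>2))"
    by (intro Bochner_Integration.integral_cong) (simp_all only: complex_norm_square)
  also have "\<dots> = of_real (LINT t|M. (norm (f t))\<^sup>2)"
    by (rule integral_complex_of_real)
  finally show ?thesis
    using assms by (simp add: L2_ip_class)
qed

lemma complex_inner_space_L2: "complex_inner_space (L2_space M)"
proof
  show "vzero (L2_space M) \<in> carrier (L2_space M)"
    by (simp add: L2_vzero L2_class_closed L2_fun_zero)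
  fix u a assume "u \<in> carrier (L2_space M)"
  then obtain f where f: "f \<in> L2_fun M" "u = L2_class M f" by (rule L2_carrierE)
  note simps = f(2) L2_vadd_class L2_vscale_class L2_ip_class L2_vzero L2_fun_add L2_fun_scale L2_fun_zero f(1)
  show "vscale (L2_space M) a u \<in> carrier (L2_space M)"
    by (simp add: simps L2_class_closed)
  show "vadd (L2_space M) u (vzero (L2_space M)) = u" "vscale (L2_space M) 1 u = u"
    "vadd (L2_space M) u (vscale (L2_space M) (- 1) u) = vzero (L2_space M)"
    using L2_fun_minus[OF f(1)] by (simp_all add: simps)
  show "vscale (L2_space M) a (vscale (L2_space M) a' u) = vscale (L2_space M) (a * a') u"
    "vscale (L2_space M) (a + a') u = vadd (L2_space M) (vscale (L2_space M) a u) (vscale (L2_space M) a' u)"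
    for a' by (simp_all add: simps mult.assoc distrib_right)
  show "0 \<le> Re (ip (L2_space M) u u)"
    unfolding f(2) L2_Re_ip_class[OF f(1)] by simp
  show "u = vzero (L2_space M)" if "ip (L2_space M) u u = 0"
  proof -
    have "(LINT t|M. (norm (f t))\<^sup>2) = 0"
      using L2_Re_ip_class[OF f(1)] that f by simp
    then have "AE t in M. (norm (f t))\<^sup>2 = 0"
      using f(1) by (subst (asm) integral_nonneg_eq_0_iff_AE) (auto simp: L2_fun_def)
    then show ?thesis
      unfolding simps using f(1) by (intro L2_class_eqI) (auto simp: L2_fun_zero)
  qed
  fix v assume "v \<in> carrier (L2_space M)"
  then obtain g where g: "g \<in> L2_fun M" "v = L2_class M g" by (rule L2_carrierE)
  note simps = simps g
  show "vadd (L2_space M) u v \<in> carrier (L2_space M)"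
    by (simp add: simps L2_class_closed)
  show "vadd (L2_space M) u v = vadd (L2_space M) v u"
    by (simp add: simps add.commute)
  show "vscale (L2_space M) a (vadd (L2_space M) u v) =
      vadd (L2_space M) (vscale (L2_space M) a u) (vscale (L2_space M) a v)"
    by (simp add: simps distrib_left)
  show "ip (L2_space M) (vscale (L2_space M) a u) v = a * ip (L2_space M) u v"
    by (simp add: simps mult.assoc)
  have "(LINT t|M. g t * cnj (f t)) = (LINT t|M. cnj (f t * cnj (g t)))"
    by (simp add: mult.commute)
  also have "\<dots> = cnj (LINT t|M. f t * cnj (g t))"
    using f g by (intro integral_bounded_linear bounded_linear_cnj L2_fun_mult_cnj_integrable)
  finally show "ip (L2_space M) v u = cnj (ip (L2_space M) u v)"
    by (simp add: simps)
  fix w assume "w \<in> carrier (L2_space M)"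
  then obtain h where h: "h \<in> L2_fun M" "w = L2_class M h" by (rule L2_carrierE)
  note simps = simps h
  show "vadd (L2_space M) (vadd (L2_space M) u v) w = vadd (L2_space M) u (vadd (L2_space M) v w)"
    by (simp add: simps add.assoc)
  show "ip (L2_space M) (vadd (L2_space M) u v) w = ip (L2_space M) u w + ip (L2_space M) v w"
    using L2_fun_mult_cnj_integrable[OF f(1) h(1)] L2_fun_mult_cnj_integrable[OF g(1) h(1)]
    by (simp add: simps distrib_right)
qed

lemma L2_vnorm_class:
  assumes "f \<in> L2_fun M"
  shows "(vnorm (L2_space M) (L2_class M f))\<^sup>2 = (LINT t|M. (norm (f t))\<^sup>2)"
  using complex_inner_space.vnorm_power2[OF complex_inner_space_L2 L2_class_closed[OF assms]]
    L2_Re_ip_class[OF assms] by simp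

lemma L2_Cauchy_Schwarz:
  assumes "f \<in> L2_fun M" "g \<in> L2_fun M"
  shows "norm (LINT t|M. f t * g t) \<le> vnorm (L2_space M) (L2_class M f) * vnorm (L2_space M) (L2_class M g)"
proof -
  have "vnorm (L2_space M) (L2_class M (\<lambda>t. cnj (g t))) = vnorm (L2_space M) (L2_class M g)"
    unfolding vnorm_def using assms by (simp add: L2_Re_ip_class L2_fun_cnj)
  then show ?thesis
    using complex_inner_space.Cauchy_Schwarz[OF complex_inner_space_L2 L2_class_closed L2_class_closed,
        OF assms(1) L2_fun_cnj[OF assms(2)]] assms
    by (simp add: L2_ip_class L2_fun_cnj)
qed

lemma L2_fun_integrable: "finite_measure M \<Longrightarrow> f \<in> L2_fun M \<Longrightarrow> integrable M f"
  using L2_fun_mult_integrable[of f M "\<lambda>t. 1"] L2_fun_const[of M 1] by simp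

text \<open>Riesz-Fischer. On a finite measure space the \<open>L2\<close> norm controls the
  \<open>L1\<close> norm, so a Cauchy sequence has a subsequence converging almost everywhere;
  Fatou's lemma upgrades this limit to one in \<open>L2\<close>.\<close>

theorem hilbert_space_L2:
  assumes fin: "finite_measure M"
  shows "hilbert_space (L2_space M)"
proof -
  interpret L: complex_inner_space "L2_space M" by (rule complex_inner_space_L2)
  let ?n = "\<lambda>f. vnorm (L2_space M) (L2_class M f)"
  show ?thesis
  proof (rule L.hilbert_spaceI)
    fix F :: "nat \<Rightarrow> _"
    assume F: "\<And>n. F n \<in> carrier (L2_space M)"
      and Cauchy: "\<And>e. e > 0 \<Longrightarrow> \<exists>N. \<forall>m\<ge>N. \<forall>n\<ge>N. vnorm (L2_space M) (vsub (L2_space M) (F m) (F n)) < e"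
    define f where "f n = L2_rep (F n)" for n
    have f: "f n \<in> L2_fun M" and Ff: "F n = L2_class M (f n)" for n
      using L2_rep_closed[OF F] by (simp_all add: f_def)
    have [measurable]: "f n \<in> borel_measurable M" for n
      using f[of n] by (simp add: L2_fun_def)
    have Cauchy': "\<exists>N. \<forall>m\<ge>N. \<forall>n\<ge>N. ?n (\<lambda>t. f m t - f n t) < e" if "e > 0" for e
      using Cauchy[OF that] f by (simp add: Ff L2_vsub_class)
    \<comment> \<open>Cauchy-Schwarz against the constant function 1.\<close>
    have L1: "(LINT t|M. norm (f m t - f n t)) \<le> ?n (\<lambda>t. f m t - f n t) * ?n (\<lambda>t. 1)" for m n
    proof -
      let ?h = "\<lambda>t. f m t - f n t"
      have h: "?h \<in> L2_fun M" by (intro L2_fun_diff f)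
      have "norm (LINT t|M. of_real (norm (?h t)) * (1 :: complex)) \<le> ?n (\<lambda>t. of_real (norm (?h t))) * ?n (\<lambda>t. 1)"
        by (intro L2_Cauchy_Schwarz L2_fun_norm h L2_fun_const fin)
      moreover have "?n (\<lambda>t. of_real (norm (?h t))) = ?n ?h"
        unfolding vnorm_def using h by (simp add: L2_Re_ip_class L2_fun_norm)
      moreover have "(LINT t|M. of_real (norm (?h t)) * (1 :: complex)) = of_real (LINT t|M. norm (?h t))"
        by simp
      ultimately show ?thesis by (simp add: abs_of_nonneg)
    qed
    obtain r where r: "strict_mono r" "AE t in M. Cauchy (\<lambda>i. f (r i) t)"
    proof (rule cauchy_L1_AE_cauchy_subseq[of M f])
      show "integrable M (f n)" for n
        by (rule L2_fun_integrable[OF fin f])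
      fix e :: real assume e: "e > 0"
      \<comment> \<open>The constant function 1 has norm zero when the measure is zero, hence the
        added 1 in the denominator below.\<close>
      have pos: "?n (\<lambda>t. 1) + 1 > 0"
        using L.vnorm_nonneg[OF L2_class_closed[OF L2_fun_const[OF fin]]] by (simp add: add_nonneg_pos)
      obtain N where N: "\<forall>m\<ge>N. \<forall>n\<ge>N. ?n (\<lambda>t. f m t - f n t) < e / (?n (\<lambda>t. 1) + 1)"
        using Cauchy'[of "e / (?n (\<lambda>t. 1) + 1)"] pos e by auto
      have "(LINT t|M. norm (f m t - f n t)) < e" if "m \<ge> N" "n \<ge> N" for m n
      proof -
        have "?n (\<lambda>t. f m t - f n t) \<ge> 0"
          by (intro L.vnorm_nonneg L2_class_closed L2_fun_diff f)
        then have "?n (\<lambda>t. f m t - f n t) * ?n (\<lambda>t. 1) \<le> ?n (\<lambda>t. f m t - f n t) * (?n (\<lambda>t. 1) + 1)"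
          by (intro mult_left_mono) auto
        also have "\<dots> < e"
          using N that pos by (simp add: pos_less_divide_eq)
        finally show ?thesis using L1[of m n] by linarith
      qed
      then show "\<exists>N. \<forall>i\<ge>N. \<forall>j\<ge>N. (LINT t|M. norm (f i t - f j t)) < e" by blast
    qed
    define g where "g t = lim (\<lambda>i. f (r i) t)" for t
    have [measurable]: "g \<in> borel_measurable M"
      unfolding g_def by (rule borel_measurable_lim_metric) simp
    have lim: "AE t in M. (\<lambda>i. f (r i) t) \<longlonglongrightarrow> g t"
      using r(2) unfolding g_def by eventually_elim (simp add: Cauchy_convergent_iff convergent_LIMSEQ_iff)
    \<comment> \<open>Fatou along the subsequence: \<open>strict_mono r\<close> gives
      \<open>r i \<ge> i\<close>, so from \<open>i = N\<close> on all integrals stay below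
      \<open>e\<^sup>2\<close>, and so does the integral of the limit.\<close>
    have close: "(\<lambda>t. f n t - g t) \<in> L2_fun M \<and> ?n (\<lambda>t. f n t - g t) \<le> e"
      if e: "e > 0" and N: "\<forall>m\<ge>N. \<forall>n\<ge>N. ?n (\<lambda>t. f m t - f n t) < e" and n: "n \<ge> N" for e N n
    proof -
      have "(\<integral>\<^sup>+t. ennreal ((norm (f n t - g t))\<^sup>2) \<partial>M) \<le>
          (\<integral>\<^sup>+t. liminf (\<lambda>i. ennreal ((norm (f n t - f (r i) t))\<^sup>2)) \<partial>M)"
      proof (rule nn_integral_mono_AE)
        show "AE t in M. ennreal ((norm (f n t - g t))\<^sup>2) \<le> liminf (\<lambda>i. ennreal ((norm (f n t - f (r i) t))\<^sup>2))"
          using lim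
        proof eventually_elim
          case (elim t)
          have "(\<lambda>i. ennreal ((norm (f n t - f (r i) t))\<^sup>2)) \<longlonglongrightarrow> ennreal ((norm (f n t - g t))\<^sup>2)"
            by (intro tendsto_ennrealI tendsto_intros elim)
          then show ?case by (simp only: lim_imp_Liminf[OF sequentially_bot] order_refl)
        qed
      qed
      also have "\<dots> \<le> liminf (\<lambda>i. \<integral>\<^sup>+t. ennreal ((norm (f n t - f (r i) t))\<^sup>2) \<partial>M)"
        by (rule nn_integral_liminf) simp
      also have "\<dots> \<le> ennreal (e\<^sup>2)"
      proof (rule Liminf_le)
        have "(\<integral>\<^sup>+t. ennreal ((norm (f n t - f (r i) t))\<^sup>2) \<partial>M) \<le> ennreal (e\<^sup>2)" if "i \<ge> N" for i
        proof -
          have d: "(\<lambda>t. f n t - f (r i) t) \<in> L2_fun M" by (intro L2_fun_diff f)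
          have "(\<integral>\<^sup>+t. ennreal ((norm (f n t - f (r i) t))\<^sup>2) \<partial>M) = ennreal ((?n (\<lambda>t. f n t - f (r i) t))\<^sup>2)"
            unfolding L2_vnorm_class[OF d] using d
            by (intro nn_integral_eq_integral) (auto simp: L2_fun_def)
          also have "\<dots> \<le> ennreal (e\<^sup>2)"
          proof (intro ennreal_leI power_mono)
            have "r i \<ge> N" using seq_suble[OF r(1), of i] that by simp
            then show "?n (\<lambda>t. f n t - f (r i) t) \<le> e" using N n by (simp add: less_imp_le)
            show "0 \<le> ?n (\<lambda>t. f n t - f (r i) t)" by (intro L.vnorm_nonneg L2_class_closed d)
          qed
          finally show ?thesis .
        qed
        then show "\<forall>\<^sub>F i in sequentially. (\<integral>\<^sup>+t. ennreal ((norm (f n t - f (r i) t))\<^sup>2) \<partial>M) \<le> ennreal (e\<^sup>2)"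
          unfolding eventually_sequentially by blast
      qed simp
      finally have le: "(\<integral>\<^sup>+t. ennreal ((norm (f n t - g t))\<^sup>2) \<partial>M) \<le> ennreal (e\<^sup>2)" .
      have int: "integrable M (\<lambda>t. (norm (f n t - g t))\<^sup>2)"
        by (rule integrableI_bounded) (use le in \<open>auto simp: order.strict_trans1\<close>)
      then have mem: "(\<lambda>t. f n t - g t) \<in> L2_fun M"
        by (simp add: L2_fun_def)
      have "ennreal (LINT t|M. (norm (f n t - g t))\<^sup>2) \<le> ennreal (e\<^sup>2)"
        using le int by (subst nn_integral_eq_integral[symmetric]) auto
      then have "(?n (\<lambda>t. f n t - g t))\<^sup>2 \<le> e\<^sup>2"
        unfolding L2_vnorm_class[OF mem] by simp
      then show ?thesis
        using mem e by (auto intro: power2_le_imp_le)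
    qed
    have g: "g \<in> L2_fun M"
    proof -
      obtain N where "\<forall>m\<ge>N. \<forall>n\<ge>N. ?n (\<lambda>t. f m t - f n t) < 1"
        using Cauchy'[of 1] by auto
      then have "(\<lambda>t. f N t - g t) \<in> L2_fun M"
        using close[of 1 N N] by simp
      then show ?thesis
        using L2_fun_diff[OF f[of N]] by fastforce
    qed
    have "\<exists>N. \<forall>n\<ge>N. vnorm (L2_space M) (vsub (L2_space M) (F n) (L2_class M g)) < e" if e: "e > 0" for e
    proof -
      obtain N where "\<forall>m\<ge>N. \<forall>n\<ge>N. ?n (\<lambda>t. f m t - f n t) < e / 2"
        using Cauchy'[of "e/2"] e by auto
      then have "\<forall>n\<ge>N. ?n (\<lambda>t. f n t - g t) \<le> e / 2"
        using close[of "e/2" N] e by auto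
      then show ?thesis
        using e f g by (intro exI[of _ N]) (fastforce simp: Ff L2_vsub_class)
    qed
    then show "\<exists>f\<in>carrier (L2_space M). \<forall>e>0. \<exists>N. \<forall>n\<ge>N. vnorm (L2_space M) (vsub (L2_space M) (F n) f) < e"
      using L2_class_closed[OF g] by blast
  qed
qed

section \<open>Complex conjugation of classes\<close>

definition L2_cnj :: "'m measure \<Rightarrow> ('m \<Rightarrow> complex) set \<Rightarrow> ('m \<Rightarrow> complex) set" where
  "L2_cnj M u = L2_class M (\<lambda>t. cnj (L2_rep u t))"

lemma L2_cnj_class:
  assumes "f \<in> L2_fun M"
  shows "L2_cnj M (L2_class M f) = L2_class M (\<lambda>t. cnj (f t))"
proof -
  have "AE t in M. cnj (L2_rep (L2_class M f) t) = cnj (f t)"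
    using L2_rep_class(2)[OF assms(1)] by eventually_elim simp
  then show ?thesis
    unfolding L2_cnj_def using assms by (intro L2_class_eqI L2_fun_cnj L2_rep_class)
qed

lemma L2_cnj_closed: "u \<in> carrier (L2_space M) \<Longrightarrow> L2_cnj M u \<in> carrier (L2_space M)"
  by (erule L2_carrierE) (simp add: L2_cnj_class L2_class_closed L2_fun_cnj)

lemma L2_cnj_cnj: "u \<in> carrier (L2_space M) \<Longrightarrow> L2_cnj M (L2_cnj M u) = u"
  by (erule L2_carrierE) (simp add: L2_cnj_class L2_fun_cnj)

lemma L2_ip_cnj:
  assumes "u \<in> carrier (L2_space M)" "v \<in> carrier (L2_space M)"
  shows "ip (L2_space M) (L2_cnj M u) (L2_cnj M v) = cnj (ip (L2_space M) u v)"
proof -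
  obtain f where f: "f \<in> L2_fun M" "u = L2_class M f" using assms(1) by (rule L2_carrierE)
  obtain g where g: "g \<in> L2_fun M" "v = L2_class M g" using assms(2) by (rule L2_carrierE)
  show ?thesis
    using f g integral_bounded_linear[OF bounded_linear_cnj L2_fun_mult_cnj_integrable[OF f(1) g(1)]]
    by (simp add: L2_cnj_class L2_ip_class L2_fun_cnj)
qed


section \<open>Sobolev functions and the formula of Green\<close>

text \<open>
  The difference of both sides, as a function of the upper end point \<open>t\<close>, has derivative zero: its
  increment over \<open>[a,b]\<close> is at most \<open>2 B (b - a) \<integral>\<^sub>a\<^sup>b |k|\<close>, and the integral is continuous in its end
  points.
\<close>

lemma integration_by_parts_primitive:
  fixes F k g g' :: "real \<Rightarrow> complex"
  assumes cd: "c < d"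
    and k: "integrable (lebesgue_on {c..d}) k"
    and F: "\<And>t. t \<in> {c..d} \<Longrightarrow> F t = F c + integral {c..t} k"
    and g: "\<And>t. t \<in> {c..d} \<Longrightarrow> (g has_vector_derivative g' t) (at t within {c..d})"
    and g': "continuous_on {c..d} g'"
    and kg: "(\<lambda>t. k t * g t) integrable_on {c..d}"
  shows "integral {c..d} (\<lambda>t. k t * g t + F t * g' t) = F d * g d - F c * g c"
proof -
  have k_int: "k integrable_on {c..d}" "(\<lambda>t. norm (k t)) integrable_on {c..d}"
    using k by (simp_all add: integrable_on_lebesgue_on)
  have sub: "f integrable_on {a..b}" if "f integrable_on {c..d}" "a \<in> {c..d}" "b \<in> {c..d}"
    for f :: "real \<Rightarrow> 'b::euclidean_space" and a b
    using that by (intro integrable_on_subinterval[OF that(1)]) auto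
  have F_cont: "continuous_on {c..d} F"
  proof -
    have "continuous_on {c..d} (\<lambda>t. F c + integral {c..t} k)"
      by (intro continuous_intros indefinite_integral_continuous_1 k_int)
    then show ?thesis using F by (metis (no_types, lifting) continuous_on_cong)
  qed
  have g_cont: "continuous_on {c..d} g"
    using g by (meson continuous_on_eq_continuous_within has_vector_derivative_continuous)
  obtain B where B: "\<And>t. t \<in> {c..d} \<Longrightarrow> norm (g' t) \<le> B" "B > 0"
  proof -
    have "bounded (g' ` {c..d})"
      by (intro compact_imp_bounded compact_continuous_image g' compact_Icc)
    then obtain b where "b > 0" "\<forall>x\<in>g' ` {c..d}. norm x \<le> b"
      unfolding bounded_pos by blast
    then show ?thesis using that[of b] by simp
  qed
  define f where "f t = k t * g t + F t * g' t" for t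
  have f_int: "f integrable_on {c..d}"
    unfolding f_def using F_cont g' by (intro integrable_add kg integrable_continuous_real continuous_intros)
  \<comment> \<open>\<open>F\<close> is a primitive of a merely integrable function and may fail to
    be differentiable at some points, so no pointwise product rule applies; the defect of the
    formula is studied as a function of the upper end point.\<close>
  define \<Phi> where "\<Phi> t = F t * g t - integral {c..t} f" for t
  define K where "K t = integral {c..t} (\<lambda>t. norm (k t))" for t
  have diff: "integral {c..b} h - integral {c..a} h = integral {a..b} h"
    if "h integrable_on {c..d}" "a \<in> {c..d}" "b \<in> {c..d}" "a \<le> b"
    for h :: "real \<Rightarrow> 'b::euclidean_space" and a b
    using Henstock_Kurzweil_Integration.integral_combine[of c a b h] that sub[of h c b]
    by (simp add: algebra_simps)
  have step: "norm (\<Phi> b - \<Phi> a) \<le> 2 * B * (b - a) * (K b - K a)"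
    if ab: "a \<in> {c..d}" "b \<in> {c..d}" "a \<le> b" for a b
  proof -
    let ?\<mu> = "K b - K a"
    have \<mu>: "?\<mu> = integral {a..b} (\<lambda>t. norm (k t))"
      unfolding K_def by (rule diff[OF k_int(2) ab])
    have s_in: "s \<in> {c..d}" if "s \<in> {a..b}" for s using ab that by auto
    have Fb: "F b - F a = integral {a..b} k"
      using diff[OF k_int(1) ab] F[OF ab(1)] F[OF ab(2)] by simp
    have F_near: "norm (F a - F s) \<le> ?\<mu>" if s: "s \<in> {a..b}" for s
    proof -
      have as: "a \<in> {c..d}" "s \<in> {c..d}" "a \<le> s" using ab s by auto
      have "F s - F a = integral {a..s} k"
        using diff[OF k_int(1) as] F[OF as(1)] F[OF as(2)] by simp
      also have "norm \<dots> \<le> integral {a..s} (\<lambda>t. norm (k t))"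
        by (intro integral_norm_bound_integral sub[OF k_int(1)] sub[OF k_int(2)] as) auto
      also have "\<dots> \<le> integral {a..b} (\<lambda>t. norm (k t))"
        using s ab as by (intro integral_subset_le sub[OF k_int(1)] sub[OF k_int(2)]) auto
      finally show ?thesis unfolding \<mu> by (simp add: norm_minus_commute)
    qed
    have g_near: "norm (g b - g s) \<le> B * (b - a)" if s: "s \<in> {a..b}" for s
    proof -
      have "(g' has_integral g b - g s) {s..b}"
        using ab s by (intro fundamental_theorem_of_calculus has_vector_derivative_within_subset[OF g]) auto
      then have "norm (g b - g s) \<le> B * measure lborel {s..b}"
        using B(2) by (rule_tac has_integral_bound_real[where S = "{}"]) (use ab s B(1) in auto)
      also have "\<dots> = B * (b - s)" using s by simp
      also have "\<dots> \<le> B * (b - a)"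
        using s B by (intro mult_left_mono) auto
      finally show ?thesis .
    qed
    have gb: "(g' has_integral g b - g a) {a..b}"
      using ab by (intro fundamental_theorem_of_calculus has_vector_derivative_within_subset[OF g]) auto
    \<comment> \<open>Freezing \<open>g\<close> at the right end and \<open>F\<close> at the left
      end makes the two integrals add up exactly to \<open>F b * g b - F a * g a\<close>. The error
      against \<open>f\<close> is \<open>k s * (g b - g s) + (F a - F s) * g' s\<close>, which
      \<open>g_near\<close> and \<open>F_near\<close> make of order \<open>b - a\<close> times the
      increment of \<open>K\<close>.\<close>
    have 1: "((\<lambda>s. k s * g b) has_integral (F b - F a) * g b) {a..b}"
      unfolding Fb by (intro has_integral_mult_left integrable_integral sub[OF k_int(1)] sub[OF k_int(2)] ab)
    have 2: "((\<lambda>s. F a * g' s) has_integral F a * (g b - g a)) {a..b}"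
      by (intro has_integral_mult_right gb)
    have 3: "(f has_integral integral {c..b} f - integral {c..a} f) {a..b}"
      unfolding diff[OF f_int ab] by (intro integrable_integral sub[OF f_int] ab)
    have "((\<lambda>s. k s * g b + F a * g' s - f s) has_integral
        (F b - F a) * g b + F a * (g b - g a) - (integral {c..b} f - integral {c..a} f)) {a..b}"
      by (intro has_integral_diff has_integral_add 1 2 3)
    moreover have "(F b - F a) * g b + F a * (g b - g a) - (integral {c..b} f - integral {c..a} f) = \<Phi> b - \<Phi> a"
      by (simp add: \<Phi>_def algebra_simps)
    ultimately have hi: "((\<lambda>s. k s * g b + F a * g' s - f s) has_integral \<Phi> b - \<Phi> a) {a..b}"
      by simp
    have "((\<lambda>s. norm (k s) * (B * (b - a)) + ?\<mu> * B) has_integral ?\<mu> * (B * (b - a)) + ?\<mu> * B * (b - a)) {a..b}"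
    proof (intro has_integral_add has_integral_mult_left)
      show "((\<lambda>s. norm (k s)) has_integral ?\<mu>) {a..b}"
        unfolding \<mu> by (intro integrable_integral sub[OF k_int(1)] sub[OF k_int(2)] ab)
      show "((\<lambda>s. ?\<mu> * B) has_integral ?\<mu> * B * (b - a)) {a..b}"
        using has_integral_const_real[of "?\<mu> * B" a b] ab by (simp add: mult.commute)
    qed
    then have bound_int: "(\<lambda>s. norm (k s) * (B * (b - a)) + ?\<mu> * B) integrable_on {a..b}"
      and bound_eq: "integral {a..b} (\<lambda>s. norm (k s) * (B * (b - a)) + ?\<mu> * B) = 2 * B * (b - a) * ?\<mu>"
      by (auto simp: integral_unique algebra_simps)
    have "norm (integral {a..b} (\<lambda>s. k s * g b + F a * g' s - f s)) \<le>
        integral {a..b} (\<lambda>s. norm (k s) * (B * (b - a)) + ?\<mu> * B)"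
    proof (rule integral_norm_bound_integral[OF _ bound_int])
      show "(\<lambda>s. k s * g b + F a * g' s - f s) integrable_on {a..b}"
        using hi by blast
      fix s assume s: "s \<in> {a..b}"
      have "k s * g b + F a * g' s - f s = k s * (g b - g s) + (F a - F s) * g' s"
        by (simp add: f_def algebra_simps)
      also have "norm \<dots> \<le> norm (k s) * norm (g b - g s) + norm (F a - F s) * norm (g' s)"
        by (metis norm_mult norm_triangle_ineq)
      also have "\<dots> \<le> norm (k s) * (B * (b - a)) + ?\<mu> * B"
        by (intro add_mono mult_mono g_near[OF s] F_near[OF s] B(1)[OF s_in[OF s]] norm_ge_zero order_refl
            order_trans[OF norm_ge_zero F_near[OF s]])
      finally show "norm (k s * g b + F a * g' s - f s) \<le> norm (k s) * (B * (b - a)) + ?\<mu> * B" .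
    qed
    then show ?thesis
      unfolding integral_unique[OF hi] bound_eq .
  qed
  have step': "norm (\<Phi> y - \<Phi> x) \<le> 2 * B * \<bar>y - x\<bar> * \<bar>K y - K x\<bar>" if "x \<in> {c..d}" "y \<in> {c..d}" for x y
  proof (cases "x \<le> y")
    case True
    have "norm (\<Phi> y - \<Phi> x) \<le> 2 * B * \<bar>y - x\<bar> * (K y - K x)"
      using step[OF that True] True by simp
    also have "\<dots> \<le> 2 * B * \<bar>y - x\<bar> * \<bar>K y - K x\<bar>"
      using B by (intro mult_left_mono) auto
    finally show ?thesis .
  next
    case False
    have "norm (\<Phi> y - \<Phi> x) \<le> 2 * B * \<bar>y - x\<bar> * (K x - K y)"
      using step[OF that(2,1)] False by (simp add: norm_minus_commute)
    also have "\<dots> \<le> 2 * B * \<bar>y - x\<bar> * \<bar>K y - K x\<bar>"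
      using B by (intro mult_left_mono) auto
    finally show ?thesis .
  qed
  have K_cont: "continuous_on {c..d} K"
    unfolding K_def by (intro indefinite_integral_continuous_1 k_int)
  have "(\<Phi> has_vector_derivative 0) (at x within {c..d})" if x: "x \<in> {c..d}" for x
    unfolding has_vector_derivative_def has_derivative_within'
  proof (intro conjI allI impI)
    fix e :: real assume e: "e > 0"
    then have "e / (2 * B) > 0" using B by simp
    then obtain \<delta> where \<delta>: "\<delta> > 0" "\<And>y. y \<in> {c..d} \<Longrightarrow> dist y x < \<delta> \<Longrightarrow> dist (K y) (K x) < e / (2 * B)"
      using K_cont x unfolding continuous_on_iff by meson
    have "norm (\<Phi> y - \<Phi> x - (y - x) *\<^sub>R 0) / norm (y - x) < e"
      if y: "y \<in> {c..d}" "0 < norm (y - x)" "norm (y - x) < \<delta>" for y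
    proof -
      have "norm (\<Phi> y - \<Phi> x) / norm (y - x) \<le> 2 * B * \<bar>K y - K x\<bar>"
        using step'[OF x y(1)] y(2) by (simp add: divide_le_eq mult_ac)
      also have "\<dots> < e"
        using \<delta>(2)[of y] y B by (simp add: dist_real_def field_simps)
      finally show ?thesis by simp
    qed
    then show "\<exists>da>0. \<forall>x'\<in>{c..d}. 0 < norm (x' - x) \<and> norm (x' - x) < da \<longrightarrow>
        norm (\<Phi> x' - \<Phi> x - (x' - x) *\<^sub>R 0) / norm (x' - x) < e"
      using \<delta>(1) by blast
  qed (simp add: bounded_linear_zero)
  then obtain C where "\<And>x. x \<in> {c..d} \<Longrightarrow> \<Phi> x = C"
    using has_vector_derivative_zero_constant[of "{c..d}" \<Phi>] by auto
  then have "\<Phi> d = \<Phi> c" using cd by simp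
  then have "integral {c..d} f = F d * g d - F c * g c" by (simp add: \<Phi>_def algebra_simps)
  then show ?thesis unfolding f_def .
qed

text \<open>Lebesgue differentiation: outside a negligible set \<open>k t\<close> is the limit of
  the averages of \<open>k\<close> over \<open>[t, t + h]\<close>, and all these averages
  vanish.\<close>

lemma primitive_zero_imp_AE_zero:
  fixes k :: "real \<Rightarrow> complex"
  assumes k: "k integrable_on {c..d}" and zero: "\<And>t. t \<in> {c..d} \<Longrightarrow> integral {c..t} k = 0"
  shows "AE t in lebesgue_on {c..d}. k t = 0"
proof -
  \<comment> \<open>Extension by zero, because the differentiation theorem asks for integrability on
    every box.\<close>
  define k' where "k' t = (if t \<in> {c..d} then k t else 0)" for t
  have "k' integrable_on UNIV"
    unfolding k'_def using k by (simp only: integrable_restrict_UNIV)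
  then have "k' integrable_on cbox a b" for a b
    by (rule integrable_on_subcbox) simp
  then obtain N where N: "negligible N" and leb:
    "\<And>x e. x \<notin> N \<Longrightarrow> 0 < e \<Longrightarrow> \<exists>\<delta>>0. \<forall>h. 0 < h \<and> h < \<delta> \<longrightarrow>
       norm (integral (cbox x (x + h *\<^sub>R One)) k' /\<^sub>R h ^ DIM(real) - k' x) < e"
    using integrable_ccontinuous_explicit[of k'] by blast
  have "k t = 0" if t: "c < t" "t < d" "t \<notin> N" for t
  proof (rule ccontr)
    assume "k t \<noteq> 0"
    then obtain \<delta> where \<delta>: "\<delta> > 0" "\<And>h. 0 < h \<Longrightarrow> h < \<delta> \<Longrightarrow> norm (integral {t..t + h} k' /\<^sub>R h - k' t) < norm (k t)"
      using leb[OF t(3), of "norm (k t)"] by auto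
    \<comment> \<open>The step is short enough for the differentiation estimate and keeps
      \<open>t + h\<close> inside the interval, where the primitive is known to vanish.\<close>
    define h where "h = min (\<delta> / 2) (d - t)"
    have h: "0 < h" "h < \<delta>" "t + h \<le> d" using \<delta> t by (auto simp: h_def)
    have "k integrable_on {c..t + h}"
      using h t by (intro integrable_on_subinterval[OF k]) auto
    then have "integral {c..t} k + integral {t..t + h} k = integral {c..t + h} k"
      using h t by (intro Henstock_Kurzweil_Integration.integral_combine) auto
    moreover have "integral {c..t} k = 0" "integral {c..t + h} k = 0"
      using h t by (auto intro!: zero)
    ultimately have "integral {t..t + h} k = 0" by simp
    moreover have "integral {t..t + h} k' = integral {t..t + h} k"
      using h t by (intro integral_cong) (auto simp: k'_def)
    ultimately show False
      using \<delta>(2)[OF h(1,2)] t by (simp add: k'_def)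
  qed
  moreover have "N \<union> {c, d} \<in> null_sets lebesgue"
    using N by (simp add: negligible_iff_null_sets[symmetric] negligible_Un)
  ultimately have "AE t in lebesgue. t \<in> {c..d} \<longrightarrow> k t = 0"
    by (intro AE_I'[of "N \<union> {c, d}"]) force+
  then show ?thesis
    by (simp add: AE_restrict_space_iff)
qed

locale compact_interval =
  fixes c d :: real
  assumes less: "c < d"
begin

abbreviation "M \<equiv> lebesgue_on {c..d}"
abbreviation "L2 \<equiv> L2_int c d"

lemma finite_measure: "finite_measure M"
  by (rule finite_measure_lebesgue_on) simp

lemma L2_fun_continuous: "continuous_on {c..d} f \<Longrightarrow> f \<in> L2_fun M"
  unfolding L2_fun_def
  by (auto intro!: continuous_imp_measurable_on_sets_lebesgue continuous_imp_integrable_real continuous_intros)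

lemma L2_fun_HK:
  assumes "f \<in> L2_fun M"
  shows "f integrable_on {c..d}"
    and "t \<in> {c..d} \<Longrightarrow> integral\<^sup>L (lebesgue_on {c..t}) f = integral {c..t} f"
proof -
  have int: "integrable M f" by (rule L2_fun_integrable[OF finite_measure assms])
  then show "f integrable_on {c..d}" by (simp add: integrable_on_lebesgue_on)
  show "integral\<^sup>L (lebesgue_on {c..t}) f = integral {c..t} f" if "t \<in> {c..d}"
    using that by (intro lebesgue_integral_eq_integral integrable_subinterval[OF int]) auto
qed

lemma continuous_AE_eq:
  fixes f g :: "real \<Rightarrow> complex"
  assumes f: "continuous_on {c..d} f" and g: "continuous_on {c..d} g"
    and ae: "AE t in M. f t = g t" and t: "t \<in> {c..d}"
  shows "f t = g t"
proof -
  have "integral\<^sup>L M (\<lambda>t. norm (f t - g t)) = integral\<^sup>L M (\<lambda>t. 0)"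
  proof (rule integral_cong_AE)
    show "(\<lambda>t. norm (f t - g t)) \<in> borel_measurable M"
      using f g by (intro continuous_imp_measurable_on_sets_lebesgue continuous_intros) auto
    show "AE t in M. norm (f t - g t) = 0"
      using ae by eventually_elim simp
  qed simp
  moreover have "integral\<^sup>L M (\<lambda>t. norm (f t - g t)) = 0 \<longleftrightarrow> (\<forall>t\<in>{c..d}. norm (f t - g t) = 0)"
    using f g less by (intro integralL_eq_0_iff continuous_intros) auto
  ultimately have "\<forall>t\<in>{c..d}. norm (f t - g t) = 0"
    unfolding Bochner_Integration.integral_zero by blast
  then have "norm (f t - g t) = 0" using t by (rule bspec)
  then show ?thesis by simp
qed

text \<open>Exchanges the Lebesgue integral of the definition for the gauge integral, in which the
  fundamental theorem of calculus and the integration by parts above are stated.\<close>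

lemma W22_fun_iff:
  "W22_fun c d f f1 f2 \<longleftrightarrow>
     (\<forall>t\<in>{c..d}. (f has_vector_derivative f1 t) (at t within {c..d})) \<and>
     f2 \<in> L2_fun M \<and> (\<forall>t\<in>{c..d}. f1 t = f1 c + integral {c..t} f2)"
proof -
  have "f1 t = f1 c + integral\<^sup>L (lebesgue_on {c..t}) f2 \<longleftrightarrow> f1 t = f1 c + integral {c..t} f2"
    if "f2 \<in> L2_fun M" "t \<in> {c..d}" for t
    by (simp only: L2_fun_HK(2)[OF that])
  then have "(\<forall>t\<in>{c..d}. f1 t = f1 c + integral\<^sup>L (lebesgue_on {c..t}) f2) \<longleftrightarrow>
      (\<forall>t\<in>{c..d}. f1 t = f1 c + integral {c..t} f2)" if "f2 \<in> L2_fun M"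
    using that by (intro ball_cong refl)
  then show ?thesis
    unfolding W22_fun_def by (intro conj_cong refl)
qed

lemma W22_funD:
  assumes "W22_fun c d f f1 f2"
  shows "t \<in> {c..d} \<Longrightarrow> (f has_vector_derivative f1 t) (at t within {c..d})"
    and "t \<in> {c..d} \<Longrightarrow> f1 t = f1 c + integral {c..t} f2"
    and "continuous_on {c..d} f" "continuous_on {c..d} f1"
    and "f \<in> L2_fun M" "f1 \<in> L2_fun M" "f2 \<in> L2_fun M"
proof -
  note W = assms[unfolded W22_fun_iff]
  show "t \<in> {c..d} \<Longrightarrow> (f has_vector_derivative f1 t) (at t within {c..d})"
    "t \<in> {c..d} \<Longrightarrow> f1 t = f1 c + integral {c..t} f2" and f2: "f2 \<in> L2_fun M"
    using W by blast+
  show f: "continuous_on {c..d} f"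
    using W by (meson continuous_on_eq_continuous_within has_vector_derivative_continuous)
  have "continuous_on {c..d} (\<lambda>t. f1 c + integral {c..t} f2)"
    by (intro continuous_intros indefinite_integral_continuous_1 L2_fun_HK f2)
  then show f1: "continuous_on {c..d} f1"
    by (rule continuous_on_eq) (use W in metis)
  show "f \<in> L2_fun M" "f1 \<in> L2_fun M"
    by (intro L2_fun_continuous f f1)+
qed

lemma W22_fun_add:
  assumes f: "W22_fun c d f f1 f2" and g: "W22_fun c d g g1 g2"
  shows "W22_fun c d (\<lambda>t. f t + g t) (\<lambda>t. f1 t + g1 t) (\<lambda>t. f2 t + g2 t)"
  unfolding W22_fun_iff
proof (intro conjI ballI)
  fix t assume t: "t \<in> {c..d}"
  show "((\<lambda>t. f t + g t) has_vector_derivative f1 t + g1 t) (at t within {c..d})"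
    by (intro has_vector_derivative_add W22_funD(1)[OF f t] W22_funD(1)[OF g t])
  have "f2 integrable_on {c..t}" "g2 integrable_on {c..t}"
    using t by (auto intro!: integrable_on_subinterval[OF L2_fun_HK(1)[OF W22_funD(7)[OF f]]]
        integrable_on_subinterval[OF L2_fun_HK(1)[OF W22_funD(7)[OF g]]])
  then show "f1 t + g1 t = f1 c + g1 c + integral {c..t} (\<lambda>t. f2 t + g2 t)"
    using W22_funD(2)[OF f t] W22_funD(2)[OF g t]
    by (simp add: Henstock_Kurzweil_Integration.integral_add)
qed (intro L2_fun_add W22_funD(7)[OF f] W22_funD(7)[OF g])

text \<open>\<open>h\<close> is only real linear, so that one argument covers both complex multiples
  and conjugation.\<close>

lemma W22_fun_bounded_linear:
  assumes f: "W22_fun c d f f1 f2" and h: "bounded_linear h" and L2: "(\<lambda>t. h (f2 t)) \<in> L2_fun M"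
  shows "W22_fun c d (\<lambda>t. h (f t)) (\<lambda>t. h (f1 t)) (\<lambda>t. h (f2 t))"
  unfolding W22_fun_iff
proof (intro conjI ballI)
  fix t assume t: "t \<in> {c..d}"
  show "((\<lambda>t. h (f t)) has_vector_derivative h (f1 t)) (at t within {c..d})"
    by (rule bounded_linear.has_vector_derivative[OF h W22_funD(1)[OF f t]])
  have "f2 integrable_on {c..t}"
    using t by (auto intro!: integrable_on_subinterval[OF L2_fun_HK(1)[OF W22_funD(7)[OF f]]])
  then have "integral {c..t} (\<lambda>t. h (f2 t)) = h (integral {c..t} f2)"
    using integral_linear[OF _ h] by (simp add: o_def)
  then show "h (f1 t) = h (f1 c) + integral {c..t} (\<lambda>t. h (f2 t))"
    using W22_funD(2)[OF f t] linear_add[OF bounded_linear.linear[OF h]] by metis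
qed (rule L2)

lemma W22_fun_scale:
  assumes "W22_fun c d f f1 f2"
  shows "W22_fun c d (\<lambda>t. a * f t) (\<lambda>t. a * f1 t) (\<lambda>t. a * f2 t)"
  by (intro W22_fun_bounded_linear[OF assms] bounded_linear_mult_right L2_fun_scale W22_funD(7)[OF assms])

lemma W22_fun_cnj:
  assumes "W22_fun c d f f1 f2"
  shows "W22_fun c d (\<lambda>t. cnj (f t)) (\<lambda>t. cnj (f1 t)) (\<lambda>t. cnj (f2 t))"
  by (intro W22_fun_bounded_linear[OF assms] bounded_linear_cnj L2_fun_cnj W22_funD(7)[OF assms])

lemma W22_fun_diff:
  assumes f: "W22_fun c d f f1 f2" and g: "W22_fun c d g g1 g2"
  shows "W22_fun c d (\<lambda>t. f t - g t) (\<lambda>t. f1 t - g1 t) (\<lambda>t. f2 t - g2 t)"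
  using W22_fun_add[OF f W22_fun_scale[OF g, of "- 1"]] by simp

text \<open>Justifies the choices in \<open>W22_rep\<close>, \<open>W22_deriv\<close> and
  \<open>W22_deriv2\<close>. Continuity settles the function, uniqueness of one-sided derivatives
  the first derivative, and the vanishing primitive of the difference the second.\<close>

lemma W22_fun_unique:
  assumes f: "W22_fun c d f f1 f2" and g: "W22_fun c d g g1 g2" and ae: "AE t in M. f t = g t"
  shows "t \<in> {c..d} \<Longrightarrow> f t = g t" "t \<in> {c..d} \<Longrightarrow> f1 t = g1 t" "AE t in M. f2 t = g2 t"
proof -
  show eq: "f t = g t" if "t \<in> {c..d}" for t
    by (rule continuous_AE_eq[OF W22_funD(3)[OF f] W22_funD(3)[OF g] ae that])
  show eq1: "f1 t = g1 t" if t: "t \<in> {c..d}" for t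
  proof (rule vector_derivative_unique_within_closed_interval[unfolded box_real, OF less t])
    show "(f has_vector_derivative f1 t) (at t within {c..d})"
      by (rule W22_funD(1)[OF f t])
    show "(f has_vector_derivative g1 t) (at t within {c..d})"
      by (rule has_vector_derivative_transform[OF t _ W22_funD(1)[OF g t]]) (simp add: eq)
  qed
  have h: "W22_fun c d (\<lambda>t. f t - g t) (\<lambda>t. f1 t - g1 t) (\<lambda>t. f2 t - g2 t)"
    by (rule W22_fun_diff[OF f g])
  have "AE t in M. f2 t - g2 t = 0"
  proof (intro primitive_zero_imp_AE_zero L2_fun_HK W22_funD(7)[OF h])
    show "integral {c..t} (\<lambda>t. f2 t - g2 t) = 0" if "t \<in> {c..d}" for t
      using W22_funD(2)[OF h that] eq1[OF that] eq1[of c] less by simp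
  qed
  then show "AE t in M. f2 t = g2 t" by simp
qed

text \<open>Each integral is integrated by parts once; both produce the integral of
  \<open>f1 t * cnj (g1 t)\<close>, which cancels.\<close>

theorem green_formula:
  assumes f: "W22_fun c d f f1 f2" and g: "W22_fun c d g g1 g2"
  shows "(LINT t|M. f2 t * cnj (g t)) - (LINT t|M. f t * cnj (g2 t)) =
    f1 d * cnj (g d) - f d * cnj (g1 d) - (f1 c * cnj (g c) - f c * cnj (g1 c))"
proof -
  note g' = W22_fun_cnj[OF g]
  have int: "(\<lambda>t. u t * v t) integrable_on {c..d} \<and> integral\<^sup>L M (\<lambda>t. u t * v t) = integral {c..d} (\<lambda>t. u t * v t)"
    if "u \<in> L2_fun M" "v \<in> L2_fun M" for u v :: "real \<Rightarrow> complex"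
    using L2_fun_mult_integrable[OF that] by (simp add: integrable_on_lebesgue_on lebesgue_integral_eq_integral)
  have parts: "(LINT t|M. u2 t * v t) + (LINT t|M. u1 t * v1 t) = u1 d * v d - u1 c * v c"
    if u: "W22_fun c d u u1 u2" and v: "W22_fun c d v v1 v2" for u u1 u2 v v1 v2
  proof -
    note L2 = W22_funD(5-7)[OF u] W22_funD(5-7)[OF v]
    have "integral {c..d} (\<lambda>t. u2 t * v t + u1 t * v1 t) = u1 d * v d - u1 c * v c"
      using int L2
      by (intro integration_by_parts_primitive less L2_fun_integrable finite_measure
          W22_funD(2)[OF u] W22_funD(1)[OF v] W22_funD(4)[OF v]) auto
    then show ?thesis
      using int L2 by (simp add: Henstock_Kurzweil_Integration.integral_add)
  qed
  have "(LINT t|M. f2 t * cnj (g t)) = f1 d * cnj (g d) - f1 c * cnj (g c) - (LINT t|M. f1 t * cnj (g1 t))"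
    using parts[OF f g'] by (simp only: eq_diff_eq)
  moreover have "(LINT t|M. f t * cnj (g2 t)) = f d * cnj (g1 d) - f c * cnj (g1 c) - (LINT t|M. f1 t * cnj (g1 t))"
    using parts[OF g' f] by (simp only: eq_diff_eq mult.commute)
  ultimately show ?thesis by simp
qed

end


section \<open>The adjoint on a compact interval\<close>

text \<open>The formula of \<open>H_op\<close> without boundary conditions; the candidate for the
  adjoint, confirmed in \<open>adj_pair_H_op_iff\<close>.\<close>

definition H_max :: "real \<Rightarrow> real \<Rightarrow> (real \<Rightarrow> complex) set \<rightharpoonup> (real \<Rightarrow> complex) set" where
  "H_max c d = (\<lambda>u. if u \<in> W22 c d
     then Some (L2_class (lebesgue_on {c..d}) (\<lambda>t. - W22_deriv2 c d u t)) else None)"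

section \<open>The boundary space\<close>

lemma ip_C2: "ip C2 u v = u $ 1 * cnj (v $ 1) + u $ 2 * cnj (v $ 2)"
  by (simp add: C2_def UNIV_2)

lemma vnorm_C2: "vnorm C2 u = norm u"
  by (simp add: vnorm_def ip_C2 norm_vec_def L2_set_def UNIV_2 complex_norm_square[symmetric]
      del: of_real_power)

lemma vnorm_C2_power2: "(vnorm C2 u)\<^sup>2 = (cmod (u $ 1))\<^sup>2 + (cmod (u $ 2))\<^sup>2"
  by (simp add: vnorm_def ip_C2 complex_norm_square[symmetric] del: of_real_power)

lemma C2_simps:
  "carrier C2 = UNIV" "vadd C2 u v = u + v" "vzero C2 = 0" "vscale C2 a u = a *s u"
  by (simp_all add: C2_def)

lemma complex_inner_space_C2: "complex_inner_space C2"
proof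
  fix u :: "complex ^ 2"
  show "u = vzero C2" if "ip C2 u u = 0"
  proof -
    have "vnorm C2 u = 0" using that by (simp add: vnorm_def)
    then show ?thesis by (simp add: vnorm_C2 C2_simps)
  qed
  show "0 \<le> Re (ip C2 u u)"
    by (simp add: ip_C2 complex_norm_square[symmetric] del: of_real_power)
qed (simp_all add: C2_simps ip_C2 vec_eq_iff algebra_simps)

lemma hilbert_space_C2: "hilbert_space C2"
proof (rule complex_inner_space.hilbert_spaceI[OF complex_inner_space_C2])
  fix F :: "nat \<Rightarrow> complex ^ 2"
  have sub: "vsub C2 u v = u - v" for u v by (simp add: C2_simps vec_eq_iff)
  assume "\<And>e. 0 < e \<Longrightarrow> \<exists>N. \<forall>m\<ge>N. \<forall>n\<ge>N. vnorm C2 (vsub C2 (F m) (F n)) < e"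
  then have "Cauchy F"
    unfolding sub vnorm_C2 by (auto simp: Cauchy_def dist_norm)
  then obtain f where "F \<longlonglongrightarrow> f"
    by (auto simp: Cauchy_convergent_iff convergent_def)
  then show "\<exists>f\<in>carrier C2. \<forall>e>0. \<exists>N. \<forall>n\<ge>N. vnorm C2 (vsub C2 (F n) f) < e"
    unfolding sub vnorm_C2 C2_simps by (auto simp: LIMSEQ_iff)
qed

context compact_interval
begin

sublocale L2: complex_inner_space L2
  by (rule complex_inner_space_L2)

text \<open>Eliminates the \<open>SOME\<close> operators: whatever they select agrees with any given
  triple \<open>f\<close>, \<open>f1\<close>, \<open>f2\<close> by \<open>W22_fun_unique\<close>.
  From here on elements of the Sobolev space are handled through such triples.\<close>

lemma W22_classD:
  assumes f: "W22_fun c d f f1 f2"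
  defines "u \<equiv> L2_class M f"
  shows "u \<in> W22 c d"
    and "t \<in> {c..d} \<Longrightarrow> W22_rep c d u t = f t"
    and "t \<in> {c..d} \<Longrightarrow> W22_deriv c d u t = f1 t"
    and "W22_deriv2 c d u \<in> L2_fun M"
    and "AE t in M. W22_deriv2 c d u t = f2 t"
proof -
  have fu: "f \<in> u" unfolding u_def using W22_funD(5)[OF f] by (simp add: mem_L2_class_iff)
  then show "u \<in> W22 c d"
    unfolding W22_def u_def using f W22_funD(5)[OF f] by (auto intro: L2_class_closed)
  let ?r = "W22_rep c d u"
  have "?r \<in> u \<and> (\<exists>f1 f2. W22_fun c d ?r f1 f2)"
    unfolding W22_rep_def by (rule someI[where x = f]) (use fu f in blast)
  then obtain r1 r2 where r: "?r \<in> u" "W22_fun c d ?r r1 r2" by blast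
  have ae: "AE t in M. ?r t = f t"
    using r(1) unfolding u_def by (auto simp: mem_L2_class_iff elim: eventually_mono)
  note eq = W22_fun_unique[OF r(2) f ae]
  show "?r t = f t" if "t \<in> {c..d}" for t by (rule eq(1)[OF that])
  show "W22_deriv c d u t = f1 t" if t: "t \<in> {c..d}" for t
  proof -
    have "vector_derivative ?r (at t within {c..d}) = r1 t"
      using vector_derivative_within_cbox[of c d t ?r "r1 t"] W22_funD(1)[OF r(2) t] less t by simp
    then show ?thesis using eq(2)[OF t] by (simp add: W22_deriv_def)
  qed
  have "\<exists>f1. W22_fun c d ?r f1 (W22_deriv2 c d u)"
    unfolding W22_deriv2_def by (rule someI[where x = r2]) (use r in blast)
  then obtain s1 where s: "W22_fun c d ?r s1 (W22_deriv2 c d u)" ..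
  show "W22_deriv2 c d u \<in> L2_fun M" by (rule W22_funD(7)[OF s])
  show "AE t in M. W22_deriv2 c d u t = f2 t" by (rule W22_fun_unique(3)[OF s f ae])
qed

lemma W22E:
  assumes "u \<in> W22 c d"
  obtains f f1 f2 where "W22_fun c d f f1 f2" "u = L2_class M f"
proof -
  obtain f f1 f2 where f: "u \<in> carrier L2" "f \<in> u" "W22_fun c d f f1 f2"
    using assms unfolding W22_def by blast
  then show ?thesis using that mem_L2_carrier(2)[OF f(1,2)] by metis
qed

section \<open>Operators and boundary mappings evaluated on explicit representatives\<close>

lemma deriv2_class:
  assumes f: "W22_fun c d f f1 f2"
  shows "L2_class M (\<lambda>t. - W22_deriv2 c d (L2_class M f) t) = L2_class M (\<lambda>t. - f2 t)"
proof (rule L2_class_eqI)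
  show "AE t in M. - W22_deriv2 c d (L2_class M f) t = - f2 t"
    using W22_classD(5)[OF f] by eventually_elim simp
qed (intro L2_fun_minus W22_classD(4)[OF f] W22_funD(7)[OF f])+

lemma H_max_class:
  "W22_fun c d f f1 f2 \<Longrightarrow> H_max c d (L2_class M f) = Some (L2_class M (\<lambda>t. - f2 t))"
  by (simp add: H_max_def W22_classD(1) deriv2_class)

lemma W22_0_class_iff:
  assumes f: "W22_fun c d f f1 f2"
  shows "L2_class M f \<in> W22_0 c d \<longleftrightarrow> f c = 0 \<and> f1 c = 0 \<and> f d = 0 \<and> f1 d = 0"
  unfolding W22_0_def using less by (simp add: W22_classD(1-3)[OF f])

lemma H_op_class:
  "W22_fun c d f f1 f2 \<Longrightarrow> f c = 0 \<Longrightarrow> f1 c = 0 \<Longrightarrow> f d = 0 \<Longrightarrow> f1 d = 0 \<Longrightarrow>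
     H_op c d (L2_class M f) = Some (L2_class M (\<lambda>t. - f2 t))"
  by (simp add: H_op_def W22_0_class_iff deriv2_class)

lemma dom_H_opE:
  assumes "u \<in> dom (H_op c d)"
  obtains f f1 f2 where "W22_fun c d f f1 f2" "f c = 0" "f1 c = 0" "f d = 0" "f1 d = 0"
    "u = L2_class M f" "H_op c d u = Some (L2_class M (\<lambda>t. - f2 t))"
proof -
  have u: "u \<in> W22_0 c d" using assms by (auto simp: H_op_def split: if_splits)
  then have "u \<in> W22 c d" by (simp add: W22_0_def)
  then obtain f f1 f2 where f: "W22_fun c d f f1 f2" "u = L2_class M f" by (rule W22E)
  have bc: "f c = 0" "f1 c = 0" "f d = 0" "f1 d = 0"
    using u W22_0_class_iff[OF f(1)] f(2) by auto
  show ?thesis by (rule that[OF f(1) bc f(2)]) (use f bc in \<open>simp add: H_op_class\<close>)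
qed

lemma dom_H_maxE:
  assumes "u \<in> dom (H_max c d)"
  obtains f f1 f2 where "W22_fun c d f f1 f2" "u = L2_class M f"
    "H_max c d u = Some (L2_class M (\<lambda>t. - f2 t))"
proof -
  have "u \<in> W22 c d" using assms by (auto simp: H_max_def split: if_splits)
  then obtain f f1 f2 where f: "W22_fun c d f f1 f2" "u = L2_class M f" by (rule W22E)
  show ?thesis by (rule that[OF f]) (use f in \<open>simp add: H_max_class\<close>)
qed

lemma dom_H_max: "dom (H_max c d) = W22 c d"
  by (auto simp: H_max_def split: if_splits)

lemma Gamma_class:
  assumes f: "W22_fun c d f f1 f2"
  shows "Gamma0 c d (L2_class M f) = Some (vector [of_real (sqrt (d - c)) * f c, - of_real (sqrt (d - c)) * f d])"
    and "Gamma1 c d (L2_class M f) = Some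
      (vector [(of_real (d - c) * f1 c + (f c - f d)) / of_real ((d - c) * sqrt (d - c)),
               (of_real (d - c) * f1 d + (f c - f d)) / of_real ((d - c) * sqrt (d - c))])"
proof -
  have "(d - c) powr (3 / 2) = (d - c) powr (1 + 1 / 2)" by simp
  also have "\<dots> = (d - c) * sqrt (d - c)"
    using less by (subst powr_add) (simp add: powr_half_sqrt)
  finally have p: "(d - c) powr (3 / 2) = (d - c) * sqrt (d - c)" .
  show "Gamma0 c d (L2_class M f) = Some (vector [of_real (sqrt (d - c)) * f c, - of_real (sqrt (d - c)) * f d])"
    using less by (simp add: Gamma0_def Let_def W22_classD(1-3)[OF f] powr_half_sqrt)
  show "Gamma1 c d (L2_class M f) = Some
      (vector [(of_real (d - c) * f1 c + (f c - f d)) / of_real ((d - c) * sqrt (d - c)),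
               (of_real (d - c) * f1 d + (f c - f d)) / of_real ((d - c) * sqrt (d - c))])"
    unfolding Gamma1_def Let_def p using less by (simp add: W22_classD(1-3)[OF f])
qed

text \<open>Source of every explicit test function below: the zero function, affine functions, and
  the cubics for interpolation and for the boundary bounds.\<close>

lemma W22_fun_cubic:
  "W22_fun c d
     (\<lambda>t. a0 + a1 * of_real (t - c) + a2 * of_real (t - c) ^ 2 + a3 * of_real (t - c) ^ 3)
     (\<lambda>t. a1 + 2 * a2 * of_real (t - c) + 3 * a3 * of_real (t - c) ^ 2)
     (\<lambda>t. 2 * a2 + 6 * a3 * of_real (t - c))"
proof -
  have vd: "((\<lambda>t. b0 + b1 * of_real (t - c) + b2 * of_real (t - c) ^ 2 + b3 * of_real (t - c) ^ 3)
      has_vector_derivative b1 + 2 * b2 * of_real (t - c) + 3 * b3 * of_real (t - c) ^ 2) (at t within S)"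
    for b0 b1 b2 b3 :: complex and t S
  proof -
    have "((\<lambda>z. b0 + b1 * (z - of_real c) + b2 * (z - of_real c) ^ 2 + b3 * (z - of_real c) ^ 3)
      has_field_derivative b1 + 2 * b2 * (of_real t - of_real c) + 3 * b3 * (of_real t - of_real c) ^ 2)
      (at (of_real t))"
      by (auto intro!: derivative_eq_intros simp: algebra_simps)
    from has_vector_derivative_real_field[OF this] show ?thesis by simp
  qed
  show ?thesis
    unfolding W22_fun_iff
  proof (intro conjI ballI vd)
    show L2: "(\<lambda>t. 2 * a2 + 6 * a3 * of_real (t - c)) \<in> L2_fun M"
      by (intro L2_fun_continuous continuous_intros)
    fix t assume t: "t \<in> {c..d}"
    have "((\<lambda>t. 2 * a2 + 6 * a3 * of_real (t - c)) has_integral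
        (a1 + 2 * a2 * of_real (t - c) + 3 * a3 * of_real (t - c) ^ 2) - (a1 + 2 * a2 * of_real (c - c) + 3 * a3 * of_real (c - c) ^ 2))
        {c..t}"
    proof (rule fundamental_theorem_of_calculus)
      show "((\<lambda>t. a1 + 2 * a2 * of_real (t - c) + 3 * a3 * of_real (t - c) ^ 2)
          has_vector_derivative 2 * a2 + 6 * a3 * of_real (s - c)) (at s within {c..t})" for s
        \<comment> \<open>The derivative is a polynomial of the same shape, with coefficients
          \<open>a1\<close>, \<open>2 * a2\<close>, \<open>3 * a3\<close>, \<open>0\<close>.\<close>
        using vd[of a1 "2 * a2" "3 * a3" 0 s "{c..t}"] by (simp add: mult.assoc)
    qed (use t in simp)
    then show "a1 + 2 * a2 * of_real (t - c) + 3 * a3 * of_real (t - c) ^ 2 =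
        a1 + 2 * a2 * of_real (c - c) + 3 * a3 * of_real (c - c) ^ 2 +
        integral {c..t} (\<lambda>t. 2 * a2 + 6 * a3 * of_real (t - c))"
      by (simp add: integral_unique)
  qed
qed

lemma W22_fun_primitive:
  assumes k: "k \<in> L2_fun M"
  shows "\<exists>f f1. W22_fun c d f f1 k \<and> f c = 0 \<and> f1 c = 0"
proof -
  define f1 where "f1 t = integral {c..t} k" for t
  define f where "f t = integral {c..t} f1" for t
  have "continuous_on {c..d} f1"
    unfolding f1_def by (intro indefinite_integral_continuous_1 L2_fun_HK k)
  then have "(f has_vector_derivative f1 t) (at t within {c..d})" if "t \<in> {c..d}" for t
    unfolding f_def using that by (rule integral_has_vector_derivative)
  moreover have "f1 c = 0" "f c = 0" by (simp_all add: f1_def f_def)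
  ultimately have "W22_fun c d f f1 k"
    unfolding W22_fun_iff using k by (simp add: f1_def)
  then show ?thesis using \<open>f1 c = 0\<close> \<open>f c = 0\<close> by blast
qed

text \<open>The second derivative \<open>q2\<close> is affine and is recorded as a Sobolev function
  in its own right, because Green's formula will be applied to it as well.\<close>

lemma cubic_interpolation:
  "\<exists>q q1 q2 q3. W22_fun c d q q1 q2 \<and> W22_fun c d q2 q3 (\<lambda>t. 0) \<and>
     q c = 0 \<and> q1 c = 0 \<and> q d = A \<and> q1 d = B"
proof -
  define l :: complex where "l = of_real (d - c)"
  have l: "l \<noteq> 0" using less by (simp add: l_def)
  \<comment> \<open>Solution of the linear system expressing the value \<open>A\<close> and the
    slope \<open>B\<close> at \<open>d\<close>; the conditions at \<open>c\<close> already exclude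
    lower powers.\<close>
  define a2 where "a2 = (3 * A - B * l) / l ^ 2"
  define a3 where "a3 = (B * l - 2 * A) / l ^ 3"
  have "a2 * l ^ 2 + a3 * l ^ 3 = A" "2 * a2 * l + 3 * a3 * l ^ 2 = B"
    using l by (simp_all add: a2_def a3_def power2_eq_square power3_eq_cube field_simps)
  then show ?thesis
    using W22_fun_cubic[of 0 0 a2 a3] W22_fun_cubic[of "2 * a2" "6 * a3" 0 0] unfolding l_def
    by (intro exI conjI) (assumption | simp)+
qed

text \<open>
  With \<open>K'' = g + k\<close> where \<open>k'' = h\<close>, and \<open>q\<close> the cubic with the same boundary values as \<open>K\<close>,
  the function \<open>K - q\<close> satisfies all boundary conditions and its second derivative is orthogonal
  both to \<open>g + k\<close> and to the affine function \<open>q''\<close>, hence vanishes.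
\<close>

lemma weak_solution_W22:
  assumes g: "g \<in> L2_fun M" and h: "h \<in> L2_fun M"
    and weak: "\<And>f f1 f2. W22_fun c d f f1 f2 \<Longrightarrow> f c = 0 \<Longrightarrow> f1 c = 0 \<Longrightarrow> f d = 0 \<Longrightarrow> f1 d = 0 \<Longrightarrow>
        (LINT t|M. - f2 t * cnj (g t)) = (LINT t|M. f t * cnj (h t))"
  shows "\<exists>f f1. W22_fun c d f f1 (\<lambda>t. - h t) \<and> (AE t in M. f t = g t)"
proof -
  obtain k k1 where k: "W22_fun c d k k1 h"
    using W22_fun_primitive[OF h] by blast
  note kL = W22_funD(5)[OF k]
  obtain K K1 where K: "W22_fun c d K K1 (\<lambda>t. g t + k t)" "K c = 0" "K1 c = 0"
    using W22_fun_primitive[OF L2_fun_add[OF g kL]] by blast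
  obtain q q1 q2 q3 where q: "W22_fun c d q q1 q2" "W22_fun c d q2 q3 (\<lambda>t. 0)"
    "q c = 0" "q1 c = 0" "q d = K d" "q1 d = K1 d"
    using cubic_interpolation by blast
  define w where "w t = g t + k t - q2 t" for t
  have W: "W22_fun c d (\<lambda>t. K t - q t) (\<lambda>t. K1 t - q1 t) w"
    unfolding w_def by (rule W22_fun_diff[OF K(1) q(1)])
  note wL = W22_funD(7)[OF W]
  have bc: "K c - q c = 0" "K1 c - q1 c = 0" "K d - q d = 0" "K1 d - q1 d = 0"
    using K q by auto
  have int: "integrable M (\<lambda>t. w t * cnj (v t))" if "v \<in> L2_fun M" for v
    by (intro L2_fun_mult_cnj_integrable wL that)
  have 1: "(LINT t|M. w t * cnj (k t)) = (LINT t|M. (K t - q t) * cnj (h t))"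
    using green_formula[OF W k] bc by simp
  have 2: "- (LINT t|M. w t * cnj (g t)) = (LINT t|M. (K t - q t) * cnj (h t))"
    using weak[OF W bc] by simp
  have 3: "(LINT t|M. w t * cnj (q2 t)) = 0"
    using green_formula[OF W q(2)] bc by simp
  have "(LINT t|M. w t * cnj (w t)) =
      (LINT t|M. w t * cnj (g t)) + (LINT t|M. w t * cnj (k t)) - (LINT t|M. w t * cnj (q2 t))"
  proof -
    have "w t * cnj (w t) = w t * cnj (g t) + w t * cnj (k t) - w t * cnj (q2 t)" for t
      unfolding w_def[of t] by (simp add: algebra_simps)
    then show ?thesis
      using int[OF g] int[OF kL] int[OF W22_funD(5)[OF q(2)]] by simp
  qed
  also have "\<dots> = 0" using 1 2 3 by (metis add.right_inverse add_uminus_conv_diff diff_self minus_minus)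
  finally have "ip L2 (L2_class M w) (L2_class M w) = 0"
    by (simp add: L2_ip_class wL)
  then have "L2_class M w = L2_class M (\<lambda>t. 0)"
    using L2.ip_definite[OF L2_class_closed[OF wL]] by (simp add: L2_vzero)
  then have "AE t in M. w t = 0"
    by (simp add: L2_class_eq_iff wL L2_fun_zero)
  \<comment> \<open>With \<open>w = 0\<close> the function \<open>g\<close> equals
    \<open>q2 - k\<close>, affine minus a twice integrated \<open>h\<close>: this is the regularity
    claimed.\<close>
  then have ae: "AE t in M. q2 t - k t = g t"
    by eventually_elim (simp add: w_def algebra_simps)
  have "W22_fun c d (\<lambda>t. q2 t - k t) (\<lambda>t. q3 t - k1 t) (\<lambda>t. - h t)"
    using W22_fun_diff[OF q(2) k] by simp
  then show ?thesis using ae by blast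
qed

lemma adj_pair_H_opD:
  assumes uv: "adj_pair L2 (H_op c d) u v"
  obtains f f1 h where "W22_fun c d f f1 (\<lambda>t. - h t)" "h \<in> L2_fun M" "u = L2_class M f" "v = L2_class M h"
proof -
  obtain g where g: "g \<in> L2_fun M" "u = L2_class M g"
    using uv by (auto simp: adj_pair_def elim: L2_carrierE)
  obtain h where h: "h \<in> L2_fun M" "v = L2_class M h"
    using uv by (auto simp: adj_pair_def elim: L2_carrierE)
  have "\<exists>f f1. W22_fun c d f f1 (\<lambda>t. - h t) \<and> (AE t in M. f t = g t)"
  proof (rule weak_solution_W22[OF g(1) h(1)])
    fix f f1 f2 assume f: "W22_fun c d f f1 f2" and bc: "f c = 0" "f1 c = 0" "f d = 0" "f1 d = 0"
    note S = H_op_class[OF f bc]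
    then have "ip L2 (the (H_op c d (L2_class M f))) u = ip L2 (L2_class M f) v"
      using uv unfolding adj_pair_def by blast
    then show "(LINT t|M. - f2 t * cnj (g t)) = (LINT t|M. f t * cnj (h t))"
      unfolding S option.sel g(2) h(2) using W22_funD(5,7)[OF f] g h
      by (simp add: L2_ip_class L2_fun_minus)
  qed
  then obtain f f1 where f: "W22_fun c d f f1 (\<lambda>t. - h t)" "AE t in M. f t = g t" by blast
  have "u = L2_class M f"
    unfolding g(2) using f g(1) by (intro L2_class_eqI W22_funD(5)[OF f(1)]) (auto elim: eventually_mono)
  then show ?thesis using that f h by blast
qed

lemma adj_pair_H_op_iff: "H_max c d u = Some v \<longleftrightarrow> adj_pair L2 (H_op c d) u v"
proof
  assume "adj_pair L2 (H_op c d) u v"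
  then obtain f f1 h where f: "W22_fun c d f f1 (\<lambda>t. - h t)" "u = L2_class M f" "v = L2_class M h"
    by (rule adj_pair_H_opD)
  then show "H_max c d u = Some v" using H_max_class[OF f(1)] by simp
next
  assume uv: "H_max c d u = Some v"
  then obtain g g1 g2 where g: "W22_fun c d g g1 g2" "u = L2_class M g" "v = L2_class M (\<lambda>t. - g2 t)"
    by (metis dom_H_maxE domI option.sel)
  note gL = W22_funD(5,7)[OF g(1)]
  have "ip L2 (the (H_op c d w)) u = ip L2 w v" if "w \<in> dom (H_op c d)" for w
  proof -
    obtain f f1 f2 where f: "W22_fun c d f f1 f2" "f c = 0" "f1 c = 0" "f d = 0" "f1 d = 0"
      "w = L2_class M f" "H_op c d w = Some (L2_class M (\<lambda>t. - f2 t))"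
      using \<open>w \<in> dom (H_op c d)\<close> by (rule dom_H_opE)
    have "(LINT t|M. f2 t * cnj (g t)) = (LINT t|M. f t * cnj (g2 t))"
      using green_formula[OF f(1) g(1)] f(2-5) by simp
    then show ?thesis
      unfolding f(7) option.sel
      using W22_funD(5,7)[OF f(1)] gL by (simp add: f(6) g(2,3) L2_ip_class L2_fun_minus)
  qed
  then show "adj_pair L2 (H_op c d) u v"
    using gL by (simp add: adj_pair_def g(2,3) L2_class_closed L2_fun_minus)
qed

text \<open>Orthogonality of \<open>v\<close> to the domain says that the zero vector and
  \<open>v\<close> form an adjoint pair. By regularity \<open>v\<close> is then minus the second
  derivative of a representative of zero, which vanishes almost everywhere by uniqueness.\<close>

lemma total_H_op:
  assumes v: "v \<in> carrier L2" and orth: "\<And>u. u \<in> dom (H_op c d) \<Longrightarrow> ip L2 u v = 0"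
  shows "v = vzero L2"
proof -
  have "ip L2 (the (H_op c d u)) (vzero L2) = ip L2 u v" if u: "u \<in> dom (H_op c d)" for u
  proof -
    obtain f f1 f2 where f: "W22_fun c d f f1 f2" "H_op c d u = Some (L2_class M (\<lambda>t. - f2 t))"
      using u by (rule dom_H_opE)
    then show ?thesis
      using orth[OF u] W22_funD(7)[OF f(1)] by (simp add: L2.ip_zero_right L2_class_closed L2_fun_minus)
  qed
  then have "adj_pair L2 (H_op c d) (vzero L2) v"
    using v by (simp add: adj_pair_def L2.zero_closed)
  then obtain f f1 h where f: "W22_fun c d f f1 (\<lambda>t. - h t)" "h \<in> L2_fun M" "vzero L2 = L2_class M f" "v = L2_class M h"
    by (rule adj_pair_H_opD)
  have "AE t in M. (0::complex) = f t"
    using f W22_funD(5)[OF f(1)] by (simp add: L2_vzero L2_class_eq_iff L2_fun_zero)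
  moreover have "W22_fun c d (\<lambda>t. 0) (\<lambda>t. 0) (\<lambda>t. 0)"
    using W22_fun_cubic[of 0 0 0 0] by simp
  ultimately have "AE t in M. (0::complex) = - h t"
    using W22_fun_unique(3) f(1) by blast
  then have "AE t in M. h t = 0" by simp
  then show ?thesis
    unfolding f(4) L2_vzero using f(2) by (simp add: L2_class_eq_iff L2_fun_zero)
qed

end


section \<open>The boundary mappings on a compact interval\<close>

context compact_interval
begin

section \<open>Boundary data estimated by testing Green's formula\<close>

lemma vnorm_class_le:
  assumes f: "f \<in> L2_fun M" and B: "B \<ge> 0" "\<And>t. t \<in> {c..d} \<Longrightarrow> norm (f t) \<le> B"
  shows "vnorm L2 (L2_class M f) \<le> B * sqrt (d - c)"
proof (rule power2_le_imp_le)
  have "(LINT t|M. (norm (f t))\<^sup>2) \<le> (LINT t|M. B\<^sup>2)"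
  proof (rule integral_mono)
    show "integrable M (\<lambda>t. (norm (f t))\<^sup>2)" using f by (simp add: L2_fun_def)
    show "integrable M (\<lambda>t. B\<^sup>2)" by (intro finite_measure.integrable_const finite_measure)
  qed (use B in \<open>auto intro: power_mono\<close>)
  also have "\<dots> = B\<^sup>2 * (d - c)"
    using less by (simp add: measure_restrict_space)
  finally show "(vnorm L2 (L2_class M f))\<^sup>2 \<le> (B * sqrt (d - c))\<^sup>2"
    using less by (simp add: L2_vnorm_class[OF f] power_mult_distrib)
qed (use B less in simp)

text \<open>A test function \<open>g\<close> selects, through its boundary values, one functional of
  the boundary data of \<open>f\<close>. Pointwise bounds on \<open>g\<close> and \<open>g2\<close>
  become norm bounds at the cost of \<open>sqrt (d - c)\<close>.\<close>

lemma green_bound: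
  assumes f: "W22_fun c d f f1 f2" and g: "W22_fun c d g g1 g2"
    and B: "B \<ge> 0" "\<And>t. t \<in> {c..d} \<Longrightarrow> norm (g t) \<le> B"
    and B2: "B2 \<ge> 0" "\<And>t. t \<in> {c..d} \<Longrightarrow> norm (g2 t) \<le> B2"
  shows "norm (f1 d * cnj (g d) - f d * cnj (g1 d) - (f1 c * cnj (g c) - f c * cnj (g1 c))) \<le>
    (vnorm L2 (L2_class M f2) * B + vnorm L2 (L2_class M f) * B2) * sqrt (d - c)"
proof -
  have CS: "norm (LINT t|M. u t * cnj (v t)) \<le> vnorm L2 (L2_class M u) * (b * sqrt (d - c))"
    if "u \<in> L2_fun M" "v \<in> L2_fun M" "b \<ge> 0" "\<And>t. t \<in> {c..d} \<Longrightarrow> norm (v t) \<le> b" for u v b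
  proof -
    have "norm (LINT t|M. u t * cnj (v t)) \<le> vnorm L2 (L2_class M u) * vnorm L2 (L2_class M v)"
      using L2.Cauchy_Schwarz[OF L2_class_closed[OF that(1)] L2_class_closed[OF that(2)]] that
      by (simp add: L2_ip_class)
    also have "\<dots> \<le> vnorm L2 (L2_class M u) * (b * sqrt (d - c))"
      by (intro mult_left_mono vnorm_class_le that L2.vnorm_nonneg L2_class_closed)
    finally show ?thesis .
  qed
  have "norm ((LINT t|M. f2 t * cnj (g t)) - (LINT t|M. f t * cnj (g2 t))) \<le>
      vnorm L2 (L2_class M f2) * (B * sqrt (d - c)) + vnorm L2 (L2_class M f) * (B2 * sqrt (d - c))"
    by (intro order_trans[OF norm_triangle_ineq4] add_mono CS W22_funD(5,7)[OF f] W22_funD(5,7)[OF g] B B2)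
  then show ?thesis
    unfolding green_formula[OF f g] by (simp add: algebra_simps)
qed

lemma relative_position:
  assumes "t \<in> {c..d}"
  obtains x where "t - c = (d - c) * x" "0 \<le> x" "x \<le> 1"
  using that[of "(t - c) / (d - c)"] assms less by (simp add: field_simps)

text \<open>The Hermite cubic \<open>l * x * (1 - x)^2\<close> in the relative coordinate
  \<open>x = (t - c) / l\<close>. Its only nonzero boundary datum is the slope 1 at
  \<open>c\<close>, so the boundary terms of Green's formula reduce to \<open>f c\<close>.\<close>

lemma hermite_left:
  "\<exists>a a1 a2. W22_fun c d a a1 a2 \<and> a c = 0 \<and> a1 c = 1 \<and> a d = 0 \<and> a1 d = 0 \<and>
     (\<forall>t\<in>{c..d}. norm (a t) \<le> d - c) \<and> (\<forall>t\<in>{c..d}. norm (a2 t) \<le> 4 / (d - c))"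
proof -
  let ?l = "d - c"
  define a where "a = (\<lambda>t. of_real (?l * (((t - c) / ?l) * (1 - (t - c) / ?l)\<^sup>2)) :: complex)"
  define a1 where "a1 = (\<lambda>t. of_real (1 - 4 * ((t - c) / ?l) + 3 * ((t - c) / ?l)\<^sup>2) :: complex)"
  define a2 where "a2 = (\<lambda>t. of_real ((6 * ((t - c) / ?l) - 4) / ?l) :: complex)"
  have l: "?l \<noteq> 0" using less by simp
  have cub: "W22_fun c d
     (\<lambda>t. 0 + 1 * of_real (t - c) + of_real (- 2 / ?l) * of_real (t - c) ^ 2 + of_real (1 / ?l\<^sup>2) * of_real (t - c) ^ 3)
     (\<lambda>t. 1 + 2 * of_real (- 2 / ?l) * of_real (t - c) + 3 * of_real (1 / ?l\<^sup>2) * of_real (t - c) ^ 2)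
     (\<lambda>t. 2 * of_real (- 2 / ?l) + 6 * of_real (1 / ?l\<^sup>2) * of_real (t - c))"
    by (rule W22_fun_cubic)
  have "a t = 0 + 1 * of_real (t - c) + of_real (- 2 / ?l) * of_real (t - c) ^ 2 + of_real (1 / ?l\<^sup>2) * of_real (t - c) ^ 3" for t
  proof -
    \<comment> \<open>\<open>L\<close> and \<open>s\<close> replace \<open>d - c\<close> and
      \<open>t - c\<close> by atoms, so that clearing denominators does not expand the
      differences.\<close>
    have "?l * (((t - c) / ?l) * (1 - (t - c) / ?l)\<^sup>2) = 0 + 1 * (t - c) + (- 2 / ?l) * (t - c) ^ 2 + (1 / ?l\<^sup>2) * (t - c) ^ 3"
      if "L = ?l" "s = t - c" for L s
      using l unfolding that[symmetric] by (simp add: field_simps power2_eq_square power3_eq_cube)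
    from this[OF refl refl] show ?thesis unfolding a_def by (simp only: of_real_add of_real_mult of_real_power of_real_0 of_real_1)
  qed
  moreover have "a1 t = 1 + 2 * of_real (- 2 / ?l) * of_real (t - c) + 3 * of_real (1 / ?l\<^sup>2) * of_real (t - c) ^ 2" for t
    unfolding a1_def by (simp add: power_divide)
  moreover have "a2 t = 2 * of_real (- 2 / ?l) + 6 * of_real (1 / ?l\<^sup>2) * of_real (t - c)" for t
    unfolding a2_def by (simp add: power2_eq_square diff_divide_distrib)
  ultimately have "W22_fun c d a a1 a2"
    using cub by presburger
  moreover have "norm (a t) \<le> ?l \<and> norm (a2 t) \<le> 4 / ?l" if "t \<in> {c..d}" for t
  proof -
    obtain x where x: "t - c = ?l * x" "0 \<le> x" "x \<le> 1" using relative_position[OF \<open>t \<in> {c..d}\<close>] .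
    then have x': "(t - c) / ?l = x" using l by simp
    have "x * (1 - x)\<^sup>2 \<le> 1 * 1"
      using x by (intro mult_mono power_le_one) auto
    then have "\<bar>?l * (x * (1 - x)\<^sup>2)\<bar> \<le> ?l * 1"
      using x less by (simp add: abs_mult)
    \<comment> \<open>On the unit interval \<open>6 * x - 4\<close> runs from -4 to 2, whence the
      constant 4.\<close>
    moreover have "\<bar>(6 * x - 4) / ?l\<bar> \<le> 4 / ?l"
      using x less by (simp add: abs_divide divide_right_mono)
    ultimately show ?thesis unfolding a_def a2_def x' norm_of_real by simp
  qed
  moreover have "a c = 0" "a1 c = 1" by (simp_all add: a_def a1_def)
  moreover have "a d = 0" "a1 d = 0" unfolding a_def a1_def divide_self[OF l] by simp_all
  ultimately show ?thesis by blast
qed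

text \<open>The mirror image \<open>l * x^2 * (1 - x)\<close>. Its slope at \<open>d\<close> is -1,
  and with this sign the boundary terms of Green's formula reduce to \<open>f d\<close>.\<close>

lemma hermite_right:
  "\<exists>b b1 b2. W22_fun c d b b1 b2 \<and> b c = 0 \<and> b1 c = 0 \<and> b d = 0 \<and> b1 d = -1 \<and>
     (\<forall>t\<in>{c..d}. norm (b t) \<le> d - c) \<and> (\<forall>t\<in>{c..d}. norm (b2 t) \<le> 4 / (d - c))"
proof -
  let ?l = "d - c"
  define a where "a = (\<lambda>t. of_real (?l * (((t - c) / ?l)\<^sup>2 * (1 - (t - c) / ?l))) :: complex)"
  define a1 where "a1 = (\<lambda>t. of_real (2 * ((t - c) / ?l) - 3 * ((t - c) / ?l)\<^sup>2) :: complex)"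
  define a2 where "a2 = (\<lambda>t. of_real ((2 - 6 * ((t - c) / ?l)) / ?l) :: complex)"
  have l: "?l \<noteq> 0" using less by simp
  have cub: "W22_fun c d
     (\<lambda>t. 0 + 0 * of_real (t - c) + of_real (1 / ?l) * of_real (t - c) ^ 2 + of_real (- 1 / ?l\<^sup>2) * of_real (t - c) ^ 3)
     (\<lambda>t. 0 + 2 * of_real (1 / ?l) * of_real (t - c) + 3 * of_real (- 1 / ?l\<^sup>2) * of_real (t - c) ^ 2)
     (\<lambda>t. 2 * of_real (1 / ?l) + 6 * of_real (- 1 / ?l\<^sup>2) * of_real (t - c))"
    by (rule W22_fun_cubic)
  have "a t = 0 + 0 * of_real (t - c) + of_real (1 / ?l) * of_real (t - c) ^ 2 + of_real (- 1 / ?l\<^sup>2) * of_real (t - c) ^ 3" for t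
  proof -
    have "?l * (((t - c) / ?l)\<^sup>2 * (1 - (t - c) / ?l)) = 0 + 0 * (t - c) + (1 / ?l) * (t - c) ^ 2 + (- 1 / ?l\<^sup>2) * (t - c) ^ 3"
      if "L = ?l" "s = t - c" for L s
      using l unfolding that[symmetric] by (simp add: field_simps power2_eq_square power3_eq_cube)
    from this[OF refl refl] show ?thesis unfolding a_def by (simp only: of_real_add of_real_mult of_real_power of_real_0 of_real_1)
  qed
  moreover have "a1 t = 0 + 2 * of_real (1 / ?l) * of_real (t - c) + 3 * of_real (- 1 / ?l\<^sup>2) * of_real (t - c) ^ 2" for t
    unfolding a1_def by (simp add: power_divide)
  moreover have "a2 t = 2 * of_real (1 / ?l) + 6 * of_real (- 1 / ?l\<^sup>2) * of_real (t - c)" for t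
    unfolding a2_def by (simp add: power2_eq_square diff_divide_distrib)
  ultimately have "W22_fun c d a a1 a2"
    using cub by presburger
  moreover have "norm (a t) \<le> ?l \<and> norm (a2 t) \<le> 4 / ?l" if "t \<in> {c..d}" for t
  proof -
    obtain x where x: "t - c = ?l * x" "0 \<le> x" "x \<le> 1" using relative_position[OF \<open>t \<in> {c..d}\<close>] .
    then have x': "(t - c) / ?l = x" using l by simp
    have "x\<^sup>2 * (1 - x) \<le> 1 * 1"
      using x by (intro mult_mono power_le_one) auto
    then have "\<bar>?l * (x\<^sup>2 * (1 - x))\<bar> \<le> ?l * 1"
      using x less by (simp add: abs_mult)
    moreover have "\<bar>(2 - 6 * x) / ?l\<bar> \<le> 4 / ?l"
      using x less by (simp add: abs_divide divide_right_mono)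
    ultimately show ?thesis unfolding a_def a2_def x' norm_of_real by simp
  qed
  moreover have "a c = 0" "a1 c = 0" by (simp_all add: a_def a1_def)
  moreover have "a d = 0" "a1 d = -1" unfolding a_def a1_def divide_self[OF l] by simp_all
  ultimately show ?thesis by blast
qed

text \<open>The Hermite cubics have size \<open>l\<close> and second derivative of size
  \<open>4 / l\<close>; multiplied by \<open>sqrt l\<close> from \<open>green_bound\<close> and
  \<open>sqrt l\<close> from the weight, these become \<open>l\<^sup>2\<close> and 4.\<close>

lemma boundary_value_bounds:
  assumes f: "W22_fun c d f f1 f2"
  defines "B \<equiv> (d - c)\<^sup>2 * vnorm L2 (L2_class M f2) + 4 * vnorm L2 (L2_class M f)"
  shows "sqrt (d - c) * norm (f c) \<le> B" "sqrt (d - c) * norm (f d) \<le> B"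
proof -
  have *: "sqrt (d - c) * z \<le> B"
    if "z \<le> (vnorm L2 (L2_class M f2) * (d - c) + vnorm L2 (L2_class M f) * (4 / (d - c))) * sqrt (d - c)" for z
  proof -
    have "sqrt (d - c) * z \<le> sqrt (d - c) *
        ((vnorm L2 (L2_class M f2) * (d - c) + vnorm L2 (L2_class M f) * (4 / (d - c))) * sqrt (d - c))"
      using that less by (intro mult_left_mono) auto
    also have "\<dots> = (sqrt (d - c) * sqrt (d - c)) *
        (vnorm L2 (L2_class M f2) * (d - c) + vnorm L2 (L2_class M f) * (4 / (d - c)))"
      by (simp only: mult_ac)
    also have "\<dots> = B"
      using less by (simp add: B_def field_simps power2_eq_square)
    finally show ?thesis .
  qed
  obtain a a1 a2 where a: "W22_fun c d a a1 a2" "a c = 0" "a1 c = 1" "a d = 0" "a1 d = 0"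
    "\<forall>t\<in>{c..d}. norm (a t) \<le> d - c" "\<forall>t\<in>{c..d}. norm (a2 t) \<le> 4 / (d - c)"
    using hermite_left by blast
  show "sqrt (d - c) * norm (f c) \<le> B"
    using green_bound[OF f a(1), of "d - c" "4 / (d - c)"] a less by (intro *) auto
  obtain b b1 b2 where b: "W22_fun c d b b1 b2" "b c = 0" "b1 c = 0" "b d = 0" "b1 d = -1"
    "\<forall>t\<in>{c..d}. norm (b t) \<le> d - c" "\<forall>t\<in>{c..d}. norm (b2 t) \<le> 4 / (d - c)"
    using hermite_right by blast
  show "sqrt (d - c) * norm (f d) \<le> B"
    using green_bound[OF f b(1), of "d - c" "4 / (d - c)"] b less by (intro *) auto
qed

text \<open>Affine test functions have no second derivative, so the norm of \<open>f\<close> itself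
  drops out. The function falling from \<open>l\<close> to 0 yields the combination at
  \<open>c\<close> up to sign, the one rising from 0 to \<open>l\<close> yields that at
  \<open>d\<close>; the size \<open>l\<close> times \<open>sqrt l\<close> is exactly the
  denominator.\<close>

lemma boundary_derivative_bounds:
  assumes f: "W22_fun c d f f1 f2"
  shows "norm ((of_real (d - c) * f1 c + (f c - f d)) / of_real ((d - c) * sqrt (d - c))) \<le> vnorm L2 (L2_class M f2)"
    and "norm ((of_real (d - c) * f1 d + (f c - f d)) / of_real ((d - c) * sqrt (d - c))) \<le> vnorm L2 (L2_class M f2)"
proof -
  have *: "norm (z / of_real ((d - c) * sqrt (d - c))) \<le> vnorm L2 (L2_class M f2)"
    if "norm z \<le> (vnorm L2 (L2_class M f2) * (d - c) + vnorm L2 (L2_class M f) * 0) * sqrt (d - c)" for z :: complex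
  proof -
    have pos: "(d - c) * sqrt (d - c) > 0" using less by simp
    show ?thesis
      unfolding norm_divide norm_of_real abs_of_pos[OF pos] pos_divide_le_eq[OF pos]
      using that by (simp add: mult.assoc)
  qed
  have g: "W22_fun c d (\<lambda>t. of_real (d - c) - of_real (t - c)) (\<lambda>t. - 1) (\<lambda>t. 0)"
    using W22_fun_cubic[of "of_real (d - c)" "- 1" 0 0] by simp
  have h: "W22_fun c d (\<lambda>t. of_real (t - c)) (\<lambda>t. 1) (\<lambda>t. 0)"
    using W22_fun_cubic[of 0 1 0 0] by simp
  have ng: "norm (of_real (d - c) - of_real (t - c) :: complex) \<le> d - c" "norm (of_real (t - c) :: complex) \<le> d - c"
    if "t \<in> {c..d}" for t
    using that unfolding of_real_diff[symmetric] norm_of_real by auto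
  have "norm (- (of_real (d - c) * f1 c + (f c - f d))) \<le>
      (vnorm L2 (L2_class M f2) * (d - c) + vnorm L2 (L2_class M f) * 0) * sqrt (d - c)"
    using green_bound[OF f g _ ng(1), of 0] less by (simp add: algebra_simps)
  then show "norm ((of_real (d - c) * f1 c + (f c - f d)) / of_real ((d - c) * sqrt (d - c))) \<le> vnorm L2 (L2_class M f2)"
    unfolding norm_minus_cancel by (rule *)
  have "norm (of_real (d - c) * f1 d + (f c - f d)) \<le>
      (vnorm L2 (L2_class M f2) * (d - c) + vnorm L2 (L2_class M f) * 0) * sqrt (d - c)"
    using green_bound[OF f h _ ng(2), of 0] less by (simp add: algebra_simps)
  then show "norm ((of_real (d - c) * f1 d + (f c - f d)) / of_real ((d - c) * sqrt (d - c))) \<le> vnorm L2 (L2_class M f2)"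
    by (rule *)
qed

section \<open>Bounds and a right inverse depending on the length only through
  \<open>D\<close>\<close>

lemma vnorm_class_minus:
  "f \<in> L2_fun M \<Longrightarrow> vnorm L2 (L2_class M (\<lambda>t. - f t)) = vnorm L2 (L2_class M f)"
  unfolding vnorm_def by (simp add: L2_Re_ip_class L2_fun_minus)

lemma Gamma_bounds:
  assumes f: "W22_fun c d f f1 f2" and D: "d - c \<le> D"
  defines "B \<equiv> (4 * D ^ 4 + 64) * ((vnorm L2 (L2_class M f))\<^sup>2 + (vnorm L2 (L2_class M f2))\<^sup>2)"
  shows "(vnorm C2 (the (Gamma0 c d (L2_class M f))))\<^sup>2 \<le> B"
    and "(vnorm C2 (the (Gamma1 c d (L2_class M f))))\<^sup>2 \<le> B"
proof -
  let ?n = "vnorm L2 (L2_class M f)" and ?n2 = "vnorm L2 (L2_class M f2)" and ?l = "d - c"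
  have l4: "?l ^ 4 \<le> D ^ 4" using less D by (intro power_mono) auto
  define X where "X = ?l\<^sup>2 * ?n2 + 4 * ?n"
  \<comment> \<open>One factor 2 counts the two components, another comes from the square of a sum,
    and the 4 in \<open>X\<close> contributes 16; hence 4 and 64 in the constant.\<close>
  have X2: "2 * X\<^sup>2 \<le> B"
  proof -
    have "X\<^sup>2 \<le> 2 * (?l\<^sup>2 * ?n2)\<^sup>2 + 2 * (4 * ?n)\<^sup>2"
      unfolding X_def power2_sum using sum_squares_bound[of "?l\<^sup>2 * ?n2" "4 * ?n"] by linarith
    also have "\<dots> = 2 * (?l ^ 4 * ?n2\<^sup>2) + 32 * ?n\<^sup>2"
      by (simp add: power_mult_distrib flip: power_mult)
    also have "\<dots> \<le> 2 * (D ^ 4 * ?n2\<^sup>2) + 32 * ?n\<^sup>2"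
      using l4 by (intro add_mono mult_left_mono mult_right_mono) auto
    finally have "2 * X\<^sup>2 \<le> 4 * (D ^ 4 * ?n2\<^sup>2) + 64 * ?n\<^sup>2" by linarith
    moreover have "0 \<le> D ^ 4 * ?n\<^sup>2" "0 \<le> ?n2\<^sup>2" by simp_all
    moreover have "0 \<le> D ^ 4 * ?n2\<^sup>2" "0 \<le> ?n\<^sup>2" by simp_all
    ultimately show ?thesis unfolding B_def distrib_left distrib_right mult.assoc by linarith
  qed
  note v = boundary_value_bounds[OF f, folded X_def]
  have "(sqrt ?l * norm (f c))\<^sup>2 \<le> X\<^sup>2" "(sqrt ?l * norm (f d))\<^sup>2 \<le> X\<^sup>2"
    using v less by (auto intro!: power_mono)
  then show "(vnorm C2 (the (Gamma0 c d (L2_class M f))))\<^sup>2 \<le> B"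
    using X2 less unfolding Gamma_class[OF f] option.sel vnorm_C2_power2 by (simp add: norm_mult)
  note w = power_mono[OF boundary_derivative_bounds(1)[OF f] norm_ge_zero, of 2]
    power_mono[OF boundary_derivative_bounds(2)[OF f] norm_ge_zero, of 2]
  have "(vnorm C2 (the (Gamma1 c d (L2_class M f))))\<^sup>2 \<le> 2 * ?n2\<^sup>2"
    using w unfolding Gamma_class[OF f] option.sel vnorm_C2_power2 vector_2 by linarith
  also have "\<dots> \<le> B"
  proof -
    have "0 \<le> D ^ 4 * ?n\<^sup>2" "0 \<le> D ^ 4 * ?n2\<^sup>2" "0 \<le> ?n2\<^sup>2" "0 \<le> ?n\<^sup>2" by simp_all
    then show ?thesis unfolding B_def distrib_left distrib_right mult.assoc by linarith
  qed
  finally show "(vnorm C2 (the (Gamma1 c d (L2_class M f))))\<^sup>2 \<le> B" .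
qed

text \<open>The two mappings decouple. An affine function carries \<open>u\<close> and is
  annihilated by \<open>Gamma1\<close>; the Hermite cubics vanish at both end points, hence are
  annihilated by \<open>Gamma0\<close>, and their slopes carry \<open>v\<close>.\<close>

lemma Gamma_surj:
  fixes u v :: "complex ^ 2"
  assumes D: "d - c \<le> D"
  shows "\<exists>f f1 f2. W22_fun c d f f1 f2 \<and>
    Gamma0 c d (L2_class M f) = Some u \<and> Gamma1 c d (L2_class M f) = Some v \<and>
    (vnorm L2 (L2_class M f))\<^sup>2 + (vnorm L2 (L2_class M f2))\<^sup>2 \<le>
      (4 * D ^ 4 + 64) * ((vnorm C2 u)\<^sup>2 + (vnorm C2 v)\<^sup>2)"
proof -
  let ?l = "d - c"
  define r where "r = sqrt ?l"
  have l: "?l > 0" using less by simp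
  have r: "r > 0" "r * r = ?l" using less by (simp_all add: r_def)
  define L :: complex where "L = of_real ?l"
  define R :: complex where "R = of_real r"
  have LR: "L \<noteq> 0" "R \<noteq> 0" "of_real (r * ?l) = R * L" "of_real r = R" "of_real ?l = L"
    using l r by (simp_all add: L_def R_def del: of_real_diff)
  obtain a a1 a2 where a: "W22_fun c d a a1 a2" "a c = 0" "a1 c = 1" "a d = 0" "a1 d = 0"
    "\<forall>t\<in>{c..d}. norm (a t) \<le> d - c" "\<forall>t\<in>{c..d}. norm (a2 t) \<le> 4 / (d - c)"
    using hermite_left by blast
  obtain b b1 b2 where b: "W22_fun c d b b1 b2" "b c = 0" "b1 c = 0" "b d = 0" "b1 d = -1"
    "\<forall>t\<in>{c..d}. norm (b t) \<le> d - c" "\<forall>t\<in>{c..d}. norm (b2 t) \<le> 4 / (d - c)"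
    using hermite_right by blast
  \<comment> \<open>The affine function with values \<open>u $ 1 / r\<close> at \<open>c\<close> and
    \<open>- (u $ 2) / r\<close> at \<open>d\<close>.\<close>
  define p where "p t = u $ 1 / of_real r + (- (u $ 1 + u $ 2) / of_real (r * ?l)) * of_real (t - c)" for t
  define p1 where "p1 = - (u $ 1 + u $ 2) / of_real (r * ?l)"
  have p: "W22_fun c d p (\<lambda>t. p1) (\<lambda>t. 0)"
    using W22_fun_cubic[of "u $ 1 / of_real r" "- (u $ 1 + u $ 2) / of_real (r * ?l)" 0 0]
    by (simp add: p_def[abs_def] p1_def)
  \<comment> \<open>The factor \<open>r\<close> is the denominator \<open>l * r\<close> of
    \<open>Gamma1\<close> divided by the \<open>l\<close> in front of the slope; the minus sign
    compensates the slope -1 of \<open>b\<close> at \<open>d\<close>.\<close>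
  define f where "f t = p t + (of_real r * (v $ 1) * a t + - of_real r * (v $ 2) * b t)" for t
  define f1 where "f1 t = p1 + (of_real r * (v $ 1) * a1 t + - of_real r * (v $ 2) * b1 t)" for t
  define f2 where "f2 t = 0 + (of_real r * (v $ 1) * a2 t + - of_real r * (v $ 2) * b2 t)" for t
  have f: "W22_fun c d f f1 f2"
    unfolding f_def f1_def f2_def by (intro W22_fun_add p W22_fun_scale a(1) b(1))
  have fc: "f c = u $ 1 / of_real r" using a b by (simp add: f_def p_def)
  have fd: "f d = - (u $ 2) / of_real r"
  proof -
    have "f d = p d" using a b by (simp add: f_def)
    also have "\<dots> = - (u $ 2) / of_real r"
      unfolding p_def LR using LR(1,2) by (simp add: field_simps)
    finally show ?thesis .
  qed
  have lp1: "of_real ?l * p1 + (f c - f d) = 0"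
    unfolding fc fd p1_def LR using LR(1,2) by (simp add: field_simps)
  have G0: "Gamma0 c d (L2_class M f) = Some u"
    unfolding Gamma_class[OF f] r_def[symmetric] fc fd using r by (simp add: vec_eq_iff forall_2)
  have "of_real ?l * f1 c + (f c - f d) = (of_real ?l * p1 + (f c - f d)) + of_real (?l * r) * v $ 1"
    using a b by (simp add: f1_def algebra_simps)
  moreover have "of_real ?l * f1 d + (f c - f d) = (of_real ?l * p1 + (f c - f d)) + of_real (?l * r) * v $ 2"
    using a b by (simp add: f1_def algebra_simps)
  ultimately have G1: "Gamma1 c d (L2_class M f) = Some v"
    unfolding Gamma_class[OF f] r_def[symmetric] lp1 using l r by (simp add: vec_eq_iff forall_2)
  define U where "U = norm (u $ 1) + norm (u $ 2)"
  define V where "V = norm (v $ 1) + norm (v $ 2)"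
  have UV: "U \<ge> 0" "V \<ge> 0" by (simp_all add: U_def V_def)
  have combo: "norm (of_real r * (v $ 1) * z + - of_real r * (v $ 2) * w) \<le> r * V * m"
    if "norm z \<le> m" "norm w \<le> m" for z w :: complex and m
  proof -
    have "norm (of_real r * (v $ 1) * z + - of_real r * (v $ 2) * w) \<le>
        norm (of_real r * (v $ 1) * z) + norm (- of_real r * (v $ 2) * w)"
      by (rule norm_triangle_ineq)
    also have "\<dots> = r * norm (v $ 1) * norm z + r * norm (v $ 2) * norm w"
      using r by (simp add: norm_mult)
    also have "\<dots> \<le> r * norm (v $ 1) * m + r * norm (v $ 2) * m"
      using r that by (intro add_mono mult_left_mono) auto
    finally show ?thesis by (simp add: V_def algebra_simps)
  qed
  have pb: "norm (p t) \<le> U / r" if t: "t \<in> {c..d}" for t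
  proof -
    obtain x where x: "t - c = ?l * x" "0 \<le> x" "x \<le> 1" using relative_position[OF t] .
    have "p t = u $ 1 / of_real r * of_real (1 - x) - u $ 2 / of_real r * of_real x"
    proof -
      have tc: "of_real (t - c) = L * of_real x"
        by (simp only: x(1) of_real_mult L_def)
      show ?thesis
        unfolding p_def tc LR of_real_diff[of 1 x] using LR(1,2) by (simp add: field_simps)
    qed
    also have "norm \<dots> \<le> norm (u $ 1 / of_real r * of_real (1 - x)) + norm (u $ 2 / of_real r * of_real x)"
      by (rule norm_triangle_ineq4)
    also have "\<dots> = norm (u $ 1) / r * (1 - x) + norm (u $ 2) / r * x"
      using x r by (simp only: norm_mult norm_divide norm_of_real)
    also have "\<dots> \<le> norm (u $ 1) / r * 1 + norm (u $ 2) / r * 1"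
      using x r by (intro add_mono mult_left_mono) auto
    finally show ?thesis by (simp add: U_def add_divide_distrib)
  qed
  have "norm (f t) \<le> U / r + r * V * ?l" if "t \<in> {c..d}" for t
    unfolding f_def using that a b pb by (intro order_trans[OF norm_triangle_ineq] add_mono combo) auto
  then have "vnorm L2 (L2_class M f) \<le> (U / r + r * V * ?l) * r"
    unfolding r_def using UV l by (intro vnorm_class_le W22_funD(5)[OF f]) (auto simp: r_def)
  also have "\<dots> = U + ?l\<^sup>2 * V"
  proof -
    have "(U / r + r * V * ?l) * r = U + (r * r) * V * ?l"
      using r(1) by (simp add: field_simps)
    then show ?thesis unfolding r(2) by (simp add: power2_eq_square)
  qed
  finally have nf: "vnorm L2 (L2_class M f) \<le> U + ?l\<^sup>2 * V" .
  have "norm (f2 t) \<le> r * V * (4 / ?l)" if "t \<in> {c..d}" for t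
    unfolding f2_def add_0 using that a b by (intro combo) auto
  then have "vnorm L2 (L2_class M f2) \<le> (r * V * (4 / ?l)) * r"
    unfolding r_def using UV l by (intro vnorm_class_le W22_funD(7)[OF f]) (auto simp: r_def)
  also have "\<dots> = (r * r) * V * (4 / ?l)" by simp
  also have "\<dots> = 4 * V" unfolding r(2) using l by simp
  finally have nf2: "vnorm L2 (L2_class M f2) \<le> 4 * V" .
  have l4: "?l ^ 4 \<le> D ^ 4" using less D by (intro power_mono) auto
  have "(norm (w $ 1) + norm (w $ 2))\<^sup>2 \<le> 2 * (vnorm C2 w)\<^sup>2" for w :: "complex ^ 2"
  proof -
    have "(p + q)\<^sup>2 \<le> 2 * (p\<^sup>2 + q\<^sup>2)" for p q :: real
      using sum_squares_bound[of p q] by (simp add: power2_sum)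
    then show ?thesis unfolding vnorm_C2_power2 .
  qed
  then have U2: "U\<^sup>2 \<le> 2 * (vnorm C2 u)\<^sup>2" and V2: "V\<^sup>2 \<le> 2 * (vnorm C2 v)\<^sup>2"
    unfolding U_def V_def by blast+
  have "(vnorm L2 (L2_class M f))\<^sup>2 \<le> (U + ?l\<^sup>2 * V)\<^sup>2"
    by (intro power_mono nf L2.vnorm_nonneg L2_class_closed W22_funD(5)[OF f])
  also have "\<dots> \<le> 2 * U\<^sup>2 + 2 * (?l\<^sup>2 * V)\<^sup>2"
    unfolding power2_sum using sum_squares_bound[of U "?l\<^sup>2 * V"] by linarith
  also have "\<dots> = 2 * U\<^sup>2 + 2 * (?l ^ 4 * V\<^sup>2)"
    by (simp add: power_mult_distrib flip: power_mult)
  also have "\<dots> \<le> 2 * (2 * (vnorm C2 u)\<^sup>2) + 2 * (D ^ 4 * (2 * (vnorm C2 v)\<^sup>2))"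
    using l4 U2 V2 by (intro add_mono mult_left_mono mult_mono) auto
  finally have 1: "(vnorm L2 (L2_class M f))\<^sup>2 \<le> 4 * (vnorm C2 u)\<^sup>2 + 4 * (D ^ 4 * (vnorm C2 v)\<^sup>2)" by simp
  have "(vnorm L2 (L2_class M f2))\<^sup>2 \<le> (4 * V)\<^sup>2"
    by (intro power_mono nf2 L2.vnorm_nonneg L2_class_closed W22_funD(7)[OF f])
  then have 2: "(vnorm L2 (L2_class M f2))\<^sup>2 \<le> 32 * (vnorm C2 v)\<^sup>2"
    using V2 by (simp add: power_mult_distrib)
  \<comment> \<open>The two estimates add up to coefficients 4 for \<open>u\<close> and
    \<open>4 * D ^ 4 + 32\<close> for \<open>v\<close>, below the constant already required by
    \<open>Gamma_bounds\<close>, so one \<open>C\<close> serves both purposes.\<close>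
  have "0 \<le> D ^ 4 * (vnorm C2 u)\<^sup>2" "0 \<le> D ^ 4 * (vnorm C2 v)\<^sup>2" "0 \<le> (vnorm C2 u)\<^sup>2" "0 \<le> (vnorm C2 v)\<^sup>2" by simp_all
  then have "(vnorm L2 (L2_class M f))\<^sup>2 + (vnorm L2 (L2_class M f2))\<^sup>2 \<le>
      (4 * D ^ 4 + 64) * ((vnorm C2 u)\<^sup>2 + (vnorm C2 v)\<^sup>2)"
    unfolding distrib_left distrib_right mult.assoc using 1 2 by linarith
  then show ?thesis using f G0 G1 by blast
qed

section \<open>The triplet of a single interval\<close>

lemma Gamma_eq_zero_iff:
  assumes f: "W22_fun c d f f1 f2"
  shows "Gamma0 c d (L2_class M f) = Some 0 \<and> Gamma1 c d (L2_class M f) = Some 0 \<longleftrightarrow>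
    f c = 0 \<and> f1 c = 0 \<and> f d = 0 \<and> f1 d = 0"
  unfolding Gamma_class[OF f] using less by (auto simp: vec_eq_iff forall_2 simp flip: of_real_diff)

lemma dom_Gamma: "dom (Gamma0 c d) = W22 c d" "dom (Gamma1 c d) = W22 c d"
  by (auto simp: Gamma0_def Gamma1_def Let_def split: if_splits)

lemma linear_Gamma: "linear_op L2 C2 (Gamma0 c d)" "linear_op L2 C2 (Gamma1 c d)"
proof -
  have L: "W22 c d \<subseteq> carrier L2" by (auto simp: W22_def)
  have zero: "vzero L2 \<in> W22 c d"
    using W22_classD(1)[OF W22_fun_cubic[of 0 0 0 0]] by (simp add: L2_vzero)
  have lin: "linear_op L2 C2 \<Gamma>" if dom: "dom \<Gamma> = W22 c d"
    and add: "\<And>f f1 f2 g g1 g2. W22_fun c d f f1 f2 \<Longrightarrow> W22_fun c d g g1 g2 \<Longrightarrow>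
      \<Gamma> (L2_class M (\<lambda>t. f t + g t)) = Some (the (\<Gamma> (L2_class M f)) + the (\<Gamma> (L2_class M g)))"
    and scale: "\<And>a f f1 f2. W22_fun c d f f1 f2 \<Longrightarrow>
      \<Gamma> (L2_class M (\<lambda>t. a * f t)) = Some (a *s the (\<Gamma> (L2_class M f)))" for \<Gamma>
    unfolding linear_op_def dom C2_simps
  proof (intro conjI ballI allI L zero)
    fix u a assume "u \<in> W22 c d"
    then obtain f f1 f2 where f: "W22_fun c d f f1 f2" "u = L2_class M f" by (rule W22E)
    show "\<Gamma> (vscale L2 a u) = Some (a *s the (\<Gamma> u))"
      using scale[OF f(1)] W22_funD(5)[OF f(1)] by (simp add: f(2) L2_vscale_class)
    fix w assume "w \<in> W22 c d"
    then obtain g g1 g2 where g: "W22_fun c d g g1 g2" "w = L2_class M g" by (rule W22E)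
    show "\<Gamma> (vadd L2 u w) = Some (the (\<Gamma> u) + the (\<Gamma> w))"
      using add[OF f(1) g(1)] W22_funD(5)[OF f(1)] W22_funD(5)[OF g(1)] by (simp add: f(2) g(2) L2_vadd_class)
  qed simp
  show "linear_op L2 C2 (Gamma0 c d)"
  proof (rule lin[OF dom_Gamma(1)])
    fix f f1 f2 g g1 g2 a assume f: "W22_fun c d f f1 f2"
    show "Gamma0 c d (L2_class M (\<lambda>t. a * f t)) = Some (a *s the (Gamma0 c d (L2_class M f)))"
      unfolding Gamma_class[OF f] Gamma_class[OF W22_fun_scale[OF f]] by (simp add: vec_eq_iff forall_2)
    assume g: "W22_fun c d g g1 g2"
    show "Gamma0 c d (L2_class M (\<lambda>t. f t + g t)) = Some (the (Gamma0 c d (L2_class M f)) + the (Gamma0 c d (L2_class M g)))"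
      unfolding Gamma_class[OF f] Gamma_class[OF g] Gamma_class[OF W22_fun_add[OF f g]]
      by (simp add: vec_eq_iff forall_2 algebra_simps)
  qed
  show "linear_op L2 C2 (Gamma1 c d)"
  proof (rule lin[OF dom_Gamma(2)])
    fix f f1 f2 g g1 g2 a assume f: "W22_fun c d f f1 f2"
    show "Gamma1 c d (L2_class M (\<lambda>t. a * f t)) = Some (a *s the (Gamma1 c d (L2_class M f)))"
      unfolding Gamma_class[OF f] Gamma_class[OF W22_fun_scale[OF f]]
      by (simp add: vec_eq_iff forall_2) (simp add: algebra_simps)
    assume g: "W22_fun c d g g1 g2"
    show "Gamma1 c d (L2_class M (\<lambda>t. f t + g t)) = Some (the (Gamma1 c d (L2_class M f)) + the (Gamma1 c d (L2_class M g)))"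
      unfolding Gamma_class[OF f] Gamma_class[OF g] Gamma_class[OF W22_fun_add[OF f g]]
      by (simp add: vec_eq_iff forall_2 flip: add_divide_distrib) (simp add: algebra_simps)
  qed
qed

theorem bounded_triplet_interval:
  assumes D: "d - c \<le> D"
  shows "bounded_triplet L2 (H_op c d) (H_max c d) C2 (Gamma0 c d) (Gamma1 c d) (L2_cnj M) (4 * D ^ 4 + 64)"
proof
  show "hilbert_space L2" "hilbert_space C2"
    by (intro hilbert_space_L2 finite_measure hilbert_space_C2)+
  show "H_max c d g = Some h \<longleftrightarrow> adj_pair L2 (H_op c d) g h" for g h
    by (rule adj_pair_H_op_iff)
  show "h = vzero L2" if "h \<in> carrier L2" "\<And>f. f \<in> dom (H_op c d) \<Longrightarrow> ip L2 f h = 0" for h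
    using that by (rule total_H_op)
  show "dom (Gamma0 c d) = dom (H_max c d)" "dom (Gamma1 c d) = dom (H_max c d)"
    by (simp_all add: dom_Gamma dom_H_max)
  show "linear_op L2 C2 (Gamma0 c d)" "linear_op L2 C2 (Gamma1 c d)"
    by (rule linear_Gamma)+
  show "H_op c d = H_max c d |` {f. Gamma0 c d f = Some (vzero C2) \<and> Gamma1 c d f = Some (vzero C2)}"
  proof
    fix u
    show "H_op c d u = (H_max c d |` {f. Gamma0 c d f = Some (vzero C2) \<and> Gamma1 c d f = Some (vzero C2)}) u"
    proof (cases "u \<in> W22 c d")
      case True
      then obtain f f1 f2 where f: "W22_fun c d f f1 f2" "u = L2_class M f" by (rule W22E)
      have "u \<in> W22_0 c d \<longleftrightarrow> Gamma0 c d u = Some 0 \<and> Gamma1 c d u = Some 0"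
        unfolding f(2) Gamma_eq_zero_iff[OF f(1)] W22_0_class_iff[OF f(1)] ..
      then show ?thesis
        using True by (simp add: H_op_def H_max_def restrict_map_def C2_simps)
    next
      case False
      then show ?thesis by (auto simp: H_op_def H_max_def restrict_map_def W22_0_def)
    qed
  qed
  show "(vnorm C2 (the (Gamma0 c d u)))\<^sup>2 \<le> (4 * D ^ 4 + 64) * ((vnorm L2 u)\<^sup>2 + (vnorm L2 (the (H_max c d u)))\<^sup>2)"
    "(vnorm C2 (the (Gamma1 c d u)))\<^sup>2 \<le> (4 * D ^ 4 + 64) * ((vnorm L2 u)\<^sup>2 + (vnorm L2 (the (H_max c d u)))\<^sup>2)"
    if "u \<in> dom (H_max c d)" for u
  proof -
    obtain f f1 f2 where f: "W22_fun c d f f1 f2" "u = L2_class M f"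
      "H_max c d u = Some (L2_class M (\<lambda>t. - f2 t))"
      using \<open>u \<in> dom (H_max c d)\<close> by (rule dom_H_maxE)
    have "vnorm L2 (the (H_max c d u)) = vnorm L2 (L2_class M f2)"
      unfolding f(3) option.sel by (rule vnorm_class_minus[OF W22_funD(7)[OF f(1)]])
    then show "(vnorm C2 (the (Gamma0 c d u)))\<^sup>2 \<le> (4 * D ^ 4 + 64) * ((vnorm L2 u)\<^sup>2 + (vnorm L2 (the (H_max c d u)))\<^sup>2)"
      "(vnorm C2 (the (Gamma1 c d u)))\<^sup>2 \<le> (4 * D ^ 4 + 64) * ((vnorm L2 u)\<^sup>2 + (vnorm L2 (the (H_max c d u)))\<^sup>2)"
      using Gamma_bounds[OF f(1) D] unfolding f(2) by simp_all
  qed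
  show "ip L2 (the (H_max c d u)) w - ip L2 u (the (H_max c d w)) =
      ip C2 (the (Gamma1 c d u)) (the (Gamma0 c d w)) - ip C2 (the (Gamma0 c d u)) (the (Gamma1 c d w))"
    if u: "u \<in> dom (H_max c d)" and w: "w \<in> dom (H_max c d)" for u w
  proof -
    obtain f f1 f2 where f: "W22_fun c d f f1 f2" "u = L2_class M f"
      "H_max c d u = Some (L2_class M (\<lambda>t. - f2 t))"
      using u by (rule dom_H_maxE)
    obtain g g1 g2 where g: "W22_fun c d g g1 g2" "w = L2_class M g"
      "H_max c d w = Some (L2_class M (\<lambda>t. - g2 t))"
      using w by (rule dom_H_maxE)
    note L = W22_funD(5,7)[OF f(1)] W22_funD(5,7)[OF g(1)]
    define r where "r = sqrt (d - c)"
    have r: "r > 0" "d - c = r * r" using less by (simp_all add: r_def)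
    have "ip L2 (the (H_max c d u)) w - ip L2 u (the (H_max c d w)) =
        - ((LINT t|M. f2 t * cnj (g t)) - (LINT t|M. f t * cnj (g2 t)))"
      unfolding f(3) g(3) option.sel using L by (simp add: f(2) g(2) L2_ip_class L2_fun_minus)
    also have "\<dots> = f1 c * cnj (g c) - f c * cnj (g1 c) - (f1 d * cnj (g d) - f d * cnj (g1 d))"
      unfolding green_formula[OF f(1) g(1)] by simp
    \<comment> \<open>The chord terms cancel between the two products. Writing \<open>d - c\<close>
      as \<open>r * r\<close> makes what remains a rational identity in \<open>r\<close>.\<close>
    also have "\<dots> = ip C2 (the (Gamma1 c d u)) (the (Gamma0 c d w)) - ip C2 (the (Gamma0 c d u)) (the (Gamma1 c d w))"
      unfolding f(2) g(2) Gamma_class[OF f(1)] Gamma_class[OF g(1)] option.sel ip_C2 vector_2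
        r_def[symmetric] unfolding r(2) using r(1) by (simp add: field_simps)
    finally show ?thesis .
  qed
  show "\<exists>w. Gamma0 c d w = Some u \<and> Gamma1 c d w = Some v \<and>
      (vnorm L2 w)\<^sup>2 + (vnorm L2 (the (H_max c d w)))\<^sup>2 \<le> (4 * D ^ 4 + 64) * ((vnorm C2 u)\<^sup>2 + (vnorm C2 v)\<^sup>2)"
    for u v
  proof -
    obtain f f1 f2 where f: "W22_fun c d f f1 f2" "Gamma0 c d (L2_class M f) = Some u"
      "Gamma1 c d (L2_class M f) = Some v"
      "(vnorm L2 (L2_class M f))\<^sup>2 + (vnorm L2 (L2_class M f2))\<^sup>2 \<le>
        (4 * D ^ 4 + 64) * ((vnorm C2 u)\<^sup>2 + (vnorm C2 v)\<^sup>2)"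
      using Gamma_surj[OF D, of u v] by blast
    have "vnorm L2 (the (H_max c d (L2_class M f))) = vnorm L2 (L2_class M f2)"
      unfolding H_max_class[OF f(1)] option.sel by (rule vnorm_class_minus[OF W22_funD(7)[OF f(1)]])
    then show ?thesis using f by (intro exI[of _ "L2_class M f"]) simp
  qed
  show "L2_cnj M u \<in> carrier L2" "L2_cnj M (L2_cnj M u) = u" if "u \<in> carrier L2" for u
    using that by (rule L2_cnj_closed L2_cnj_cnj)+
  show "ip L2 (L2_cnj M u) (L2_cnj M v) = cnj (ip L2 u v)" if "u \<in> carrier L2" "v \<in> carrier L2" for u v
    using that by (rule L2_ip_cnj)
  show "H_op c d (L2_cnj M u) = Some (L2_cnj M (the (H_op c d u)))" if "u \<in> dom (H_op c d)" for u
  proof -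
    obtain f f1 f2 where f: "W22_fun c d f f1 f2" "f c = 0" "f1 c = 0" "f d = 0" "f1 d = 0"
      "u = L2_class M f" "H_op c d u = Some (L2_class M (\<lambda>t. - f2 t))"
      using \<open>u \<in> dom (H_op c d)\<close> by (rule dom_H_opE)
    note L = W22_funD(5,7)[OF f(1)]
    have "H_op c d (L2_class M (\<lambda>t. cnj (f t))) = Some (L2_class M (\<lambda>t. - cnj (f2 t)))"
      using f by (intro H_op_class[OF W22_fun_cnj[OF f(1)]]) auto
    then show ?thesis
      unfolding f(7) option.sel using L by (simp add: f(6) L2_cnj_class L2_fun_minus)
  qed
qed

end

theorem theorem4p1:
  fixes b :: ereal and x :: "nat \<Rightarrow> real"
  assumes "0 < b"
    and "x 0 = 0"
    and "strict_mono x"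
    and "\<And>n. ereal (x n) < b"
    and "(\<lambda>n. ereal (x n)) \<longlonglongrightarrow> b"
    and "bdd_above (range (\<lambda>n. x (Suc n) - x n))"
  shows "(\<forall>n\<ge>1. boundary_triplet (L2_int (x (n - 1)) (x n)) (H_op (x (n - 1)) (x n))
                   C2 (Gamma0 (x (n - 1)) (x n)) (Gamma1 (x (n - 1)) (x n)))
       \<and> boundary_triplet (L2_sum x) (H_min x) l2_C2 (Gamma0_sum x) (Gamma1_sum x)"
proof -
  obtain D where D: "\<And>n. x (Suc n) - x n \<le> D"
    using assms(6) by (auto simp: bdd_above_def)
  have tri: "bounded_triplet (L2_int (x n) (x (Suc n))) (H_op (x n) (x (Suc n))) (H_max (x n) (x (Suc n)))
      C2 (Gamma0 (x n) (x (Suc n))) (Gamma1 (x n) (x (Suc n)))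
      (L2_cnj (lebesgue_on {x n..x (Suc n)})) (4 * D ^ 4 + 64)" for n
    by (intro compact_interval.bounded_triplet_interval compact_interval.intro D strict_monoD[OF assms(3)]) simp
  \<comment> \<open>Intervals are numbered from 1 in the first claim and from 0 in the direct sum,
    hence the shift to \<open>n - 1\<close>.\<close>
  have "boundary_triplet (L2_int (x (n - 1)) (x n)) (H_op (x (n - 1)) (x n))
      C2 (Gamma0 (x (n - 1)) (x n)) (Gamma1 (x (n - 1)) (x n))" if "n \<ge> 1" for n
    using bounded_triplet.boundary_triplet[OF tri[of "n - 1"]] that by simp
  moreover have "boundary_triplet (L2_sum x) (H_min x) l2_C2 (Gamma0_sum x) (Gamma1_sum x)"
    unfolding L2_sum_def H_min_def l2_C2_def Gamma0_sum_def Gamma1_sum_def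
    by (rule bounded_triplet.boundary_triplet[OF bounded_triplet_dsum[OF tri]])
  ultimately show ?thesis by blast
qed

end
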